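(* Let $\rho\in C^{1,1}(1,\infty)$ be a positive, decreasing function with $\rho(z)\to0$ as $z\to+\infty$ and $$\operatorname*{ess\,liminf}_{z\to+\infty}\big[\rho'(z)^2-\rho(z)\rho''(z)\big]>-1,$$ and let $\Omega=\{(\bar x,z)\in\mathbb R^2\times(1,\infty):|\bar x|<\rho(z)\}$. For $Z>1$ let $\Omega^Z=\Omega\cap\{(\bar x,z)\in\mathbb R^3: z>Z\}$. Then there exist $Z_0>1$ and $C>0$ such that $$\|w\|^2_{L^2(\Omega)^3}\le C\rho(Z)^2\big(\|\operatorname{curl}w\|^2_{L^2(\Omega)^3}+\|\operatorname{div}w\|^2_{L^2(\Omega)}\big)$$ for all $Z\ge Z_0$ and every $w\in X_N(\Omega)$ with $\operatorname{supp}w\subset\Omega^Z$.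
   Context: $X_N(\Omega)=H_0(\operatorname{curl},\Omega)\cap H(\operatorname{div},\Omega)$, where $H(\operatorname{div},\Omega)=\{u\in L^2(\Omega)^3:\operatorname{div}u\in L^2(\Omega)\}$, $H(\operatorname{curl},\Omega)=\{u\in L^2(\Omega)^3:\operatorname{curl}u\in L^2(\Omega)^3\}$, and $H_0(\operatorname{curl},\Omega)$ is the closure of $C_c^\infty(\Omega)^3$ in $H(\operatorname{curl},\Omega)$ with respect to the norm $(\|u\|^2+\|\operatorname{curl}u\|^2)^{1/2}$ (equivalently, $\nu\times u=0$ on $\partial\Omega$ when $\Omega$ is locally Lipschitz). Supports may touch the lateral boundary of $\Omega$. *)

theory Defs
  imports "HOL-Analysis.Analysis"
begin

text \<open>
  All function spaces are complex; elements are represented by functions (not by classes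
  modulo null sets), and only their values on \<open>\<Omega>\<close> matter.
\<close>

definition L2 :: "'a::euclidean_space set \<Rightarrow> ('a \<Rightarrow> 'b::real_normed_vector) set" where
  "L2 \<Omega> = {f. f \<in> borel_measurable (lebesgue_on \<Omega>)
             \<and> integrable (lebesgue_on \<Omega>) (\<lambda>x. (norm (f x))\<^sup>2)}"

definition L2_norm :: "'a::euclidean_space set \<Rightarrow> ('a \<Rightarrow> 'b::real_normed_vector) \<Rightarrow> real" where
  "L2_norm \<Omega> f = sqrt (\<integral>x. (norm (f x))\<^sup>2 \<partial>lebesgue_on \<Omega>)"

primrec C_k :: "nat \<Rightarrow> ('a::real_normed_vector \<Rightarrow> 'b::real_normed_vector) \<Rightarrow> bool" where
  "C_k 0 f \<longleftrightarrow> continuous_on UNIV f"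
| "C_k (Suc k) f \<longleftrightarrow> (\<forall>x. f differentiable (at x))
                    \<and> (\<forall>v. C_k k (\<lambda>x. frechet_derivative f (at x) v))"

text \<open>\<open>C\<^sub>c\<^sup>\<infinity>(\<Omega>)\<close>; its elements are extended by zero to the whole space.\<close>

definition test_functions ::
    "'a::real_normed_vector set \<Rightarrow> ('a \<Rightarrow> 'b::real_normed_vector) set" where
  "test_functions \<Omega> = {\<phi>. (\<forall>k. C_k k \<phi>)
      \<and> compact (closure {x. \<phi> x \<noteq> 0}) \<and> closure {x. \<phi> x \<noteq> 0} \<subseteq> \<Omega>}"

definition partial_deriv :: "3 \<Rightarrow> (real^3 \<Rightarrow> 'b::real_normed_vector) \<Rightarrow> real^3 \<Rightarrow> 'b" where
  "partial_deriv i f x = frechet_derivative f (at x) (axis i 1)"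

definition grad :: "(real^3 \<Rightarrow> complex) \<Rightarrow> real^3 \<Rightarrow> complex^3" where
  "grad f x = (\<chi> i. partial_deriv i f x)"

definition curl :: "(real^3 \<Rightarrow> complex^3) \<Rightarrow> real^3 \<Rightarrow> complex^3" where
  "curl f x = vector
     [partial_deriv 2 (\<lambda>y. f y $ 3) x - partial_deriv 3 (\<lambda>y. f y $ 2) x,
      partial_deriv 3 (\<lambda>y. f y $ 1) x - partial_deriv 1 (\<lambda>y. f y $ 3) x,
      partial_deriv 1 (\<lambda>y. f y $ 2) x - partial_deriv 2 (\<lambda>y. f y $ 1) x]"

text \<open>The bilinear product, without complex conjugation.\<close>

definition cdot :: "complex^3 \<Rightarrow> complex^3 \<Rightarrow> complex" where
  "cdot a b = (\<Sum>i\<in>UNIV. a $ i * b $ i)"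

definition is_weak_curl ::
    "(real^3) set \<Rightarrow> (real^3 \<Rightarrow> complex^3) \<Rightarrow> (real^3 \<Rightarrow> complex^3) \<Rightarrow> bool" where
  "is_weak_curl \<Omega> u c \<longleftrightarrow> c \<in> L2 \<Omega> \<and> (\<forall>\<phi>\<in>test_functions \<Omega>.
     (\<integral>x. cdot (u x) (curl \<phi> x) \<partial>lebesgue_on \<Omega>) = (\<integral>x. cdot (c x) (\<phi> x) \<partial>lebesgue_on \<Omega>))"

definition is_weak_div ::
    "(real^3) set \<Rightarrow> (real^3 \<Rightarrow> complex^3) \<Rightarrow> (real^3 \<Rightarrow> complex) \<Rightarrow> bool" where
  "is_weak_div \<Omega> u d \<longleftrightarrow> d \<in> L2 \<Omega> \<and> (\<forall>\<phi>\<in>test_functions \<Omega>.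
     (\<integral>x. cdot (u x) (grad \<phi> x) \<partial>lebesgue_on \<Omega>) = - (\<integral>x. d x * \<phi> x \<partial>lebesgue_on \<Omega>))"

text \<open>For \<open>\<Omega>\<close> open, the chosen representative is unique almost everywhere on \<open>\<Omega>\<close>.\<close>

definition weak_curl :: "(real^3) set \<Rightarrow> (real^3 \<Rightarrow> complex^3) \<Rightarrow> real^3 \<Rightarrow> complex^3" where
  "weak_curl \<Omega> u = (SOME c. is_weak_curl \<Omega> u c)"

definition weak_div :: "(real^3) set \<Rightarrow> (real^3 \<Rightarrow> complex^3) \<Rightarrow> real^3 \<Rightarrow> complex" where
  "weak_div \<Omega> u = (SOME d. is_weak_div \<Omega> u d)"

definition H_curl :: "(real^3) set \<Rightarrow> (real^3 \<Rightarrow> complex^3) set" where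
  "H_curl \<Omega> = {u \<in> L2 \<Omega>. \<exists>c. is_weak_curl \<Omega> u c}"

definition H_div :: "(real^3) set \<Rightarrow> (real^3 \<Rightarrow> complex^3) set" where
  "H_div \<Omega> = {u \<in> L2 \<Omega>. \<exists>d. is_weak_div \<Omega> u d}"

definition H_curl_norm :: "(real^3) set \<Rightarrow> (real^3 \<Rightarrow> complex^3) \<Rightarrow> real" where
  "H_curl_norm \<Omega> u = sqrt ((L2_norm \<Omega> u)\<^sup>2 + (L2_norm \<Omega> (weak_curl \<Omega> u))\<^sup>2)"

definition H0_curl :: "(real^3) set \<Rightarrow> (real^3 \<Rightarrow> complex^3) set" where
  "H0_curl \<Omega> = {u \<in> H_curl \<Omega>. \<forall>\<epsilon>>0. \<exists>\<phi>\<in>test_functions \<Omega>. H_curl_norm \<Omega> (\<lambda>x. u x - \<phi> x) < \<epsilon>}"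

definition X_N :: "(real^3) set \<Rightarrow> (real^3 \<Rightarrow> complex^3) set" where
  "X_N \<Omega> = H0_curl \<Omega> \<inter> H_div \<Omega>"

text \<open>
  The support of a class modulo null sets, closed relative to \<open>\<Omega>\<close>: boundary points of \<open>\<Omega>\<close>
  never belong to it, so it may accumulate at the boundary and still lie inside \<open>\<Omega>\<close>.
\<close>

definition ess_supp :: "'a::euclidean_space set \<Rightarrow> ('a \<Rightarrow> 'b::real_normed_vector) \<Rightarrow> 'a set" where
  "ess_supp \<Omega> f = {x \<in> \<Omega>. \<forall>U. open U \<and> x \<in> U \<longrightarrow> \<not> (AE y in lebesgue_on (U \<inter> \<Omega>). f y = 0)}"

text \<open>
  \<open>C\<^sup>1\<^sup>,\<^sup>1(S)\<close> for open \<open>S\<close>: the derivative is Lipschitz on compact subsets of \<open>S\<close>, not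
  necessarily on all of \<open>S\<close>.
\<close>

definition C11_on :: "real set \<Rightarrow> (real \<Rightarrow> real) \<Rightarrow> bool" where
  "C11_on S f \<longleftrightarrow> (\<forall>z\<in>S. f differentiable (at z))
     \<and> (\<forall>K. compact K \<and> K \<subseteq> S \<longrightarrow> (\<exists>L. L-lipschitz_on K (deriv f)))"

text \<open>
  The limit inferior as \<open>z \<rightarrow> \<infinity>\<close> up to null sets: the largest number that is a limit of
  essential infima over \<open>(a, \<infinity>)\<close>. The filter is described by the lemma below.
\<close>

definition ess_liminf_at_top :: "(real \<Rightarrow> ereal) \<Rightarrow> ereal" where
  "ess_liminf_at_top f = Liminf (inf at_top (ae_filter lebesgue)) f"

lemma eventually_inf_at_top_ae_filter:
  "eventually P (inf at_top (ae_filter lebesgue)) \<longleftrightarrow>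
     (\<exists>a::real. AE z in lebesgue. a < z \<longrightarrow> P z)"
proof
  assume "eventually P (inf at_top (ae_filter lebesgue))"
  then obtain Q R where Q: "eventually Q at_top" and R: "AE z in lebesgue. R z"
    and P: "\<And>z. Q z \<Longrightarrow> R z \<Longrightarrow> P z"
    unfolding eventually_inf by blast
  from Q obtain a where a: "\<And>z. a < z \<Longrightarrow> Q z"
    unfolding eventually_at_top_dense by blast
  have "AE z in lebesgue. a < z \<longrightarrow> P z"
    using R by eventually_elim (use P a in blast)
  then show "\<exists>a. AE z in lebesgue. a < z \<longrightarrow> P z" ..
next
  assume "\<exists>a. AE z in lebesgue. a < z \<longrightarrow> P z"
  then obtain a where "AE z in lebesgue. a < z \<longrightarrow> P z" ..
  then show "eventually P (inf at_top (ae_filter lebesgue))"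
    unfolding eventually_inf using eventually_gt_at_top[of a] by blast
qed

definition horn :: "(real \<Rightarrow> real) \<Rightarrow> (real^3) set" where
  "horn \<rho> = {x. 1 < x $ 3 \<and> sqrt ((x $ 1)\<^sup>2 + (x $ 2)\<^sup>2) < \<rho> (x $ 3)}"

end

theory Submission
  imports Defs
begin

text \<open>
  The field \<open>w\<close> is tested against smooth fields \<open>f\<close> with compact support in the horn whose
  conjugates approximate \<open>w\<close> in \<open>H(curl)\<close>. Each \<open>f\<close> is split as \<open>f = \<nabla>p + (f - \<nabla>p)\<close>, so that
    \<open>\<integral> w \<cdot> f = \<integral> w \<cdot> (f - \<nabla>p) - \<integral> (div w) p\<close>.
  As the left side tends to \<open>\<parallel>w\<parallel>\<^sup>2\<close>, it is enough to find a potential \<open>p\<close> of class \<open>C\<^sup>1\<close> that vanishes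
  near the lateral boundary and satisfies, in the norms of \<open>L\<^sup>2\<close> above height \<open>Z\<close>,
    \<open>\<parallel>f - \<nabla>p\<parallel> \<le> C \<rho>(Z) \<parallel>curl f\<parallel>\<close>  and  \<open>\<parallel>p\<parallel> \<le> C \<rho>(Z) \<parallel>f\<parallel>\<close>,
  with \<open>C\<close> independent of \<open>f\<close> (\<open>integral_gradient_error\<close>, \<open>integral_potential_square\<close>).

  The potential comes from line integrals of \<open>f\<close> along rays that go upwards and outwards. As \<open>\<rho>\<close>
  decreases, such a ray never enters the horn once it is outside and points away from the axis,
  and a ray that starts in the horn above height \<open>Z\<close> leaves it after a time of at most
  \<open>2 \<rho>(Z)\<close>. For the direction \<open>e\<close> let \<open>P\<^sub>e(x) = - \<integral> f(x + t e) \<cdot> e dt\<close>. Then \<open>f - \<nabla>P\<^sub>e\<close> is an integral of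
  \<open>curl f\<close> along the same ray, and both integrals are bounded in \<open>L\<^sup>2\<close> by the Cauchy-Schwarz
  inequality, Fubini's theorem and translation invariance.

  However, \<open>P\<^sub>e\<close> vanishes only on that half of the outside into which \<open>e\<close> points. The four directions
  \<open>(\<plusminus>1, 0, 1)\<close> and \<open>(0, \<plusminus>1, 1)\<close> together cover the outside, and \<open>p\<close> blends the four potentials with
  cutoff functions of \<open>x\<^sub>1/\<mu>(x\<^sub>3)\<close> and \<open>x\<^sub>2/\<mu>(x\<^sub>3)\<close>. The gradients of the cutoff functions are of size
  \<open>1/\<mu>\<close> and multiply differences of two potentials. By Stokes' theorem such a difference is the flux
  of \<open>curl f\<close> through the quadrant spanned by the two rays (\<open>ray_potential_diff\<close>). Where the cutoff
  functions vary, this quadrant meets the horn only in a square of side \<open>3 \<mu>\<close>, and the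
  Cauchy-Schwarz inequality on that square yields the factor \<open>\<mu>\<close> which compensates \<open>1/\<mu>\<close>
  (\<open>potential_error_le\<close>).

  All this needs a scale \<open>\<mu>\<close> with bounded derivative, whereas the slope of \<open>\<rho>\<close> may be unbounded.
  The root \<open>\<lambda>\<close> of \<open>\<rho>(z + \<lambda>) = \<lambda>\<close>, the time after which a ray of slope one from height \<open>z\<close> on the axis
  leaves the horn, is 1-Lipschitz in \<open>z\<close> for every decreasing \<open>\<rho>\<close>, and \<open>\<mu> = \<lambda>/2\<close> (\<open>exit_scale_exists\<close>).

  The norm of \<open>H(curl)\<close> involves an arbitrarily chosen weak curl of the difference between \<open>w\<close> and
  its approximant, so weak curls have to be unique almost everywhere (\<open>is_weak_curl_unique\<close>). And since \<open>p\<close> is only of class \<open>C\<^sup>1\<close>, the identity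
  defining the weak divergence is extended to such functions by mollification (\<open>is_weak_div_C1\<close>).
\<close>

section \<open>Functions of class \<open>C\<^sup>k\<close>\<close>

lemma C_k_SucI:
  assumes "\<And>x. (f has_derivative f' x) (at x)" and "\<And>v. C_k k (\<lambda>x. f' x v)"
  shows "C_k (Suc k) f"
proof -
  have "frechet_derivative f (at x) = f' x" for x
    using frechet_derivative_at[OF assms(1)] by simp
  then show ?thesis
    using assms by (auto simp: differentiable_def)
qed

lemma C_k_SucD:
  assumes "C_k (Suc k) f"
  shows "(f has_derivative frechet_derivative f (at x)) (at x)"
    and "C_k k (\<lambda>x. frechet_derivative f (at x) v)"
  using assms by (auto simp: frechet_derivative_works)

lemma C_k_lower: "C_k (Suc k) f \<Longrightarrow> C_k k f"
proof (induction k arbitrary: f)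
  case 0
  then show ?case
    by (auto intro!: continuous_at_imp_continuous_on differentiable_imp_continuous_within)
next
  case (Suc k)
  show ?case
    using C_k_SucD[OF Suc.prems] Suc.IH by (intro C_k_SucI) auto
qed

lemma C_k_continuous: "C_k k f \<Longrightarrow> continuous_on UNIV f"
  by (induction k arbitrary: f) (auto dest: C_k_lower simp del: C_k.simps(2))

lemma C_k_const: "C_k k (\<lambda>x. c)"
proof (induction k arbitrary: c)
  case (Suc k)
  show ?case by (rule C_k_SucI[where f' = "\<lambda>x v. 0"]) (auto intro: Suc.IH derivative_eq_intros)
qed auto

lemma C_k_add: "C_k k f \<Longrightarrow> C_k k g \<Longrightarrow> C_k k (\<lambda>x. f x + g x)"
proof (induction k arbitrary: f g)
  case (Suc k)
  note f = C_k_SucD[OF Suc.prems(1)] and g = C_k_SucD[OF Suc.prems(2)]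
  show ?case
    by (rule C_k_SucI[OF has_derivative_add[OF f(1) g(1)] Suc.IH[OF f(2) g(2)]])
qed (auto intro: continuous_intros)

lemma C_k_bounded_linear: "bounded_linear L \<Longrightarrow> C_k k f \<Longrightarrow> C_k k (\<lambda>x. L (f x))"
proof (induction k arbitrary: f)
  case 0
  then show ?case using bounded_linear.continuous_on[of L UNIV f] by auto
next
  case (Suc k)
  note f = C_k_SucD[OF Suc.prems(2)]
  show ?case
    by (rule C_k_SucI[OF bounded_linear.has_derivative[OF Suc.prems(1) f(1)] Suc.IH[OF Suc.prems(1) f(2)]])
qed

lemma C_k_bilinear:
  assumes P: "bounded_bilinear P"
  shows "C_k k f \<Longrightarrow> C_k k g \<Longrightarrow> C_k k (\<lambda>x. P (f x) (g x))"
proof (induction k arbitrary: f g)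
  case 0
  then show ?case using bounded_bilinear.continuous_on[OF P] by auto
next
  case (Suc k)
  note f = C_k_SucD[OF Suc.prems(1)] and g = C_k_SucD[OF Suc.prems(2)]
  show ?case
    by (rule C_k_SucI[OF bounded_bilinear.FDERIV[OF P f(1) g(1)]])
       (intro C_k_add Suc.IH f g C_k_lower[OF Suc.prems(1)] C_k_lower[OF Suc.prems(2)])
qed

lemma C_k_prod:
  fixes f :: "'i \<Rightarrow> 'a::real_normed_vector \<Rightarrow> real"
  shows "finite I \<Longrightarrow> (\<And>i. i \<in> I \<Longrightarrow> C_k k (f i)) \<Longrightarrow> C_k k (\<lambda>x. \<Prod>i\<in>I. f i x)"
  by (induction rule: finite_induct) (auto intro: C_k_const C_k_bilinear[OF bounded_bilinear_mult])

section \<open>A smooth bump function\<close>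

text \<open>On \<open>t > 0\<close> these are the functions \<open>q(1/t) exp(-1/t)\<close>. The whole family is needed because it
  is closed under differentiation, which makes smoothness of its member \<open>q = 1\<close> a plain induction.\<close>

definition flat :: "real poly \<Rightarrow> real \<Rightarrow> real" where
  "flat q t = (if t \<le> 0 then 0 else poly q (1/t) * exp (- (1/t)))"

text \<open>The power \<open>u ^ k\<close> makes the induction on \<open>q\<close> work: a coefficient step multiplies by \<open>u\<close>.\<close>

lemma poly_exp_tendsto_0:
  "((\<lambda>u::real. u ^ k * poly q u * exp (- u)) \<longlongrightarrow> 0) at_top"
proof (induction q arbitrary: k)
  case (pCons a q)
  have "((\<lambda>u. a * (u ^ k / exp u) + u ^ Suc k * poly q u * exp (- u)) \<longlongrightarrow> a * 0 + 0) at_top"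
    by (intro tendsto_intros pCons.IH tendsto_power_div_exp_0)
  then show ?case
    by (simp add: algebra_simps exp_minus divide_inverse)
qed simp

lemma flat_has_derivative:
  "(flat q has_real_derivative flat ([:0,0,1:] * (q - pderiv q)) t) (at t)"
proof -
  consider "t < 0" | "t = 0" | "t > 0" by linarith
  then show ?thesis
  proof cases
    case 1
    have "((\<lambda>t. 0) has_real_derivative 0) (at t)" by simp
    then have "(flat q has_real_derivative 0) (at t)"
      by (rule has_field_derivative_transform_within_open[where S = "{..<0}"])
         (use 1 in \<open>auto simp: flat_def\<close>)
    then show ?thesis using 1 by (simp add: flat_def)
  next
    case 3
    have "((\<lambda>t. poly q (1/t) * exp (- (1/t))) has_real_derivative
       (poly (pderiv q) (1/t) * (-(1/t^2))) * exp (-(1/t)) + poly q (1/t) * (exp (-(1/t)) * (1/t^2))) (at t)"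
      using 3 by (auto intro!: derivative_eq_intros simp: power2_eq_square field_simps)
    then have "(flat q has_real_derivative 
       (poly (pderiv q) (1/t) * (-(1/t^2))) * exp (-(1/t)) + poly q (1/t) * (exp (-(1/t)) * (1/t^2))) (at t)"
      by (rule has_field_derivative_transform_within_open[where S = "{0<..}"])
         (use 3 in \<open>auto simp: flat_def\<close>)
    then show ?thesis using 3 by (simp add: flat_def algebra_simps power2_eq_square)
  next
    case 2
    have "((\<lambda>y. flat q y / y) \<longlongrightarrow> 0) (at 0)"
    proof (rule filterlim_split_at)
      show "((\<lambda>y. flat q y / y) \<longlongrightarrow> 0) (at_left 0)"
        by (rule tendsto_eventually) (auto simp: eventually_at_filter flat_def)
      have "((\<lambda>u::real. u ^ 1 * poly q u * exp (- u)) \<longlongrightarrow> 0) at_top"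
        by (rule poly_exp_tendsto_0)
      then have "((\<lambda>t. (inverse t) ^ 1 * poly q (inverse t) * exp (- (inverse t))) \<longlongrightarrow> 0) (at_right 0)"
        by (rule filterlim_compose[OF _ filterlim_inverse_at_top_right])
      then show "((\<lambda>y. flat q y / y) \<longlongrightarrow> 0) (at_right 0)"
        by (rule Lim_transform_eventually)
           (auto simp: eventually_at_filter flat_def field_simps)
    qed
    then have "(flat q has_real_derivative 0) (at 0)"
      by (simp add: has_field_derivative_iff flat_def)
    then show ?thesis using 2 by (simp add: flat_def)
  qed
qed

lemma C_k_flat_affine:
  assumes "bounded_linear l"
  shows "C_k k (\<lambda>x. flat q (l x + c))"
proof (induction k arbitrary: q)
  case 0
  have "continuous_on UNIV (flat q)"
    using flat_has_derivative by (blast intro: DERIV_continuous_on has_field_derivative_at_within)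
  moreover have "continuous_on UNIV (\<lambda>x. l x + c)"
    by (intro continuous_intros linear_continuous_on assms)
  ultimately show ?case using continuous_on_compose2[of UNIV "flat q" UNIV] by auto
next
  case (Suc k)
  have *: "((\<lambda>x. flat q (l x + c)) has_derivative (\<lambda>v. flat ([:0,0,1:] * (q - pderiv q)) (l x + c) * l v)) (at x)" for x
  proof -
    have "((\<lambda>x. l x + c) has_derivative l) (at x)"
      using bounded_linear_imp_has_derivative[OF assms] by (auto intro!: derivative_eq_intros)
    from DERIV_compose_FDERIV[OF flat_has_derivative this] show ?thesis
      by (simp add: mult.commute)
  qed
  show ?case
    by (rule C_k_SucI[OF *]) (intro C_k_bilinear[OF bounded_bilinear_mult] C_k_const Suc.IH)
qed

abbreviation smooth_ramp :: "real \<Rightarrow> real" where "smooth_ramp \<equiv> flat 1"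

lemma smooth_ramp_facts: "smooth_ramp t \<ge> 0" "smooth_ramp t \<le> 1" "smooth_ramp t > 0 \<longleftrightarrow> t > 0" "t \<le> 0 \<Longrightarrow> smooth_ramp t = 0"
  by (auto simp: flat_def)

text \<open>As \<open>exp(-1/(n t)) \<longlonglongrightarrow> 1\<close> for \<open>t > 0\<close>, the parameter \<open>n\<close> turns this bump into the indicator
  function of the box; for \<open>n = 1\<close> it is the profile of the mollifiers.\<close>

definition box_bump :: "real^3 \<Rightarrow> real^3 \<Rightarrow> real \<Rightarrow> real^3 \<Rightarrow> real" where
  "box_bump a b n x = (\<Prod>i\<in>UNIV. smooth_ramp (n * (x$i - a$i)) * smooth_ramp (n * (b$i - x$i)))"

lemma C_k_box_bump: "C_k k (box_bump a b n)"
proof -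
  have 1: "C_k k (\<lambda>x::real^3. smooth_ramp (n * (x$i - a$i)))" for i
    using C_k_flat_affine[of "\<lambda>x::real^3. n * x$i" k 1 "- n * a$i"]
    by (simp add: algebra_simps bounded_linear_const_mult bounded_linear_vec_nth)
  have 2: "C_k k (\<lambda>x::real^3. smooth_ramp (n * (b$i - x$i)))" for i
    using C_k_flat_affine[of "\<lambda>x::real^3. (-n) * x$i" k 1 "n * b$i"]
    bounded_linear_const_mult[OF bounded_linear_vec_nth[of i], of "-n"]
    by (simp add: algebra_simps del: bounded_linear_minus)
  show ?thesis
    unfolding box_bump_def [abs_def]
    by (intro C_k_prod C_k_bilinear[OF bounded_bilinear_mult] 1 2 finite)
qed

section \<open>Differentiation under the integral sign\<close>

lemma has_derivative_integral_cbox: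
  fixes F :: "'a::euclidean_space \<Rightarrow> 'b::euclidean_space \<Rightarrow> 'c::banach"
  assumes deriv: "\<And>x t. t \<in> cbox a b \<Longrightarrow> ((\<lambda>x. F x t) has_derivative F' x t) (at x)"
    and cont: "\<And>x. continuous_on (cbox a b) (F x)"
    and cont': "\<And>v. continuous_on (UNIV \<times> cbox a b) (\<lambda>(x, t). F' x t v)"
  shows "((\<lambda>x. integral (cbox a b) (F x)) has_derivative
           (\<lambda>v. integral (cbox a b) (\<lambda>t. F' x t v))) (at x)"
    and "continuous_on UNIV (\<lambda>x. integral (cbox a b) (\<lambda>t. F' x t v))"
proof -
  define G where "G x t = (if t \<in> cbox a b then Blinfun (F' x t) else 0)" for x t
  have app: "blinfun_apply (G x t) = F' x t" if "t \<in> cbox a b" for x t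
    using that bounded_linear_Blinfun_apply[OF has_derivative_bounded_linear[OF deriv[OF that]]]
    by (simp add: G_def)
  have contG: "continuous_on (UNIV \<times> cbox a b) (\<lambda>(x, t). G x t)"
  proof (rule continuous_on_blinfun_componentwise)
    fix i :: 'a assume "i \<in> Basis"
    show "continuous_on (UNIV \<times> cbox a b) (\<lambda>z. blinfun_apply (case z of (x, t) \<Rightarrow> G x t) i)"
      using cont'[of i] by (rule continuous_on_eq) (auto simp: app)
  qed
  have "((\<lambda>x. integral (cbox a b) (F x)) has_derivative integral (cbox a b) (G x)) (at x within UNIV)"
    using deriv app cont contG by (intro leibniz_rule integrable_continuous) auto
  moreover have "blinfun_apply (integral (cbox a b) (G x)) v = integral (cbox a b) (\<lambda>t. F' x t v)" for v
  proof -
    have "continuous_on (cbox a b) (G x)"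
      using continuous_on_compose2[OF contG, of "cbox a b" "\<lambda>t. (x, t)"]
        continuous_on_Pair[OF continuous_on_const continuous_on_id, of "cbox a b" x]
      by auto
    then have "blinfun_apply (integral (cbox a b) (G x)) v = integral (cbox a b) (\<lambda>t. blinfun_apply (G x t) v)"
      by (intro blinfun_apply_integral integrable_continuous)
    also have "\<dots> = integral (cbox a b) (\<lambda>t. F' x t v)"
      by (rule integral_cong) (simp add: app)
    finally show ?thesis .
  qed
  then have "blinfun_apply (integral (cbox a b) (G x)) = (\<lambda>v. integral (cbox a b) (\<lambda>t. F' x t v))"
    by auto
  ultimately show "((\<lambda>x. integral (cbox a b) (F x)) has_derivative
           (\<lambda>v. integral (cbox a b) (\<lambda>t. F' x t v))) (at x)"
    by simp
  show "continuous_on UNIV (\<lambda>x. integral (cbox a b) (\<lambda>t. F' x t v))"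
    using cont' by (intro integral_continuous_on_param) 
qed

lemma integral_lborel_translate:
  fixes f :: "'a::euclidean_space \<Rightarrow> 'b::{banach, second_countable_topology}"
  assumes "f \<in> borel_measurable borel"
  shows "(\<integral>x. f (x + c) \<partial>lborel) = (\<integral>x. f x \<partial>lborel)"
proof -
  have "(\<integral>x. f x \<partial>lborel) = (\<integral>x. f x \<partial>distr lborel borel ((+) c))"
    by (simp add: lborel_distr_plus)
  also have "\<dots> = (\<integral>x. f (c + x) \<partial>lborel)"
    using assms by (intro integral_distr) auto
  finally show ?thesis by (simp add: add.commute)
qed

lemma integrable_compact_support:
  fixes f :: "'a::euclidean_space \<Rightarrow> 'b::euclidean_space"
  assumes "continuous_on UNIV f" and "\<And>x. x \<notin> cbox a b \<Longrightarrow> f x = 0"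
  shows "integrable lborel f"
proof -
  have "integrable lborel (\<lambda>x. indicator (cbox a b) x *\<^sub>R f x)"
    by (intro borel_integrable_compact continuous_on_subset[OF assms(1)]) auto
  moreover have "(\<lambda>x. indicator (cbox a b) x *\<^sub>R f x) = f"
    using assms(2) by (auto simp: indicator_def fun_eq_iff)
  ultimately show ?thesis by simp
qed

lemma bounded_compact_support:
  fixes f :: "'a::euclidean_space \<Rightarrow> 'b::real_normed_vector"
  assumes "continuous_on UNIV f" and "\<And>x. x \<notin> cbox a b \<Longrightarrow> f x = 0"
  obtains K where "K > 0" "\<And>x. norm (f x) \<le> K"
proof -
  have "bounded (f ` cbox a b)"
    by (intro compact_imp_bounded compact_continuous_image continuous_on_subset[OF assms(1)]) auto
  then obtain K where K: "K > 0" "\<And>x. x \<in> cbox a b \<Longrightarrow> norm (f x) \<le> K"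
    by (auto simp: bounded_pos)
  have "norm (f x) \<le> K" for x
    using K assms(2)[of x] by (cases "x \<in> cbox a b") auto
  then show ?thesis using K that by blast
qed

lemma frechet_derivative_outside_support:
  fixes f :: "'a::euclidean_space \<Rightarrow> 'b::real_normed_vector"
  assumes "\<And>x. x \<notin> S \<Longrightarrow> f x = 0" and "closed S" and "x \<notin> S"
  shows "frechet_derivative f (at x) v = 0"
proof -
  have "((\<lambda>_. 0::'b) has_derivative (\<lambda>_. 0)) (at x)" by simp
  then have "(f has_derivative (\<lambda>_. 0)) (at x)"
    by (rule has_derivative_transform_within_open[where s = "- S"]) (use assms in auto)
  then show ?thesis using frechet_derivative_at by metis
qed

text \<open>A directional derivative is a limit of difference quotients, and by translation invariance
  each of them has integral zero.\<close>

lemma integral_frechet_derivative_eq_0: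
  fixes f :: "'a::euclidean_space \<Rightarrow> 'b::euclidean_space"
  assumes C1: "C_k (Suc 0) f" and supp: "\<And>x. x \<notin> cbox a b \<Longrightarrow> f x = 0"
  shows "(\<integral>x. frechet_derivative f (at x) v \<partial>lborel) = 0"
proof -
  let ?D = "\<lambda>x. frechet_derivative f (at x) v"
  note f' = C_k_SucD(1)[OF C1]
  have contf: "continuous_on UNIV f" using C1 by (rule C_k_continuous)
  have contD: "continuous_on UNIV ?D" using C_k_SucD(2)[OF C1] by simp
  have suppD: "?D x = 0" if "x \<notin> cbox a b" for x
    using frechet_derivative_outside_support[of "cbox a b" f x v] supp that by auto
  obtain K where K: "K > 0" "\<And>x. norm (?D x) \<le> K"
    using bounded_compact_support[OF contD suppD] by blast
  define g where "g n x = real (Suc n) *\<^sub>R (f (x + (1 / real (Suc n)) *\<^sub>R v) - f x)" for n x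
  have line: "((\<lambda>t. f (x + t *\<^sub>R v)) has_vector_derivative ?D (x + t *\<^sub>R v)) (at t)" for x t
  proof -
    have "((\<lambda>t. x + t *\<^sub>R v) has_vector_derivative v) (at t)"
      by (auto intro!: derivative_eq_intros simp: has_vector_derivative_def)
    from vector_derivative_diff_chain_within[OF this has_derivative_at_withinI[OF f']]
    show ?thesis by (simp add: comp_def)
  qed
  have lim: "(\<lambda>n. g n x) \<longlonglongrightarrow> ?D x" for x
  proof -
    have "((\<lambda>h. (f (x + h *\<^sub>R v) - f x) /\<^sub>R h) \<longlongrightarrow> ?D x) (at 0)"
    proof -
      have "((\<lambda>h. norm (f (x + h *\<^sub>R v) - f x - h *\<^sub>R ?D x) / norm h) \<longlongrightarrow> 0) (at 0)"
        using line[of x 0] by (simp add: has_vector_derivative_def has_derivative_at)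
      moreover have "eventually (\<lambda>h. norm (f (x + h *\<^sub>R v) - f x - h *\<^sub>R ?D x) / norm h =
          norm ((f (x + h *\<^sub>R v) - f x) /\<^sub>R h - ?D x)) (at (0::real))"
        unfolding eventually_at_filter
      proof (intro always_eventually allI impI)
        fix h :: real assume "h \<noteq> 0"
        then have "(f (x + h *\<^sub>R v) - f x) /\<^sub>R h - ?D x = (f (x + h *\<^sub>R v) - f x - h *\<^sub>R ?D x) /\<^sub>R h"
          by (simp add: scaleR_diff_right)
        then show "norm (f (x + h *\<^sub>R v) - f x - h *\<^sub>R ?D x) / norm h =
          norm ((f (x + h *\<^sub>R v) - f x) /\<^sub>R h - ?D x)"
          by (simp add: divide_inverse mult.commute)
      qed
      ultimately have "((\<lambda>h. norm ((f (x + h *\<^sub>R v) - f x) /\<^sub>R h - ?D x)) \<longlongrightarrow> 0) (at 0)"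
        by (rule Lim_transform_eventually)
      then show ?thesis using Lim_null tendsto_norm_zero_iff by blast
    qed
    moreover have "filterlim (\<lambda>n. 1 / real (Suc n)) (at 0) sequentially"
      unfolding filterlim_at using lim_1_over_n LIMSEQ_inverse_real_of_nat by (auto simp: inverse_eq_divide)
    ultimately have "(\<lambda>n. (f (x + (1 / real (Suc n)) *\<^sub>R v) - f x) /\<^sub>R (1 / real (Suc n))) \<longlonglongrightarrow> ?D x"
      by (rule filterlim_compose)
    then show ?thesis by (simp add: g_def)
  qed
  have bound: "norm (g n x) \<le> K" for n x
  proof -
    define h where "h = 1 / real (Suc n)"
    have h: "h > 0" by (simp add: h_def)
    have "norm (f (x + h *\<^sub>R v) - f (x + 0 *\<^sub>R v)) \<le> K * norm (h - 0)"
    proof (rule differentiable_bound[where S = UNIV and f' = "\<lambda>t h. h *\<^sub>R ?D (x + t *\<^sub>R v)"])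
      show "((\<lambda>t. f (x + t *\<^sub>R v)) has_derivative (\<lambda>h. h *\<^sub>R ?D (x + t *\<^sub>R v))) (at t within UNIV)" for t
        using line[of x t] by (simp add: has_vector_derivative_def)
      show "onorm (\<lambda>h. h *\<^sub>R ?D (x + t *\<^sub>R v)) \<le> K" for t
        using K by (intro onorm_bound) (auto simp: mult.commute[of K] intro!: mult_left_mono)
    qed auto
    then show ?thesis using h by (simp add: g_def h_def divide_simps mult.commute)
  qed
  \<comment> \<open>An enlarged box that contains the supports of all difference quotients, as the shifts are at most \<open>v\<close>.\<close>
  define R where "R = cbox (a - (\<Sum>i\<in>Basis. \<bar>v \<bullet> i\<bar> *\<^sub>R i)) (b + (\<Sum>i\<in>Basis. \<bar>v \<bullet> i\<bar> *\<^sub>R i))"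
  have R: "g n x = 0" if "x \<notin> R" for n x
  proof -
    have le: "\<bar>v \<bullet> i\<bar> * (1 / real (Suc n)) \<le> \<bar>v \<bullet> i\<bar>" for i
      by (rule mult_left_le) auto
    have "\<exists>i\<in>Basis. x \<bullet> i < a \<bullet> i - \<bar>v \<bullet> i\<bar> \<or> x \<bullet> i > b \<bullet> i + \<bar>v \<bullet> i\<bar>"
    proof (rule ccontr)
      assume "\<not> ?thesis"
      then have "x \<in> R" by (simp add: R_def mem_box inner_diff_left inner_add_left not_less)
      then show False using that by simp
    qed
    then obtain i where i: "i \<in> Basis" "x \<bullet> i < a \<bullet> i - \<bar>v \<bullet> i\<bar> \<or> x \<bullet> i > b \<bullet> i + \<bar>v \<bullet> i\<bar>"
      by blast
    have "\<bar>(1 / real (Suc n)) * (v \<bullet> i)\<bar> \<le> \<bar>v \<bullet> i\<bar>"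
      using le[of i] by (simp add: abs_mult mult.commute)
    moreover have "(x + (1 / real (Suc n)) *\<^sub>R v) \<bullet> i = x \<bullet> i + (1 / real (Suc n)) * (v \<bullet> i)"
      by (simp add: inner_add_left)
    ultimately have "\<not> (a \<bullet> i \<le> x \<bullet> i \<and> x \<bullet> i \<le> b \<bullet> i)"
      "\<not> (a \<bullet> i \<le> (x + (1 / real (Suc n)) *\<^sub>R v) \<bullet> i \<and> (x + (1 / real (Suc n)) *\<^sub>R v) \<bullet> i \<le> b \<bullet> i)"
      using i by linarith+
    then have "x \<notin> cbox a b" "x + (1 / real (Suc n)) *\<^sub>R v \<notin> cbox a b"
      using i(1) unfolding mem_box by blast+
    then show ?thesis using supp by (simp add: g_def)
  qed
  have contg: "continuous_on UNIV (g n)" for n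
    unfolding g_def by (intro continuous_intros continuous_on_compose2[OF contf]) auto
  have "(\<lambda>n. \<integral>x. g n x \<partial>lborel) \<longlonglongrightarrow> (\<integral>x. ?D x \<partial>lborel)"
  proof (rule integral_dominated_convergence[where w = "\<lambda>x. K * indicator R x"])
    show "?D \<in> borel_measurable lborel" "\<And>n. g n \<in> borel_measurable lborel"
      using contD contg by (auto intro: borel_measurable_continuous_onI)
    show "integrable lborel (\<lambda>x. K * indicator R x)"
      by (intro integrable_mult_right integrable_real_indicator) (auto simp: R_def bounded_cbox emeasure_bounded_finite[OF bounded_cbox, unfolded infinity_ennreal_def])
    show "AE x in lborel. norm (g n x) \<le> K * indicator R x" for n
      using bound R K by (auto simp: indicator_def)
  qed (use lim in auto)
  moreover have "(\<integral>x. g n x \<partial>lborel) = 0" for n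
  proof -
    let ?c = "(1 / real (Suc n)) *\<^sub>R v"
    have int: "integrable lborel f" by (rule integrable_compact_support[OF contf supp])
    have "f \<in> borel_measurable borel" using contf by (rule borel_measurable_continuous_onI)
    note tr = integral_lborel_translate[OF this, of ?c]
    have "integrable lborel (\<lambda>x. f (x + ?c))"
    proof (rule integrable_compact_support[where a = "a - ?c" and b = "b - ?c"])
      show "continuous_on UNIV (\<lambda>x. f (x + ?c))"
        by (intro continuous_intros continuous_on_compose2[OF contf]) auto
      show "f (x + ?c) = 0" if "x \<notin> cbox (a - ?c) (b - ?c)" for x
        using that by (intro supp) (auto simp: mem_box inner_simps algebra_simps)
    qed
    then show ?thesis using int tr by (simp add: g_def)
  qed
  ultimately show ?thesis by (simp add: LIMSEQ_const_iff)
qed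

section \<open>Mollification\<close>

definition smoothing :: "('a::euclidean_space \<Rightarrow> real) \<Rightarrow> ('a \<Rightarrow> 'b::euclidean_space) \<Rightarrow> 'a \<Rightarrow> 'b" where
  "smoothing \<eta> g x = (\<integral>y. \<eta> (x - y) *\<^sub>R g y \<partial>lborel)"

lemma smoothing_eq_integral:
  assumes "continuous_on UNIV \<eta>" "continuous_on UNIV g" "\<And>x. x \<notin> cbox a b \<Longrightarrow> g x = 0"
  shows "smoothing \<eta> g x = integral (cbox a b) (\<lambda>y. \<eta> (x - y) *\<^sub>R g y)"
proof -
  have "continuous_on UNIV (\<lambda>y. \<eta> (x - y) *\<^sub>R g y)"
    by (intro continuous_intros continuous_on_compose2[OF assms(1)] assms(2)) auto
  then have "integrable lborel (\<lambda>y. \<eta> (x - y) *\<^sub>R g y)"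
    by (rule integrable_compact_support) (use assms(3) in auto)
  then have "smoothing \<eta> g x = integral UNIV (\<lambda>y. \<eta> (x - y) *\<^sub>R g y)"
    by (simp add: smoothing_def integral_lborel)
  also have "\<dots> = integral UNIV (\<lambda>y. if y \<in> cbox a b then \<eta> (x - y) *\<^sub>R g y else 0)"
    by (rule integral_cong) (use assms(3) in auto)
  also have "\<dots> = integral (cbox a b) (\<lambda>y. \<eta> (x - y) *\<^sub>R g y)"
    by (rule integral_restrict_UNIV)
  finally show ?thesis .
qed

lemma smoothing_has_derivative:
  assumes \<eta>: "C_k (Suc 0) \<eta>" and g: "continuous_on UNIV g" "\<And>x. x \<notin> cbox a b \<Longrightarrow> g x = 0"
  shows "(smoothing \<eta> g has_derivative (\<lambda>v. smoothing (\<lambda>x. frechet_derivative \<eta> (at x) v) g x)) (at x)"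
proof -
  note c\<eta> = C_k_continuous[OF \<eta>]
  have c\<eta>': "continuous_on UNIV (\<lambda>x. frechet_derivative \<eta> (at x) v)" for v
    using C_k_SucD(2)[OF \<eta>] by simp
  have "((\<lambda>x. integral (cbox a b) (\<lambda>y. \<eta> (x - y) *\<^sub>R g y)) has_derivative
      (\<lambda>v. integral (cbox a b) (\<lambda>y. frechet_derivative \<eta> (at (x - y)) v *\<^sub>R g y))) (at x)"
  proof (rule has_derivative_integral_cbox)
    fix x y
    have "((\<lambda>x. \<eta> (x - y)) has_derivative frechet_derivative \<eta> (at (x - y))) (at x)"
      using has_derivative_compose[OF has_derivative_diff[OF has_derivative_ident has_derivative_const] C_k_SucD(1)[OF \<eta>, of "x - y"]]
      by simp
    then show "((\<lambda>x. \<eta> (x - y) *\<^sub>R g y) has_derivative (\<lambda>v. frechet_derivative \<eta> (at (x - y)) v *\<^sub>R g y)) (at x)"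
      by (rule has_derivative_scaleR_left)
    show "continuous_on (cbox a b) (\<lambda>y. \<eta> (x - y) *\<^sub>R g y)"
      by (intro continuous_intros continuous_on_compose2[OF c\<eta>] continuous_on_subset[OF g(1)]) auto
    show "continuous_on (UNIV \<times> cbox a b) (\<lambda>(x, y). frechet_derivative \<eta> (at (x - y)) v *\<^sub>R g y)" for v
      unfolding split_beta
      by (intro continuous_intros continuous_on_compose2[OF c\<eta>'] continuous_on_compose2[OF g(1)]) auto
  qed
  moreover have "smoothing \<eta> g = (\<lambda>x. integral (cbox a b) (\<lambda>y. \<eta> (x - y) *\<^sub>R g y))"
    by (rule ext, rule smoothing_eq_integral[OF c\<eta> g])
  moreover have "(\<lambda>v. smoothing (\<lambda>x. frechet_derivative \<eta> (at x) v) g x)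
      = (\<lambda>v. integral (cbox a b) (\<lambda>y. frechet_derivative \<eta> (at (x - y)) v *\<^sub>R g y))"
    by (rule ext, rule smoothing_eq_integral[OF c\<eta>' g])
  ultimately show ?thesis by simp
qed

lemma smoothing_C_k:
  assumes g: "continuous_on UNIV g" "\<And>x. x \<notin> cbox a b \<Longrightarrow> g x = 0"
  shows "(\<And>k. C_k k \<eta>) \<Longrightarrow> C_k k (smoothing \<eta> g)"
proof (induction k arbitrary: \<eta>)
  case 0
  then have "C_k (Suc 0) \<eta>" by blast
  then show ?case using smoothing_has_derivative[OF _ g]
    by (auto intro!: continuous_at_imp_continuous_on has_derivative_continuous)
next
  case (Suc k)
  have 1: "C_k (Suc 0) \<eta>" by fact
  show ?case
    by (rule C_k_SucI[OF smoothing_has_derivative[OF 1 g]]) (use Suc.IH C_k_SucD(2)[OF Suc.prems] in blast)+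
qed

text \<open>The two ways of placing the derivative differ by the integral of the derivative of the
  compactly supported function \<open>y \<mapsto> \<eta>(x - y) g(y)\<close>.\<close>

lemma smoothing_derivative_commute:
  assumes \<eta>: "C_k (Suc 0) \<eta>" and g: "C_k (Suc 0) g" "\<And>x. x \<notin> cbox a b \<Longrightarrow> g x = 0"
  shows "smoothing (\<lambda>x. frechet_derivative \<eta> (at x) v) g x = smoothing \<eta> (\<lambda>y. frechet_derivative g (at y) v) x"
proof -
  let ?f = "\<lambda>y. \<eta> (x - y) *\<^sub>R g y"
  have R: "((\<lambda>y. \<eta> (x - y)) has_derivative (\<lambda>w. - frechet_derivative \<eta> (at (x - y)) w)) (at y)" for y
  proof -
    have "((\<lambda>y. x - y) has_derivative (\<lambda>w. - w)) (at y)" by (auto intro!: derivative_eq_intros)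
    from has_derivative_compose[OF this C_k_SucD(1)[OF \<eta>, of "x - y"]]
    show ?thesis using linear_neg[OF has_derivative_linear[OF C_k_SucD(1)[OF \<eta>]]] by simp
  qed
  have f': "(?f has_derivative (\<lambda>w. \<eta> (x - y) *\<^sub>R frechet_derivative g (at y) w + (- frechet_derivative \<eta> (at (x - y)) w) *\<^sub>R g y)) (at y)" for y
    by (rule has_derivative_scaleR[OF R C_k_SucD(1)[OF g(1)]])
  have c1: "continuous_on UNIV (\<lambda>y. \<eta> (x - y) *\<^sub>R frechet_derivative g (at y) w)" for w
    using C_k_SucD(2)[OF g(1)] by (intro continuous_intros continuous_on_compose2[OF C_k_continuous[OF \<eta>]]) auto
  have c2: "continuous_on UNIV (\<lambda>y. frechet_derivative \<eta> (at (x - y)) w *\<^sub>R g y)" for w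
  proof -
    have "continuous_on UNIV (\<lambda>z. frechet_derivative \<eta> (at z) w)" using C_k_SucD(2)[OF \<eta>] by simp
    then have "continuous_on UNIV (\<lambda>y. frechet_derivative \<eta> (at (x - y)) w)"
      by (rule continuous_on_compose2) (auto intro!: continuous_intros)
    then show ?thesis by (intro continuous_on_scaleR C_k_continuous[OF g(1)])
  qed
  have C1: "C_k (Suc 0) ?f"
    by (rule C_k_SucI[OF f']) (use continuous_on_add[OF c1 continuous_on_minus[OF c2]] in simp)
  have s1: "frechet_derivative g (at y) v = 0" if "y \<notin> cbox a b" for y
    using frechet_derivative_outside_support[of "cbox a b" g y v] g(2) that by auto
  have "0 = (\<integral>y. frechet_derivative ?f (at y) v \<partial>lborel)"
    by (rule integral_frechet_derivative_eq_0[OF C1, symmetric]) (use g(2) in auto)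
  also have "\<dots> = (\<integral>y. \<eta> (x - y) *\<^sub>R frechet_derivative g (at y) v - frechet_derivative \<eta> (at (x - y)) v *\<^sub>R g y \<partial>lborel)"
    using fun_cong[OF frechet_derivative_at[OF f']] by simp
  also have "\<dots> = (\<integral>y. \<eta> (x - y) *\<^sub>R frechet_derivative g (at y) v \<partial>lborel) - (\<integral>y. frechet_derivative \<eta> (at (x - y)) v *\<^sub>R g y \<partial>lborel)"
    by (intro Bochner_Integration.integral_diff integrable_compact_support[OF c1, of a b] integrable_compact_support[OF c2, of a b])
       (use s1 g(2) in auto)
  finally show ?thesis by (simp add: smoothing_def)
qed

definition mollifier :: "nat \<Rightarrow> real^3 \<Rightarrow> real" where
  "mollifier n x = (let h = (\<chi> i. 1 / real (Suc n)) in
     box_bump (- h) h 1 x / (\<integral>y. box_bump (- h) h 1 y \<partial>lborel))"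

lemma box_bump_facts:
  shows "box_bump a b n x \<ge> 0" "box_bump a b n x \<le> 1"
    and "x \<notin> box a b \<Longrightarrow> n \<ge> 0 \<Longrightarrow> box_bump a b n x = 0"
    and "x \<in> box a b \<Longrightarrow> n > 0 \<Longrightarrow> box_bump a b n x > 0"
proof -
  show "box_bump a b n x \<ge> 0" "box_bump a b n x \<le> 1"
    unfolding box_bump_def
    by (intro prod_nonneg prod_le_1 conjI mult_nonneg_nonneg mult_le_one smooth_ramp_facts ballI)+
  show "x \<notin> box a b \<Longrightarrow> n \<ge> 0 \<Longrightarrow> box_bump a b n x = 0"
    unfolding box_bump_def by (auto simp: mem_box_cart not_less intro!: prod_zero smooth_ramp_facts(4) mult_nonneg_nonpos)
  show "x \<in> box a b \<Longrightarrow> n > 0 \<Longrightarrow> box_bump a b n x > 0"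
    unfolding box_bump_def by (intro prod_pos mult_pos_pos) (auto simp: mem_box_cart smooth_ramp_facts)
qed

lemma mollifier_facts:
  shows "C_k k (mollifier n)" "mollifier n x \<ge> 0" "mollifier n (- x) = mollifier n x"
    and "integrable lborel (mollifier n)" "(\<integral>x. mollifier n x \<partial>lborel) = 1"
    and "mollifier n x \<noteq> 0 \<Longrightarrow> \<bar>x $ i\<bar> \<le> 1 / real (Suc n)"
proof -
  define h :: "real^3" where "h = (\<chi> i. 1 / real (Suc n))"
  define I where "I = (\<integral>y. box_bump (- h) h 1 y \<partial>lborel)"
  have m: "mollifier n = (\<lambda>x. box_bump (- h) h 1 x / I)"
    unfolding mollifier_def [abs_def] Let_def h_def [symmetric] I_def ..
  have supp: "x \<notin> cbox (-h) h \<Longrightarrow> box_bump (- h) h 1 x = 0" for x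
    using box_bump_facts(3)[of x "-h" h 1] box_subset_cbox by (metis subsetD zero_le_one)
  have int: "integrable lborel (box_bump (- h) h 1)"
    by (rule integrable_compact_support[OF C_k_continuous[OF C_k_box_bump] supp])
  have "I \<noteq> 0"
  proof
    assume "I = 0"
    then have "AE x in lborel. box_bump (- h) h 1 x = 0"
      using integral_nonneg_eq_0_iff_AE[OF int] box_bump_facts(1) by (simp add: I_def)
    then have "AE x in lborel. x \<notin> box (-h) h"
      by eventually_elim (use box_bump_facts(4)[of _ "-h" h 1] in force)
    then have "emeasure lborel (box (-h) h) = 0"
      by (subst (asm) AE_iff_measurable[of "box (-h) h"]) auto
    moreover have "emeasure lborel (box (-h) h) = ennreal (\<Prod>b\<in>Basis. (h - - h) \<bullet> b)"
      by (intro emeasure_lborel_box) (auto simp: h_def Basis_vec_def inner_axis)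
    moreover have "(\<Prod>b\<in>Basis. (h - - h) \<bullet> b) > 0"
      by (intro prod_pos) (auto simp: h_def Basis_vec_def inner_axis)
    ultimately show False by (metis ennreal_eq_0_iff not_le)
  qed
  moreover have "I \<ge> 0" unfolding I_def by (intro Bochner_Integration.integral_nonneg box_bump_facts)
  ultimately have I: "I > 0" by simp
  show "C_k k (mollifier n)"
    unfolding m divide_inverse by (intro C_k_bilinear[OF bounded_bilinear_mult] C_k_const C_k_box_bump)
  show "mollifier n x \<ge> 0" using I by (simp add: m box_bump_facts)
  show "integrable lborel (mollifier n)" using int by (simp add: m)
  show "(\<integral>x. mollifier n x \<partial>lborel) = 1" using I by (simp add: m I_def[symmetric])
  show "mollifier n (- x) = mollifier n x"
    by (simp add: m box_bump_def mult.commute add.commute)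
  show "\<bar>x $ i\<bar> \<le> 1 / real (Suc n)" if "mollifier n x \<noteq> 0"
  proof -
    have "x \<in> cbox (-h) h" using that supp by (auto simp: m)
    then show ?thesis by (auto simp: mem_box_cart h_def abs_le_iff minus_le_iff)
  qed
qed

lemma mollifier_shift:
  shows "continuous_on UNIV (\<lambda>y. mollifier n (x - y))"
    and "integrable lborel (\<lambda>y. mollifier n (x - y))"
    and "(\<integral>y. mollifier n (x - y) \<partial>lborel) = 1"
proof -
  show "continuous_on UNIV (\<lambda>y. mollifier n (x - y))"
    by (intro continuous_on_compose2[OF C_k_continuous[OF mollifier_facts(1)]] continuous_intros) auto
  have mb: "mollifier n \<in> borel_measurable borel"
    by (rule borel_measurable_continuous_onI[OF C_k_continuous[OF mollifier_facts(1)]])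
  have "(\<integral>y. mollifier n (x - y) \<partial>lborel) = (\<integral>y. mollifier n (y + (- x)) \<partial>lborel)"
    using mollifier_facts(3)[of n "x - y" for y] by (intro Bochner_Integration.integral_cong) auto
  also have "\<dots> = 1"
    by (rule trans[OF integral_lborel_translate[OF mb] mollifier_facts(5)])
  finally show 1: "(\<integral>y. mollifier n (x - y) \<partial>lborel) = 1" .
  show "integrable lborel (\<lambda>y. mollifier n (x - y))"
    using 1 not_integrable_integral_eq[of lborel "\<lambda>y. mollifier n (x - y)"] by (metis zero_neq_one)
qed

lemma norm_integral_mollifier_le:
  fixes g :: "real^3 \<Rightarrow> 'b::euclidean_space"
  assumes "continuous_on UNIV g" and "\<And>y. mollifier n (x - y) \<noteq> 0 \<Longrightarrow> norm (g y) \<le> e"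
  shows "norm (smoothing (mollifier n) g x) \<le> e"
proof -
  note cm = mollifier_shift(1)[of n x] and int = mollifier_shift(2)[of n x]
    and 1 = mollifier_shift(3)[of n x]
  have "norm (smoothing (mollifier n) g x) \<le> (\<integral>y. norm (mollifier n (x - y) *\<^sub>R g y) \<partial>lborel)"
    unfolding smoothing_def by (rule integral_norm_bound)
  also have "\<dots> \<le> (\<integral>y. mollifier n (x - y) * e \<partial>lborel)"
  proof (rule integral_mono_AE)
    have p: "norm (mollifier n (x - y) *\<^sub>R g y) \<le> mollifier n (x - y) * e" for y
      using assms(2)[of y] mollifier_facts(2)[of n "x - y"]
      by (cases "mollifier n (x - y) = 0") (auto intro!: mult_left_mono)
    show i: "integrable lborel (\<lambda>y. mollifier n (x - y) * e)" using int by simp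
    show "integrable lborel (\<lambda>y. norm (mollifier n (x - y) *\<^sub>R g y))"
      by (rule Bochner_Integration.integrable_bound[OF i])
         (use cm assms(1) p in \<open>auto intro!: borel_measurable_continuous_onI continuous_intros intro: order_trans[OF _ abs_ge_self]\<close>)
    show "AE y in lborel. norm (mollifier n (x - y) *\<^sub>R g y) \<le> mollifier n (x - y) * e"
      using p by simp
  qed
  also have "\<dots> = e" using 1 by simp
  finally show ?thesis .
qed

lemma smoothing_mollifier_tendsto:
  fixes g :: "real^3 \<Rightarrow> 'b::euclidean_space"
  assumes g: "continuous_on UNIV g" "\<And>x. x \<notin> cbox a b \<Longrightarrow> g x = 0"
  shows "(\<lambda>n. smoothing (mollifier n) g x) \<longlonglongrightarrow> g x"
proof (rule LIMSEQ_I)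
  fix r :: real assume "r > 0"
  then obtain d where d: "d > 0" "\<And>y. dist y x < d \<Longrightarrow> dist (g y) (g x) < r / 2"
    using g(1) unfolding continuous_on_iff by (metis UNIV_I half_gt_zero)
  obtain N where N: "real (Suc N) > 3 / d" using reals_Archimedean2 by (metis less_trans of_nat_less_iff lessI)
  have "norm (smoothing (mollifier n) g x - g x) < r" if "n \<ge> N" for n
  proof -
    note cm = mollifier_shift(1)[of n x] and int = mollifier_shift(2)[of n x]
      and 1 = mollifier_shift(3)[of n x]
    have "integrable lborel (\<lambda>y. mollifier n (x - y) *\<^sub>R g y)"
      by (rule integrable_compact_support[of _ a b]) (use cm g in \<open>auto intro!: continuous_intros\<close>)
    then have "smoothing (mollifier n) (\<lambda>y. g y - g x) x = smoothing (mollifier n) g x - g x"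
      using int 1 by (simp add: smoothing_def scaleR_diff_right)
    moreover have "norm (smoothing (mollifier n) (\<lambda>y. g y - g x) x) \<le> r / 2"
    proof (rule norm_integral_mollifier_le)
      show "continuous_on UNIV (\<lambda>y. g y - g x)" using g by (intro continuous_intros)
      fix y assume "mollifier n (x - y) \<noteq> 0"
      then have "\<bar>(x - y) $ i\<bar> \<le> 1 / real (Suc n)" for i by (rule mollifier_facts(6))
      then have "norm (x - y) \<le> (\<Sum>i\<in>(UNIV::3 set). 1 / real (Suc n))"
        by (intro order_trans[OF norm_le_l1_cart] sum_mono)
      also have "\<dots> \<le> 3 / real (Suc N)" using that by (simp add: divide_simps)
      also have "\<dots> < d" using N d by (simp add: divide_simps mult.commute)
      finally show "norm (g y - g x) \<le> r / 2" using d(2)[of y] by (simp add: dist_norm norm_minus_commute)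
    qed
    ultimately show ?thesis using \<open>r > 0\<close> by simp
  qed
  then show "\<exists>N. \<forall>n\<ge>N. norm (smoothing (mollifier n) g x - g x) < r" by blast
qed

section \<open>Functions orthogonal to all bump functions\<close>

text \<open>Boxes form a generator of the Borel sets that is stable under intersection, so the integrals
  over all Borel sets vanish.\<close>

lemma AE_zero_if_box_integrals_zero:
  fixes f :: "'a::euclidean_space \<Rightarrow> 'b::{banach, second_countable_topology}"
  assumes int: "integrable (lebesgue_on (box p q)) f"
    and zero: "\<And>a b. (\<integral>x. indicator (box a b) x *\<^sub>R f x \<partial>lebesgue_on (box p q)) = 0"
  shows "AE x in lebesgue_on (box p q). f x = 0"
proof -
  let ?M = "lebesgue_on (box p q)"
  have meas: "A \<inter> box p q \<in> sets ?M" if "A \<in> sets lebesgue" for A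
    using that by (simp add: sets_restrict_space_iff sets.Int)
  have intA: "integrable ?M (\<lambda>x. indicator A x *\<^sub>R f x)" if "A \<in> sets lebesgue" for A
  proof -
    have "integrable ?M (\<lambda>x. indicator (A \<inter> box p q) x *\<^sub>R f x)"
      using meas[OF that] int by (rule integrable_mult_indicator)
    moreover have "integrable ?M (\<lambda>x. indicator (A \<inter> box p q) x *\<^sub>R f x) \<longleftrightarrow> integrable ?M (\<lambda>x. indicator A x *\<^sub>R f x)"
      by (rule Bochner_Integration.integrable_cong) (auto simp: indicator_def)
    ultimately show ?thesis by simp
  qed
  have total: "(\<integral>x. f x \<partial>?M) = 0"
  proof -
    have "(\<integral>x. f x \<partial>?M) = (\<integral>x. indicator (box p q) x *\<^sub>R f x \<partial>?M)"
      by (rule Bochner_Integration.integral_cong) auto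
    then show ?thesis using zero[of p q] by simp
  qed
  have borel: "(\<integral>x. indicator A x *\<^sub>R f x \<partial>?M) = 0" if "A \<in> sets borel" for A
  proof -
    have "Int_stable (range (\<lambda>(a, b). box a b :: 'a set))"
    proof (rule Int_stableI)
      fix X Y :: "'a set"
      assume "X \<in> range (\<lambda>(a, b). box a b)" "Y \<in> range (\<lambda>(a, b). box a b)"
      then obtain a b c d where "X = box a b" "Y = box c d" by auto
      moreover obtain e f where "box a b \<inter> box c d = box e f" by (rule that[OF box_Int_box])
      ultimately have "X \<inter> Y = (case (e, f) of (a, b) \<Rightarrow> box a b)" by simp
      then show "X \<inter> Y \<in> range (\<lambda>(a, b). box a b)" by (rule range_eqI)
    qed
    moreover have "range (\<lambda>(a, b). box a b :: 'a set) \<subseteq> Pow UNIV" by simp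
    moreover have "A \<in> sigma_sets UNIV (range (\<lambda>(a, b). box a b :: 'a set))"
      using that by (simp add: borel_eq_box)
    ultimately show ?thesis
    proof (induction A rule: sigma_sets_induct_disjoint)
      case (compl A)
      then have "A \<in> sets lebesgue" by (simp add: borel_eq_box)
      have "(\<integral>x. indicator (UNIV - A) x *\<^sub>R f x \<partial>?M) = (\<integral>x. f x - indicator A x *\<^sub>R f x \<partial>?M)"
        by (intro Bochner_Integration.integral_cong) (auto simp: indicator_def)
      also have "\<dots> = 0"
        using int intA[OF \<open>A \<in> sets lebesgue\<close>] total compl by simp
      finally show ?case .
    next
      case (union A)
      have A: "A i \<in> sets lebesgue" for i
      proof -
        have "A i \<in> sigma_sets UNIV (range (\<lambda>(a, b). box a b :: 'a set))" using union(2) by blast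
        then show ?thesis by (simp add: borel_eq_box)
      qed
      have "set_lebesgue_integral ?M (\<Union>i. A i \<inter> box p q) f = (\<Sum>i. set_lebesgue_integral ?M (A i \<inter> box p q) f)"
      proof (rule lebesgue_integral_countable_add)
        show "set_integrable ?M (\<Union>i. A i \<inter> box p q) f"
          unfolding set_integrable_def
          using meas[OF A] int by (intro integrable_mult_indicator sets.countable_UN) auto
      qed (use meas[OF A] union in \<open>auto simp: disjoint_family_on_def\<close>)
      also have "(\<lambda>i. set_lebesgue_integral ?M (A i \<inter> box p q) f) = (\<lambda>i. (\<integral>x. indicator (A i) x *\<^sub>R f x \<partial>?M))"
        unfolding set_lebesgue_integral_def
        by (intro ext Bochner_Integration.integral_cong) (auto simp: indicator_def)
      also have "set_lebesgue_integral ?M (\<Union>i. A i \<inter> box p q) f = (\<integral>x. indicator (\<Union>i. A i) x *\<^sub>R f x \<partial>?M)"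
        unfolding set_lebesgue_integral_def
        by (intro Bochner_Integration.integral_cong) (auto simp: indicator_def)
      finally show ?case using union by simp
    qed (use zero in auto)
  qed
  have all: "(\<integral>x. indicator A x *\<^sub>R f x \<partial>?M) = 0" if A: "A \<in> sets lebesgue" for A
  proof -
    obtain S N N' where SN: "A = S \<union> N" "N \<subseteq> N'" "N' \<in> null_sets lborel" "S \<in> sets lborel"
      using sets_completionE[OF A] by metis
    have "AE x in lebesgue. x \<notin> N'"
      using SN(3) by (intro AE_not_in null_sets_completionI)
    then have "AE x in ?M. x \<notin> N'"
      by (subst AE_restrict_space_iff) auto
    then have "AE x in ?M. indicator A x *\<^sub>R f x = indicator S x *\<^sub>R f x"
      by eventually_elim (use SN in \<open>auto simp: indicator_def\<close>)
    then have "(\<integral>x. indicator A x *\<^sub>R f x \<partial>?M) = (\<integral>x. indicator S x *\<^sub>R f x \<partial>?M)"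
      using intA[OF A] intA[of S] SN(4) by (intro integral_cong_AE) (auto dest: borel_measurable_integrable)
    then show ?thesis using borel[of S] SN(4) by simp
  qed
  interpret finite_measure ?M by (rule finite_measure_lebesgue_on) simp
  show ?thesis
  proof (rule density_zero[OF int])
    fix A assume "A \<in> sets ?M"
    then have "A \<in> sets lebesgue" by (auto simp: sets_restrict_space_iff)
    then show "set_lebesgue_integral ?M A f = 0"
      unfolding set_lebesgue_integral_def by (rule all)
  qed
qed

lemma test_functionsI:
  assumes "\<And>k. C_k k f" "compact K" "K \<subseteq> \<Omega>" "\<And>x. x \<notin> K \<Longrightarrow> f x = 0"
  shows "f \<in> test_functions \<Omega>"
proof -
  have "closure {x. f x \<noteq> 0} \<subseteq> K"
    using assms by (intro closure_minimal compact_imp_closed) auto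
  moreover from this have "compact (closure {x. f x \<noteq> 0})"
    using compact_Int_closed[OF assms(2), of "closure {x. f x \<noteq> 0}"] by (simp add: Int_absorb1)
  ultimately show ?thesis using assms by (auto simp: test_functions_def)
qed

lemma test_functionsE:
  assumes "f \<in> test_functions \<Omega>"
  obtains K where "\<And>k. C_k k f" "compact K" "K \<subseteq> \<Omega>" "\<And>x. x \<notin> K \<Longrightarrow> f x = 0"
proof -
  have "f x = 0" if "x \<notin> closure {x. f x \<noteq> 0}" for x
    using that closure_subset[of "{x. f x \<noteq> 0}"] by auto
  then show ?thesis
    using assms unfolding test_functions_def mem_Collect_eq by (intro that[of "closure {x. f x \<noteq> 0}"]) blast+
qed

lemma box_bump_test_function:
  assumes L: "bounded_linear L" and "cbox a b \<subseteq> \<Omega>" "n \<ge> 0"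
  shows "(\<lambda>x. L (box_bump a b n x)) \<in> test_functions \<Omega>"
proof (rule test_functionsI)
  show "C_k k (\<lambda>x. L (box_bump a b n x))" for k
    by (rule C_k_bounded_linear[OF L C_k_box_bump])
  show "L (box_bump a b n x) = 0" if "x \<notin> cbox a b" for x
  proof -
    have "x \<notin> box a b" using that box_subset_cbox[of a b] by blast
    then have "box_bump a b n x = 0" using box_bump_facts(3) assms(3) by blast
    then show ?thesis using linear_0[OF bounded_linear.linear[OF L]] by simp
  qed
qed (use assms in auto)

lemma box_bump_tendsto: "(\<lambda>n. box_bump a b (real n) x) \<longlonglongrightarrow> indicator (box a b) x"
proof (cases "x \<in> box a b")
  case True
  have 1: "(\<lambda>n. smooth_ramp (real n * t)) \<longlonglongrightarrow> 1" if "t > 0" for t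
  proof -
    have "(\<lambda>n. exp (- (1 / (real n * t)))) \<longlonglongrightarrow> exp (- 0)"
    proof (intro tendsto_intros)
      have "(\<lambda>n. (1 / t) * (1 / real n)) \<longlonglongrightarrow> (1 / t) * 0"
        by (intro tendsto_intros lim_1_over_n)
      then show "(\<lambda>n. 1 / (real n * t)) \<longlonglongrightarrow> 0" by (simp add: mult.commute)
    qed
    moreover have "eventually (\<lambda>n. exp (- (1 / (real n * t))) = smooth_ramp (real n * t)) sequentially"
      using eventually_gt_at_top[of 0]
      by eventually_elim (use that in \<open>auto simp: flat_def mult_le_0_iff\<close>)
    ultimately show ?thesis by (simp add: Lim_transform_eventually)
  qed
  have "(\<lambda>n. box_bump a b (real n) x) \<longlonglongrightarrow> (\<Prod>i\<in>(UNIV::3 set). 1 * 1)"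
    unfolding box_bump_def using True
    by (intro tendsto_prod tendsto_mult 1) (auto simp: mem_box_cart)
  then show ?thesis using True by simp
next
  case False
  then show ?thesis using box_bump_facts(3)[of x a b] by simp
qed

text \<open>The fundamental lemma of the calculus of variations: the bumps converge to indicator functions
  of boxes, and countably many closed boxes cover \<open>\<Omega>\<close>.\<close>

lemma AE_zero_if_orthogonal_to_bumps:
  fixes d :: "real^3 \<Rightarrow> complex"
  assumes \<Omega>: "open \<Omega>" and d: "d \<in> borel_measurable (lebesgue_on \<Omega>)"
    and int: "\<And>a b. cbox a b \<subseteq> \<Omega> \<Longrightarrow> integrable (lebesgue_on \<Omega>) (\<lambda>x. indicator (cbox a b) x *\<^sub>R d x)"
    and zero: "\<And>a b n. cbox a b \<subseteq> \<Omega> \<Longrightarrow> n \<ge> 0 \<Longrightarrow> (\<integral>x. d x * of_real (box_bump a b n x) \<partial>lebesgue_on \<Omega>) = 0"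
  shows "AE x in lebesgue_on \<Omega>. d x = 0"
proof -
  let ?M = "lebesgue_on \<Omega>"
  have \<Omega>_meas: "\<Omega> \<in> sets lebesgue" using \<Omega> by simp
  have box0: "(\<integral>x. indicator (box a b) x *\<^sub>R d x \<partial>?M) = 0" if sub: "cbox a b \<subseteq> \<Omega>" for a b
  proof -
    have "(\<lambda>n. \<integral>x. d x * of_real (box_bump a b (real n) x) \<partial>?M) \<longlonglongrightarrow> (\<integral>x. indicator (box a b) x *\<^sub>R d x \<partial>?M)"
    proof (rule integral_dominated_convergence[where w = "\<lambda>x. norm (indicator (cbox a b) x *\<^sub>R d x)"])
      have bm: "box_bump a b n \<in> borel_measurable ?M" for n
        by (intro continuous_imp_measurable_on_sets_lebesgue \<Omega>_meas continuous_on_subset[OF C_k_continuous[OF C_k_box_bump]]) auto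
      show "(\<lambda>x. d x * of_real (box_bump a b (real n) x)) \<in> borel_measurable ?M" for n
        using bm d by measurable
      have "box a b \<in> sets ?M" using sub box_subset_cbox[of a b] \<Omega>_meas
        by (auto simp: sets_restrict_space_iff)
      then show "(\<lambda>x. indicator (box a b) x *\<^sub>R d x) \<in> borel_measurable ?M"
        using d by (intro borel_measurable_scaleR borel_measurable_indicator)
      show "integrable ?M (\<lambda>x. norm (indicator (cbox a b) x *\<^sub>R d x))"
        by (intro integrable_norm int sub)
      have "(\<lambda>n. d x * complex_of_real (box_bump a b (real n) x)) \<longlonglongrightarrow> d x * of_real (indicator (box a b) x)" for x
        by (intro tendsto_intros box_bump_tendsto)
      then show "AE x in ?M. (\<lambda>n. d x * complex_of_real (box_bump a b (real n) x)) \<longlonglongrightarrow> indicator (box a b) x *\<^sub>R d x"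
        by (simp add: scaleR_conv_of_real mult.commute)
      show "AE x in ?M. norm (d x * complex_of_real (box_bump a b (real n) x)) \<le> norm (indicator (cbox a b) x *\<^sub>R d x)" for n
      proof (rule AE_I2)
        fix x
        show "norm (d x * complex_of_real (box_bump a b (real n) x)) \<le> norm (indicator (cbox a b) x *\<^sub>R d x)"
          using box_bump_facts(1,2)[of a b n x] box_bump_facts(3)[of x a b n] box_subset_cbox[of a b]
          by (cases "x \<in> cbox a b"; cases "x \<in> box a b") (auto simp: norm_mult intro!: mult_left_le)
      qed
    qed
    then show ?thesis using zero[OF sub] by (simp add: LIMSEQ_const_iff)
  qed
  have on_box: "AE x in lebesgue. x \<in> box p q \<longrightarrow> d x = 0" if sub: "cbox p q \<subseteq> \<Omega>" for p q
  proof -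
    have sub': "box p q \<subseteq> \<Omega>" using sub box_subset_cbox by blast
    have eq: "lebesgue_on (box p q) = restrict_space ?M (box p q)"
      using sub' \<Omega>_meas by (subst restrict_restrict_space) (auto simp: Int_absorb1)
    have bM: "box p q \<inter> space ?M \<in> sets ?M" using sub' \<Omega>_meas by (auto simp: sets_restrict_space_iff Int_absorb2)
    have "AE x in lebesgue_on (box p q). d x = 0"
    proof (rule AE_zero_if_box_integrals_zero)
      have "integrable ?M (\<lambda>x. indicator (box p q \<inter> space ?M) x *\<^sub>R (indicator (cbox p q) x *\<^sub>R d x))"
        by (rule integrable_mult_indicator[OF bM int[OF sub]])
      moreover have "integrable ?M (\<lambda>x. indicator (box p q \<inter> space ?M) x *\<^sub>R (indicator (cbox p q) x *\<^sub>R d x))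
          \<longleftrightarrow> integrable ?M (\<lambda>x. indicator (box p q) x *\<^sub>R d x)"
        by (rule Bochner_Integration.integrable_cong)
           (use box_subset_cbox[of p q] in \<open>auto simp: indicator_def\<close>)
      ultimately have "integrable ?M (\<lambda>x. indicator (box p q) x *\<^sub>R d x)" by simp
      then show "integrable (lebesgue_on (box p q)) d"
        unfolding eq by (subst integrable_restrict_space[OF bM])
      fix a b
      \<comment> \<open>A nonempty subbox of \<open>box p q\<close> has its closure in \<open>cbox p q\<close>, hence in \<open>\<Omega>\<close>.\<close>
      obtain c e where ce: "box a b \<inter> box p q = box c e" by (rule that[OF box_Int_box])
      have "(\<integral>x. indicator (box a b) x *\<^sub>R d x \<partial>lebesgue_on (box p q)) = (\<integral>x. indicator (box c e) x *\<^sub>R d x \<partial>?M)"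
        unfolding eq
        by (subst integral_restrict_space[OF bM], rule Bochner_Integration.integral_cong)
           (auto simp: ce[symmetric] indicator_def)
      also have "\<dots> = 0"
      proof (cases "box c e = {}")
        case False
        have "closure (box c e) \<subseteq> closure (box p q)" using ce by (intro closure_mono) blast
        moreover have "box p q \<noteq> {}" using False ce by blast
        ultimately have "cbox c e \<subseteq> \<Omega>" using False sub by simp
        then show ?thesis by (rule box0)
      qed simp
      finally show "(\<integral>x. indicator (box a b) x *\<^sub>R d x \<partial>lebesgue_on (box p q)) = 0" .
    qed
    then show ?thesis by (subst (asm) AE_restrict_space_iff) auto
  qed
  obtain D where D: "countable D" "D \<subseteq> Pow \<Omega>" "\<And>X. X \<in> D \<Longrightarrow> \<exists>a b. X = cbox a b" "\<Union>D = \<Omega>"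
    using open_countable_Union_open_cbox[OF \<Omega>] by metis
  have "AE x in lebesgue. \<forall>X\<in>D. x \<in> X \<longrightarrow> d x = 0"
  proof (subst AE_ball_countable[OF D(1)], intro ballI)
    fix X assume "X \<in> D"
    then obtain p q where X: "X = cbox p q" "cbox p q \<subseteq> \<Omega>" using D by blast
    have "AE x in lebesgue. x \<notin> cbox p q - box p q"
      using negligible_frontier_interval[of p q] by (intro AE_not_in) (simp add: negligible_iff_null_sets)
    then show "AE x in lebesgue. x \<in> X \<longrightarrow> d x = 0"
      using on_box[OF X(2)] by eventually_elim (auto simp: X)
  qed
  then have "AE x in lebesgue. x \<in> \<Omega> \<longrightarrow> d x = 0"
    by eventually_elim (use D in blast)
  then show ?thesis using \<Omega>_meas by (subst AE_restrict_space_iff) auto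
qed

section \<open>Square integrable fields\<close>

lemma norm_cdot_le: "norm (cdot a b) \<le> norm a * norm b"
proof -
  have "norm (cdot a b) \<le> (\<Sum>i\<in>UNIV. norm (a $ i) * norm (b $ i))"
    unfolding cdot_def by (rule sum_norm_le) (simp add: norm_mult)
  also have "\<dots> \<le> norm a * norm b"
    using L2_set_mult_ineq[of "\<lambda>i. norm (a $ i)" "\<lambda>i. norm (b $ i)" UNIV]
    by (simp add: norm_vec_def)
  finally show ?thesis .
qed

lemma Cauchy_Schwarz_integral:
  fixes f g :: "'a \<Rightarrow> real"
  assumes [measurable]: "f \<in> borel_measurable M" "g \<in> borel_measurable M"
    and f: "integrable M (\<lambda>x. (f x)\<^sup>2)" and g: "integrable M (\<lambda>x. (g x)\<^sup>2)"
  shows "integrable M (\<lambda>x. f x * g x)"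
    and "(\<integral>x. \<bar>f x * g x\<bar> \<partial>M) \<le> sqrt (\<integral>x. (f x)\<^sup>2 \<partial>M) * sqrt (\<integral>x. (g x)\<^sup>2 \<partial>M)"
proof -
  show int: "integrable M (\<lambda>x. f x * g x)"
  proof (rule Bochner_Integration.integrable_bound)
    show "integrable M (\<lambda>x. (f x)\<^sup>2 + (g x)\<^sup>2)" using f g by simp
    have "\<bar>f x * g x\<bar> \<le> (f x)\<^sup>2 + (g x)\<^sup>2" for x
    proof -
      have "2 * (\<bar>f x\<bar> * \<bar>g x\<bar>) \<le> (f x)\<^sup>2 + (g x)\<^sup>2"
        using sum_squares_bound[of "\<bar>f x\<bar>" "\<bar>g x\<bar>"] by simp
      moreover have "\<bar>f x\<bar> * \<bar>g x\<bar> \<ge> 0" by simp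
      ultimately have "\<bar>f x\<bar> * \<bar>g x\<bar> \<le> (f x)\<^sup>2 + (g x)\<^sup>2" by linarith
      then show ?thesis by (simp add: abs_mult)
    qed
    then show "AE x in M. norm (f x * g x) \<le> norm ((f x)\<^sup>2 + (g x)\<^sup>2)" by simp
  qed measurable
  have "(\<integral>\<^sup>+x. ennreal \<bar>f x\<bar> * ennreal \<bar>g x\<bar> \<partial>M)\<^sup>2 \<le> (\<integral>\<^sup>+x. (ennreal \<bar>f x\<bar>)\<^sup>2 \<partial>M) * (\<integral>\<^sup>+x. (ennreal \<bar>g x\<bar>)\<^sup>2 \<partial>M)"
    by (rule Cauchy_Schwarz_nn_integral) measurable
  moreover have "(\<integral>\<^sup>+x. ennreal \<bar>f x\<bar> * ennreal \<bar>g x\<bar> \<partial>M) = ennreal (\<integral>x. \<bar>f x * g x\<bar> \<partial>M)"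
    using nn_integral_eq_integral[OF integrable_abs[OF int]] by (simp add: abs_mult ennreal_mult)
  moreover have "(\<integral>\<^sup>+x. (ennreal \<bar>f x\<bar>)\<^sup>2 \<partial>M) = ennreal (\<integral>x. (f x)\<^sup>2 \<partial>M)"
    using f by (subst nn_integral_eq_integral[symmetric]) (auto simp: ennreal_power)
  moreover have "(\<integral>\<^sup>+x. (ennreal \<bar>g x\<bar>)\<^sup>2 \<partial>M) = ennreal (\<integral>x. (g x)\<^sup>2 \<partial>M)"
    using g by (subst nn_integral_eq_integral[symmetric]) (auto simp: ennreal_power)
  ultimately have "ennreal ((\<integral>x. \<bar>f x * g x\<bar> \<partial>M)\<^sup>2) \<le> ennreal ((\<integral>x. (f x)\<^sup>2 \<partial>M) * (\<integral>x. (g x)\<^sup>2 \<partial>M))"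
    by (simp add: ennreal_power ennreal_mult)
  then have "(\<integral>x. \<bar>f x * g x\<bar> \<partial>M)\<^sup>2 \<le> (\<integral>x. (f x)\<^sup>2 \<partial>M) * (\<integral>x. (g x)\<^sup>2 \<partial>M)"
    by (subst (asm) ennreal_le_iff) auto
  then show "(\<integral>x. \<bar>f x * g x\<bar> \<partial>M) \<le> sqrt (\<integral>x. (f x)\<^sup>2 \<partial>M) * sqrt (\<integral>x. (g x)\<^sup>2 \<partial>M)"
    by (metis real_le_rsqrt real_sqrt_mult)
qed

lemma L2_norm_nonneg: "L2_norm \<Omega> f \<ge> 0"
  by (simp add: L2_norm_def)

lemma L2_norm_power2: "(L2_norm \<Omega> f)\<^sup>2 = (\<integral>x. (norm (f x))\<^sup>2 \<partial>lebesgue_on \<Omega>)"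
  by (simp add: L2_norm_def)

lemma L2_borel_measurable: "f \<in> L2 \<Omega> \<Longrightarrow> f \<in> borel_measurable (lebesgue_on \<Omega>)"
  by (simp add: L2_def)

lemma borel_measurable_component:
  fixes f :: "'a \<Rightarrow> complex^3"
  assumes "f \<in> borel_measurable M" shows "(\<lambda>x. f x $ i) \<in> borel_measurable M"
  by (rule measurable_compose[OF assms borel_measurable_continuous_onI]) (intro continuous_intros)

lemma borel_measurable_cdot:
  assumes "f \<in> borel_measurable M" "g \<in> borel_measurable M"
  shows "(\<lambda>x. cdot (f x) (g x)) \<in> borel_measurable M"
proof -
  have "(\<lambda>x. f x $ i) \<in> borel_measurable M" "(\<lambda>x. g x $ i) \<in> borel_measurable M" for i
    by (intro borel_measurable_component assms)+
  then show ?thesis unfolding cdot_def by measurable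
qed

lemma L2_product_bound:
  fixes f :: "real^3 \<Rightarrow> 'b::euclidean_space" and g :: "real^3 \<Rightarrow> 'c::euclidean_space"
    and h :: "real^3 \<Rightarrow> complex"
  assumes f: "f \<in> L2 \<Omega>" and g: "g \<in> L2 \<Omega>" and h: "h \<in> borel_measurable (lebesgue_on \<Omega>)"
    and le: "\<And>x. norm (h x) \<le> norm (f x) * norm (g x)"
  shows "integrable (lebesgue_on \<Omega>) h"
    and "norm (\<integral>x. h x \<partial>lebesgue_on \<Omega>) \<le> L2_norm \<Omega> f * L2_norm \<Omega> g"
proof -
  note CS = Cauchy_Schwarz_integral[of "\<lambda>x. norm (f x)" "lebesgue_on \<Omega>" "\<lambda>x. norm (g x)"]
  have meas: "(\<lambda>x. norm (f x)) \<in> borel_measurable (lebesgue_on \<Omega>)" "(\<lambda>x. norm (g x)) \<in> borel_measurable (lebesgue_on \<Omega>)"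
    using f g by (auto simp: L2_def intro: borel_measurable_norm)
  have sq: "integrable (lebesgue_on \<Omega>) (\<lambda>x. (norm (f x))\<^sup>2)" "integrable (lebesgue_on \<Omega>) (\<lambda>x. (norm (g x))\<^sup>2)"
    using f g by (auto simp: L2_def)
  note int = CS(1)[OF meas sq] and bd = CS(2)[OF meas sq]
  show ih: "integrable (lebesgue_on \<Omega>) h"
    by (rule Bochner_Integration.integrable_bound[OF int h]) (use le in auto)
  have "norm (\<integral>x. h x \<partial>lebesgue_on \<Omega>) \<le> (\<integral>x. norm (h x) \<partial>lebesgue_on \<Omega>)"
    by (rule integral_norm_bound)
  also have "\<dots> \<le> (\<integral>x. \<bar>norm (f x) * norm (g x)\<bar> \<partial>lebesgue_on \<Omega>)"
    using le ih int by (intro integral_mono integrable_norm) (auto simp del: abs_mult)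
  also have "\<dots> \<le> L2_norm \<Omega> f * L2_norm \<Omega> g"
    using bd by (simp add: L2_norm_def)
  finally show "norm (\<integral>x. h x \<partial>lebesgue_on \<Omega>) \<le> L2_norm \<Omega> f * L2_norm \<Omega> g" .
qed

lemma L2_cdot:
  fixes u v :: "real^3 \<Rightarrow> complex^3"
  assumes u: "u \<in> L2 \<Omega>" and v: "v \<in> L2 \<Omega>"
  shows "integrable (lebesgue_on \<Omega>) (\<lambda>x. cdot (u x) (v x))"
    and "norm (\<integral>x. cdot (u x) (v x) \<partial>lebesgue_on \<Omega>) \<le> L2_norm \<Omega> u * L2_norm \<Omega> v"
  by (rule L2_product_bound[of u \<Omega> v "\<lambda>x. cdot (u x) (v x)", OF u v
        borel_measurable_cdot[OF L2_borel_measurable[OF u] L2_borel_measurable[OF v]] norm_cdot_le])+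

text \<open>The second bound replaces the triangle inequality: it estimates an approximant \<open>g\<close> of \<open>f\<close>, and
  the factor 2 only enters the final constant.\<close>

lemma L2_diff:
  fixes f g :: "'a::euclidean_space \<Rightarrow> 'b::euclidean_space"
  assumes "f \<in> L2 \<Omega>" "g \<in> L2 \<Omega>"
  shows "(\<lambda>x. f x - g x) \<in> L2 \<Omega>"
    and "(L2_norm \<Omega> g)\<^sup>2 \<le> 2 * (L2_norm \<Omega> f)\<^sup>2 + 2 * (L2_norm \<Omega> (\<lambda>x. f x - g x))\<^sup>2"
proof -
  have sq: "(norm (a - b))\<^sup>2 \<le> 2 * (norm a)\<^sup>2 + 2 * (norm b)\<^sup>2" for a b :: 'b
  proof -
    have "(norm (a - b))\<^sup>2 \<le> (norm a + norm b)\<^sup>2"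
      by (intro power_mono norm_triangle_ineq4) auto
    then show ?thesis using sum_squares_bound[of "norm a" "norm b"] by (simp add: power2_sum)
  qed
  have meas: "(\<lambda>x. f x - g x) \<in> borel_measurable (lebesgue_on \<Omega>)"
    using assms by (auto simp: L2_def)
  have int: "integrable (lebesgue_on \<Omega>) (\<lambda>x. (norm (f x))\<^sup>2)" "integrable (lebesgue_on \<Omega>) (\<lambda>x. (norm (g x))\<^sup>2)"
    using assms by (auto simp: L2_def)
  have i: "integrable (lebesgue_on \<Omega>) (\<lambda>x. (norm (f x - g x))\<^sup>2)"
  proof (rule Bochner_Integration.integrable_bound)
    show "integrable (lebesgue_on \<Omega>) (\<lambda>x. 2 * (norm (f x))\<^sup>2 + 2 * (norm (g x))\<^sup>2)" using int by simp
    show "(\<lambda>x. (norm (f x - g x))\<^sup>2) \<in> borel_measurable (lebesgue_on \<Omega>)" using meas by measurable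
    show "AE x in lebesgue_on \<Omega>. norm ((norm (f x - g x))\<^sup>2) \<le> norm (2 * (norm (f x))\<^sup>2 + 2 * (norm (g x))\<^sup>2)"
      using sq by simp
  qed
  then show "(\<lambda>x. f x - g x) \<in> L2 \<Omega>" using meas by (simp add: L2_def)
  have "(L2_norm \<Omega> g)\<^sup>2 \<le> (\<integral>x. 2 * (norm (f x))\<^sup>2 + 2 * (norm (f x - g x))\<^sup>2 \<partial>lebesgue_on \<Omega>)"
    unfolding L2_norm_power2 using int i sq[of "f x" "f x - g x" for x]
    by (intro integral_mono) simp_all
  then show "(L2_norm \<Omega> g)\<^sup>2 \<le> 2 * (L2_norm \<Omega> f)\<^sup>2 + 2 * (L2_norm \<Omega> (\<lambda>x. f x - g x))\<^sup>2"
    using int i by (simp add: L2_norm_power2)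
qed

lemma compactly_supported_lebesgue_on:
  fixes f :: "'a::euclidean_space \<Rightarrow> 'b::euclidean_space"
  assumes f: "continuous_on UNIV f" and supp: "\<And>x. x \<notin> cbox a b \<Longrightarrow> f x = 0"
    and \<Omega>: "open \<Omega>"
  shows "f \<in> L2 \<Omega>" and "integrable (lebesgue_on \<Omega>) f"
    and "(\<And>x. x \<notin> \<Omega> \<Longrightarrow> f x = 0) \<Longrightarrow> (\<integral>x. f x \<partial>lebesgue_on \<Omega>) = (\<integral>x. f x \<partial>lborel)"
proof -
  have \<Omega>': "\<Omega> \<inter> space lebesgue \<in> sets lebesgue" using \<Omega> by simp
  have i: "integrable lebesgue g \<Longrightarrow> integrable (lebesgue_on \<Omega>) g" for g :: "'a \<Rightarrow> 'c::euclidean_space"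
    unfolding integrable_restrict_space[OF \<Omega>'] using \<Omega>' by (intro integrable_mult_indicator) auto
  have leb: "integrable lebesgue f"
    using integrable_compact_support[OF f supp] by (simp add: integrable_completion f borel_measurable_continuous_onI)
  then show "integrable (lebesgue_on \<Omega>) f" by (rule i)
  have c2: "continuous_on UNIV (\<lambda>x. (norm (f x))\<^sup>2)" by (intro continuous_intros f)
  have "integrable lebesgue (\<lambda>x. (norm (f x))\<^sup>2)"
    using integrable_compact_support[OF c2, of a b] supp
    by (simp add: integrable_completion c2 borel_measurable_continuous_onI)
  moreover have "f \<in> borel_measurable (lebesgue_on \<Omega>)"
    using \<Omega> by (intro continuous_imp_measurable_on_sets_lebesgue continuous_on_subset[OF f]) auto
  ultimately show "f \<in> L2 \<Omega>" using i by (simp add: L2_def)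
  assume z: "\<And>x. x \<notin> \<Omega> \<Longrightarrow> f x = 0"
  have "(\<integral>x. f x \<partial>lebesgue_on \<Omega>) = (\<integral>x. indicator \<Omega> x *\<^sub>R f x \<partial>lebesgue)"
    by (rule integral_restrict_space[OF \<Omega>'])
  also have "(\<lambda>x. indicator \<Omega> x *\<^sub>R f x) = f" using z by (auto simp: indicator_def)
  finally show "(\<integral>x. f x \<partial>lebesgue_on \<Omega>) = (\<integral>x. f x \<partial>lborel)"
    by (simp add: integral_completion f borel_measurable_continuous_onI)
qed

section \<open>Testing the weak divergence with functions of class \<open>C\<^sup>1\<close>\<close>

text \<open>The mollified functions are test functions as soon as the mollifier is narrower than the
  distance from \<open>K\<close> to the complement of \<open>\<Omega>\<close>. They and their gradients are uniformly bounded, vanish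
  outside one compact set and converge pointwise, so dominated convergence applies although \<open>w\<close> is
  merely square integrable.\<close>

lemma is_weak_div_C1:
  fixes \<psi> :: "real^3 \<Rightarrow> complex"
  assumes \<Omega>: "open \<Omega>" and w: "w \<in> L2 \<Omega>" and d: "is_weak_div \<Omega> w d"
    and \<psi>: "C_k (Suc 0) \<psi>" and K: "compact K" "K \<subseteq> \<Omega>" "\<And>x. x \<notin> K \<Longrightarrow> \<psi> x = 0"
  shows "(\<integral>x. cdot (w x) (grad \<psi> x) \<partial>lebesgue_on \<Omega>) = - (\<integral>x. d x * \<psi> x \<partial>lebesgue_on \<Omega>)"
proof -
  let ?M = "lebesgue_on \<Omega>"
  have \<Omega>': "\<Omega> \<in> sets lebesgue" using \<Omega> by simp
  obtain r where r: "r > 0" "\<And>x y. x \<in> K \<Longrightarrow> y \<in> - \<Omega> \<Longrightarrow> r \<le> dist x y"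
  proof -
    have "K \<inter> - \<Omega> = {}" using K(2) by blast
    with separate_compact_closed[OF K(1), of "- \<Omega>"] \<Omega> show ?thesis using that by (auto simp: closed_Compl)
  qed
  define K' where "K' = {x + y | x y. x \<in> K \<and> y \<in> cball 0 (r/2)}"
  have K': "compact K'" "K' \<subseteq> \<Omega>"
  proof -
    show "compact K'" unfolding K'_def by (intro compact_sums K(1) compact_cball)
    show "K' \<subseteq> \<Omega>"
    proof
      fix z assume "z \<in> K'"
      then obtain x y where xy: "z = x + y" "x \<in> K" "norm y \<le> r/2" unfolding K'_def by auto
      then have "dist x z < r" using r(1) by (simp add: dist_norm)
      then show "z \<in> \<Omega>" using r(2)[OF xy(2), of z] by auto
    qed
  qed
  obtain a where "K' \<subseteq> cbox (-a) a" using bounded_subset_cbox_symmetric compact_imp_bounded K'(1) by metis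
  moreover have "K \<subseteq> K'" unfolding K'_def using r by (force intro: exI[of _ 0])
  ultimately have sub: "K' \<subseteq> cbox (-a) a" "K \<subseteq> cbox (-a) a" by auto
  have supp: "\<And>x. x \<notin> cbox (-a) a \<Longrightarrow> \<psi> x = 0" using K(3) sub by blast
  note c\<psi> = C_k_continuous[OF \<psi>]
  define P where "P i = partial_deriv i \<psi>" for i
  have cP: "continuous_on UNIV (P i)" for i
    using C_k_SucD(2)[OF \<psi>] by (simp add: P_def partial_deriv_def)
  have sP: "P i x = 0" if "x \<notin> cbox (-a) a" for i x
    unfolding P_def partial_deriv_def
    by (rule frechet_derivative_outside_support[of "cbox (-a) a"]) (use supp that in auto)
  obtain N where N: "real (Suc N) > 3 / (r/2)" using reals_Archimedean2 by (metis less_trans of_nat_less_iff lessI)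
  \<comment> \<open>The first \<open>N\<close> mollifiers may be too wide and are skipped.\<close>
  define f where "f n = smoothing (mollifier (n + N)) \<psi>" for n
  have smooth: "C_k k (f n)" for k n
    unfolding f_def by (rule smoothing_C_k[OF c\<psi> supp mollifier_facts(1)])
  have grad_f: "partial_deriv i (f n) x = smoothing (mollifier (n + N)) (P i) x" for i n x
  proof -
    have "frechet_derivative (f n) (at x) = (\<lambda>v. smoothing (\<lambda>x. frechet_derivative (mollifier (n + N)) (at x) v) \<psi> x)"
      unfolding f_def
      by (rule frechet_derivative_at[symmetric], rule smoothing_has_derivative[OF mollifier_facts(1) c\<psi> supp])
    then show ?thesis
      unfolding partial_deriv_def P_def
      using smoothing_derivative_commute[OF mollifier_facts(1) \<psi> supp] by simp
  qed
  have supp_f: "f n x = 0" if "x \<notin> K'" for n x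
  proof -
    have "mollifier (n + N) (x - y) *\<^sub>R \<psi> y = 0" for y
    proof (rule ccontr)
      assume "\<not> ?thesis"
      then have m: "mollifier (n + N) (x - y) \<noteq> 0" and y: "y \<in> K" using K(3) by auto
      have "norm (x - y) \<le> (\<Sum>i\<in>(UNIV::3 set). 1 / real (Suc (n + N)))"
        using mollifier_facts(6)[OF m] by (intro order_trans[OF norm_le_l1_cart] sum_mono)
      also have "\<dots> \<le> 3 / real (Suc N)" by (simp add: divide_simps)
      also have "\<dots> < r / 2" using N r by (simp add: divide_simps mult.commute)
      finally have "x - y \<in> cball 0 (r/2)" by simp
      with y have "x \<in> K'" unfolding K'_def mem_Collect_eq
        by (intro exI[of _ y] exI[of _ "x - y"]) simp
      then show False using that by simp
    qed
    then show ?thesis unfolding f_def smoothing_def by (simp only: Bochner_Integration.integral_zero)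
  qed
  have test: "f n \<in> test_functions \<Omega>" for n
    by (rule test_functionsI[OF smooth K' supp_f])
  have eq: "(\<integral>x. cdot (w x) (grad (f n) x) \<partial>?M) = - (\<integral>x. d x * f n x \<partial>?M)" for n
    using d test[of n] by (simp add: is_weak_div_def)
  obtain B where B: "B > 0" "\<And>x. norm (\<psi> x) \<le> B" using bounded_compact_support[OF c\<psi> supp] by blast
  have "\<exists>B. B > 0 \<and> (\<forall>x. norm (P i x) \<le> B)" for i using bounded_compact_support[OF cP sP] by metis
  then obtain BP where BP: "\<And>i. BP i > 0" "\<And>i x. norm (P i x) \<le> BP i" by metis
  define G where "G = (\<Sum>i\<in>UNIV. BP i)"
  have intK: "integrable ?M (\<lambda>x. C * (indicator K' x * norm (u x)))" if "u \<in> L2 \<Omega>" for u :: "real^3 \<Rightarrow> 'c::euclidean_space" and C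
  proof -
    have KM: "K' \<in> sets ?M" using K' by (auto simp: sets_restrict_space_iff \<Omega>' compact_imp_closed)
    have "emeasure ?M K' < \<infinity>"
      using K' \<Omega>' compact_imp_bounded[OF K'(1)] emeasure_bounded_finite[of K']
      by (subst emeasure_restrict_space) (auto simp: compact_imp_closed)
    then have "integrable ?M (indicator K' :: _ \<Rightarrow> real)" using KM by (intro integrable_real_indicator)
    moreover have "(\<lambda>x. (indicator K' x :: real)\<^sup>2) = indicator K'" by (auto simp: indicator_def)
    ultimately have "integrable ?M (\<lambda>x. indicator K' x * norm (u x))"
      using that KM by (intro Cauchy_Schwarz_integral(1) borel_measurable_norm borel_measurable_indicator) (auto simp: L2_def)
    then show ?thesis by simp
  qed
  have cont_meas: "g \<in> borel_measurable ?M" if "continuous_on UNIV g" for g :: "real^3 \<Rightarrow> 'c::euclidean_space"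
    using that \<Omega>' by (intro continuous_imp_measurable_on_sets_lebesgue continuous_on_subset[OF that]) auto
  have cgrad: "continuous_on UNIV (grad g)" if "C_k (Suc 0) g" for g
    unfolding grad_def partial_deriv_def using C_k_SucD(2)[OF that] by (intro continuous_on_vec_lambda) simp
  have "(\<lambda>n. \<integral>x. d x * f n x \<partial>?M) \<longlonglongrightarrow> (\<integral>x. d x * \<psi> x \<partial>?M)"
  proof (rule integral_dominated_convergence[where w = "\<lambda>x. B * (indicator K' x * norm (d x))"])
    have dL: "d \<in> L2 \<Omega>" using d by (simp add: is_weak_div_def)
    note dm = L2_borel_measurable[OF dL]
    show "integrable ?M (\<lambda>x. B * (indicator K' x * norm (d x)))" by (rule intK[OF dL])
    show "(\<lambda>x. d x * \<psi> x) \<in> borel_measurable ?M" using cont_meas[OF c\<psi>] dm by measurable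
    show "(\<lambda>x. d x * f n x) \<in> borel_measurable ?M" for n
      using cont_meas[OF C_k_continuous[OF smooth[of 0 n]]] dm by measurable
    have "(\<lambda>n. f n x) \<longlonglongrightarrow> \<psi> x" for x
      unfolding f_def by (rule LIMSEQ_ignore_initial_segment[OF smoothing_mollifier_tendsto[OF c\<psi> supp]])
    then show "AE x in ?M. (\<lambda>n. d x * f n x) \<longlonglongrightarrow> d x * \<psi> x" by (auto intro!: tendsto_intros)
    have "norm (d x * f n x) \<le> B * (indicator K' x * norm (d x))" for n x
    proof (cases "x \<in> K'")
      case True
      have "norm (f n x) \<le> B" unfolding f_def by (rule norm_integral_mollifier_le[OF c\<psi> B(2)])
      then show ?thesis using True by (simp add: norm_mult mult.commute[of B] mult_left_mono)
    qed (simp add: supp_f)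
    then show "AE x in ?M. norm (d x * f n x) \<le> B * (indicator K' x * norm (d x))" for n by simp
  qed
  moreover have "(\<lambda>n. \<integral>x. cdot (w x) (grad (f n) x) \<partial>?M) \<longlonglongrightarrow> (\<integral>x. cdot (w x) (grad \<psi> x) \<partial>?M)"
  proof (rule integral_dominated_convergence[where w = "\<lambda>x. G * (indicator K' x * norm (w x))"])
    note wm = L2_borel_measurable[OF w]
    show "integrable ?M (\<lambda>x. G * (indicator K' x * norm (w x)))" by (rule intK[OF w])
    show "(\<lambda>x. cdot (w x) (grad \<psi> x)) \<in> borel_measurable ?M"
      by (rule borel_measurable_cdot[OF wm cont_meas[OF cgrad[OF \<psi>]]])
    show "(\<lambda>x. cdot (w x) (grad (f n) x)) \<in> borel_measurable ?M" for n
      by (rule borel_measurable_cdot[OF wm cont_meas[OF cgrad[OF smooth]]])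
    have lim: "(\<lambda>n. partial_deriv i (f n) x) \<longlonglongrightarrow> partial_deriv i \<psi> x" for i x
      unfolding grad_f P_def[symmetric]
      by (rule LIMSEQ_ignore_initial_segment[OF smoothing_mollifier_tendsto[OF cP sP]])
    then show "AE x in ?M. (\<lambda>n. cdot (w x) (grad (f n) x)) \<longlonglongrightarrow> cdot (w x) (grad \<psi> x)"
      unfolding cdot_def grad_def by (auto intro!: tendsto_intros)
    have "norm (cdot (w x) (grad (f n) x)) \<le> G * (indicator K' x * norm (w x))" for n x
    proof (cases "x \<in> K'")
      case True
      have "norm (partial_deriv i (f n) x) \<le> BP i" for i
        unfolding grad_f by (rule norm_integral_mollifier_le[OF cP BP(2)])
      then have "norm (grad (f n) x) \<le> G"
        unfolding norm_vec_def G_def grad_def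
        by (intro order_trans[OF L2_set_le_sum] sum_mono) auto
      then have "norm (cdot (w x) (grad (f n) x)) \<le> norm (w x) * G"
        using norm_cdot_le[of "w x" "grad (f n) x"] by (meson mult_left_mono norm_ge_zero order_trans)
      then show ?thesis using True by (simp add: mult.commute)
    next
      case False
      have "grad (f n) x = 0"
        unfolding grad_def partial_deriv_def vec_eq_iff
        using frechet_derivative_outside_support[of K' "f n" x] supp_f compact_imp_closed[OF K'(1)] False by simp
      then show ?thesis using False by (simp add: cdot_def)
    qed
    then show "AE x in ?M. norm (cdot (w x) (grad (f n) x)) \<le> G * (indicator K' x * norm (w x))" for n by simp
  qed
  ultimately show ?thesis
    unfolding eq using LIMSEQ_unique tendsto_minus by blast
qed

section \<open>Weak curls\<close>

lemma C_k_component: "C_k k f \<Longrightarrow> C_k k (\<lambda>x. f x $ i)"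
  by (rule C_k_bounded_linear[OF bounded_linear_vec_nth])

lemma C_k_partial_deriv: "C_k (Suc k) f \<Longrightarrow> C_k k (partial_deriv i f)"
  unfolding partial_deriv_def [abs_def] by (rule C_k_SucD(2))

lemma continuous_on_curl:
  assumes "C_k (Suc 0) f" shows "continuous_on UNIV (curl f)"
proof -
  have "continuous_on UNIV (partial_deriv i (\<lambda>y. f y $ j))" for i j
    using C_k_partial_deriv[OF C_k_component[OF assms]] by simp
  then have "continuous_on UNIV (\<lambda>x. curl f x $ i)" for i
    using exhaust_3[of i] by (auto simp: curl_def continuous_on_diff)
  then have "continuous_on UNIV (\<lambda>x. \<chi> i. curl f x $ i)" by (rule continuous_on_vec_lambda)
  then show ?thesis by simp
qed

lemma partial_deriv_mult:
  fixes f g :: "real^3 \<Rightarrow> complex"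
  assumes "C_k (Suc 0) f" "C_k (Suc 0) g"
  shows "partial_deriv i (\<lambda>x. f x * g x) x = f x * partial_deriv i g x + partial_deriv i f x * g x"
  unfolding partial_deriv_def
  using frechet_derivative_at[OF has_derivative_mult[OF C_k_SucD(1)[OF assms(1)] C_k_SucD(1)[OF assms(2)]]] by metis

text \<open>Integration by parts: \<open>\<phi> \<cdot> curl \<psi> - \<psi> \<cdot> curl \<phi>\<close> is the divergence of the compactly supported
  field \<open>\<psi> \<times> \<phi>\<close>.\<close>

lemma is_weak_curl_test_function:
  assumes \<Omega>: "open \<Omega>" and \<phi>: "\<phi> \<in> test_functions \<Omega>"
  shows "is_weak_curl \<Omega> \<phi> (curl \<phi>)" and "\<phi> \<in> L2 \<Omega>"
proof -
  obtain K where K: "\<And>k. C_k k \<phi>" "compact K" "K \<subseteq> \<Omega>" "\<And>x. x \<notin> K \<Longrightarrow> \<phi> x = 0"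
    using test_functionsE[OF \<phi>] by metis
  obtain a where a: "K \<subseteq> cbox (-a) a" using bounded_subset_cbox_symmetric compact_imp_bounded K(2) by metis
  have supp: "\<phi> x = 0" if "x \<notin> cbox (-a) a" for x using K(4) a that by blast
  have pd0: "partial_deriv i (\<lambda>y. f y $ j) x = 0" if "\<And>x. x \<notin> S \<Longrightarrow> f x = 0" "closed S" "x \<notin> S" for f :: "real^3 \<Rightarrow> complex^3" and S i j x
    unfolding partial_deriv_def using that by (intro frechet_derivative_outside_support[of S]) auto
  have curl0: "curl \<phi> x = 0" if "x \<notin> S" "closed S" "\<And>x. x \<notin> S \<Longrightarrow> \<phi> x = 0" for S x
    using pd0[OF that(3,2,1)] by (simp add: curl_def vec_eq_iff forall_3)
  have c\<phi>: "continuous_on UNIV (curl \<phi>)" by (rule continuous_on_curl[OF K(1)])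
  have curlL2: "curl \<phi> \<in> L2 \<Omega>"
    using compactly_supported_lebesgue_on(1)[OF c\<phi> _ \<Omega>] curl0[OF _ closed_cbox supp] by blast
  show "\<phi> \<in> L2 \<Omega>"
    using compactly_supported_lebesgue_on(1)[OF C_k_continuous[OF K(1)] supp \<Omega>] by blast
  have "(\<integral>x. cdot (\<phi> x) (curl \<psi> x) \<partial>lebesgue_on \<Omega>) = (\<integral>x. cdot (curl \<phi> x) (\<psi> x) \<partial>lebesgue_on \<Omega>)"
    if \<psi>: "\<psi> \<in> test_functions \<Omega>" for \<psi>
  proof -
    have C\<psi>: "C_k k \<psi>" for k using test_functionsE[OF \<psi>] by metis
    have c\<psi>: "continuous_on UNIV (curl \<psi>)" by (rule continuous_on_curl[OF C\<psi>])
    have c: "C_k (Suc 0) (\<lambda>x. \<psi> x $ i)" "C_k (Suc 0) (\<lambda>x. \<phi> x $ i)" for i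
      by (rule C_k_component[OF C\<psi>] C_k_component[OF K(1)])+
    define h where "h i j x = \<psi> x $ i * \<phi> x $ j" for i j x
    have Ch: "C_k (Suc 0) (h i j)" for i j
      unfolding h_def [abs_def] by (rule C_k_bilinear[OF bounded_bilinear_mult c])
    have h0: "h i j x = 0" if "x \<notin> cbox (-a) a" for i j x using supp that by (simp add: h_def)
    have int0: "(\<integral>x. partial_deriv k (h i j) x \<partial>lborel) = 0" for i j k
      unfolding partial_deriv_def by (rule integral_frechet_derivative_eq_0[OF Ch h0])
    have dh0: "partial_deriv k (h i j) x = 0" if "x \<notin> cbox (-a) a" for i j k x
      unfolding partial_deriv_def by (rule frechet_derivative_outside_support[of "cbox (-a) a"]) (use h0 that in auto)
    have inth: "integrable lborel (partial_deriv k (h i j))" for i j k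
      using C_k_partial_deriv[OF Ch] dh0 by (intro integrable_compact_support[of _ "-a" a]) auto
    have cont1: "continuous_on UNIV (\<lambda>x. cdot (\<phi> x) (curl \<psi> x))"
      unfolding cdot_def by (intro continuous_intros c\<psi> C_k_continuous[OF K(1)])
    have cont2: "continuous_on UNIV (\<lambda>x. cdot (curl \<phi> x) (\<psi> x))"
      unfolding cdot_def by (intro continuous_intros c\<phi> C_k_continuous[OF C\<psi>])
    have z1: "cdot (\<phi> x) (curl \<psi> x) = 0" if "x \<notin> cbox (-a) a" for x
      using supp[OF that] by (simp add: cdot_def)
    have z2: "cdot (curl \<phi> x) (\<psi> x) = 0" if "x \<notin> cbox (-a) a" for x
      using curl0[OF that closed_cbox supp] by (simp add: cdot_def)
    have O1: "cdot (\<phi> x) (curl \<psi> x) = 0" "cdot (curl \<phi> x) (\<psi> x) = 0" if "x \<notin> \<Omega>" for x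
    proof -
      have "x \<notin> K" using that K(3) by blast
      then have "\<phi> x = 0" "curl \<phi> x = 0" using K(4) curl0[of x K] compact_imp_closed[OF K(2)] by auto
      then show "cdot (\<phi> x) (curl \<psi> x) = 0" "cdot (curl \<phi> x) (\<psi> x) = 0" by (simp_all add: cdot_def)
    qed
    have "cdot (\<phi> x) (curl \<psi> x) - cdot (curl \<phi> x) (\<psi> x) =
        (partial_deriv 1 (h 2 3) x - partial_deriv 1 (h 3 2) x)
      + (partial_deriv 2 (h 3 1) x - partial_deriv 2 (h 1 3) x)
      + (partial_deriv 3 (h 1 2) x - partial_deriv 3 (h 2 1) x)" for x
      unfolding h_def [abs_def] partial_deriv_mult[OF c]
      by (simp add: cdot_def curl_def sum_3 algebra_simps)
    then have "(\<integral>x. cdot (\<phi> x) (curl \<psi> x) - cdot (curl \<phi> x) (\<psi> x) \<partial>lborel) = 0"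
      using int0 inth by simp
    moreover have "integrable lborel (\<lambda>x. cdot (\<phi> x) (curl \<psi> x))" "integrable lborel (\<lambda>x. cdot (curl \<phi> x) (\<psi> x))"
      using integrable_compact_support[OF cont1 z1] integrable_compact_support[OF cont2 z2] by auto
    ultimately have "(\<integral>x. cdot (\<phi> x) (curl \<psi> x) \<partial>lborel) = (\<integral>x. cdot (curl \<phi> x) (\<psi> x) \<partial>lborel)" by simp
    then show ?thesis
      using compactly_supported_lebesgue_on(3)[OF cont1 z1 \<Omega> O1(1)] compactly_supported_lebesgue_on(3)[OF cont2 z2 \<Omega> O1(2)]
      by simp
  qed
  then show "is_weak_curl \<Omega> \<phi> (curl \<phi>)" using curlL2 by (simp add: is_weak_curl_def)
qed

lemma is_weak_curl_L2: "is_weak_curl \<Omega> u c \<Longrightarrow> c \<in> L2 \<Omega>"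
  by (simp add: is_weak_curl_def)

lemma cdot_axis: "cdot v (axis i z) = v $ i * z"
  unfolding cdot_def axis_def by (simp add: if_distrib cong: if_cong)

lemma is_weak_curl_unique:
  assumes \<Omega>: "open \<Omega>" and c: "is_weak_curl \<Omega> u c" and c': "is_weak_curl \<Omega> u c'"
  shows "AE x in lebesgue_on \<Omega>. c x = c' x"
proof -
  let ?M = "lebesgue_on \<Omega>"
  have L: "c \<in> L2 \<Omega>" "c' \<in> L2 \<Omega>" by (rule is_weak_curl_L2[OF c], rule is_weak_curl_L2[OF c'])
  have D: "(\<lambda>x. c x - c' x) \<in> L2 \<Omega>" by (rule L2_diff(1)[OF L])
  have "AE x in ?M. (c x - c' x) $ i = 0" for i
  proof (rule AE_zero_if_orthogonal_to_bumps[OF \<Omega>])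
    show dm: "(\<lambda>x. (c x - c' x) $ i) \<in> borel_measurable ?M"
      by (rule borel_measurable_component[OF L2_borel_measurable[OF D]])
    fix a b :: "real^3" assume sub: "cbox a b \<subseteq> \<Omega>"
    have bM: "cbox a b \<in> sets ?M" using sub \<Omega> by (auto simp: sets_restrict_space_iff)
    show "integrable ?M (\<lambda>x. indicator (cbox a b) x *\<^sub>R (c x - c' x) $ i)"
    proof (rule L2_product_bound(1)[OF _ D])
      have "emeasure ?M (cbox a b) < \<infinity>"
        using sub \<Omega> emeasure_bounded_finite[OF bounded_cbox, of a b] by (subst emeasure_restrict_space) auto
      then have "integrable ?M (indicator (cbox a b) :: _ \<Rightarrow> real)" using bM by (intro integrable_real_indicator)
      moreover have "(\<lambda>x. (norm (indicator (cbox a b) x :: real))\<^sup>2) = indicator (cbox a b)" by (auto simp: indicator_def)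
      ultimately show "(indicator (cbox a b) :: _ \<Rightarrow> real) \<in> L2 \<Omega>" using bM by (simp add: L2_def)
      show "(\<lambda>x. indicator (cbox a b) x *\<^sub>R (c x - c' x) $ i) \<in> borel_measurable ?M"
        using bM dm by (intro borel_measurable_scaleR borel_measurable_indicator)
      show "norm (indicator (cbox a b) x *\<^sub>R (c x - c' x) $ i) \<le> norm (indicator (cbox a b) x :: real) * norm (c x - c' x)" for x
        using Finite_Cartesian_Product.norm_nth_le[of "c x - c' x" i] by (auto simp: indicator_def simp del: vector_minus_component)
    qed
    fix n :: real assume "n \<ge> 0"
    define \<phi> where "\<phi> x = axis i (complex_of_real (box_bump a b n x))" for x
    have "bounded_linear (\<lambda>t::real. axis i (complex_of_real t) :: complex^3)"
      unfolding linear_conv_bounded_linear[symmetric]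
      by (rule linearI) (simp_all add: vec_eq_iff axis_def scaleR_conv_of_real[where 'a = complex])
    then have t: "\<phi> \<in> test_functions \<Omega>"
      unfolding \<phi>_def [abs_def] by (rule box_bump_test_function[OF _ sub \<open>n \<ge> 0\<close>])
    note \<phi>L = is_weak_curl_test_function(2)[OF \<Omega> t]
    have "(\<integral>x. cdot (c x) (\<phi> x) \<partial>?M) = (\<integral>x. cdot (c' x) (\<phi> x) \<partial>?M)"
      using c c' t by (simp add: is_weak_curl_def)
    then have "(\<integral>x. cdot (c x) (\<phi> x) - cdot (c' x) (\<phi> x) \<partial>?M) = 0"
      using L2_cdot(1)[OF L(1) \<phi>L] L2_cdot(1)[OF L(2) \<phi>L] by simp
    then show "(\<integral>x. (c x - c' x) $ i * of_real (box_bump a b n x) \<partial>?M) = 0"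
      by (simp add: \<phi>_def cdot_axis algebra_simps)
  qed
  then have "AE x in ?M. \<forall>i\<in>UNIV. (c x - c' x) $ i = 0" by (subst AE_finite_all) auto
  then show ?thesis by eventually_elim (simp add: vec_eq_iff)
qed

lemma is_weak_curl_diff:
  assumes \<Omega>: "open \<Omega>" and "u \<in> L2 \<Omega>" "v \<in> L2 \<Omega>" and u: "is_weak_curl \<Omega> u c" and v: "is_weak_curl \<Omega> v e"
  shows "is_weak_curl \<Omega> (\<lambda>x. u x - v x) (\<lambda>x. c x - e x)"
  unfolding is_weak_curl_def
proof (intro conjI ballI)
  have L: "c \<in> L2 \<Omega>" "e \<in> L2 \<Omega>" by (rule is_weak_curl_L2[OF u], rule is_weak_curl_L2[OF v])
  then show "(\<lambda>x. c x - e x) \<in> L2 \<Omega>" by (rule L2_diff(1))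
  fix \<phi> :: "real^3 \<Rightarrow> complex^3" assume \<phi>: "\<phi> \<in> test_functions \<Omega>"
  note W = is_weak_curl_test_function[OF \<Omega> \<phi>]
  have C: "curl \<phi> \<in> L2 \<Omega>" using W(1) by (simp add: is_weak_curl_def)
  have d: "cdot (p - q) r = cdot p r - cdot q r" for p q r
    by (simp add: cdot_def algebra_simps sum_subtractf)
  show "(\<integral>x. cdot (u x - v x) (curl \<phi> x) \<partial>lebesgue_on \<Omega>) = (\<integral>x. cdot (c x - e x) (\<phi> x) \<partial>lebesgue_on \<Omega>)"
    unfolding d using u v \<phi> L2_cdot(1)[OF assms(2) C] L2_cdot(1)[OF assms(3) C]
      L2_cdot(1)[OF L(1) W(2)] L2_cdot(1)[OF L(2) W(2)]
    by (simp add: is_weak_curl_def)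
qed

lemma is_weak_curl_weak_curl: "u \<in> H_curl \<Omega> \<Longrightarrow> is_weak_curl \<Omega> u (weak_curl \<Omega> u)"
  unfolding H_curl_def weak_curl_def using someI_ex[of "is_weak_curl \<Omega> u"] by blast

lemma is_weak_div_weak_div: "u \<in> H_div \<Omega> \<Longrightarrow> is_weak_div \<Omega> u (weak_div \<Omega> u)"
  unfolding H_div_def weak_div_def using someI_ex[of "is_weak_div \<Omega> u"] by blast

text \<open>By uniqueness the weak curl chosen for \<open>w - \<phi>\<close> is the difference of the curls of \<open>w\<close> and \<open>\<phi>\<close>.\<close>

lemma H0_curl_approximation:
  assumes \<Omega>: "open \<Omega>" and w: "w \<in> H0_curl \<Omega>" and \<epsilon>: "\<epsilon> > 0"
  obtains \<phi> where "\<phi> \<in> test_functions \<Omega>" "L2_norm \<Omega> (\<lambda>x. w x - \<phi> x) < \<epsilon>"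
    "L2_norm \<Omega> (\<lambda>x. weak_curl \<Omega> w x - curl \<phi> x) < \<epsilon>"
proof -
  obtain \<phi> where \<phi>: "\<phi> \<in> test_functions \<Omega>" and lt: "H_curl_norm \<Omega> (\<lambda>x. w x - \<phi> x) < \<epsilon>"
    using w \<epsilon> unfolding H0_curl_def mem_Collect_eq by blast
  have wH: "w \<in> H_curl \<Omega>" using w unfolding H0_curl_def by blast
  then have wL: "w \<in> L2 \<Omega>" unfolding H_curl_def by blast
  let ?d = "\<lambda>x. w x - \<phi> x" and ?c = "\<lambda>x. weak_curl \<Omega> w x - curl \<phi> x"
  have c: "is_weak_curl \<Omega> ?d ?c"
    by (rule is_weak_curl_diff[OF \<Omega> wL is_weak_curl_test_function(2)[OF \<Omega> \<phi>]
        is_weak_curl_weak_curl[OF wH] is_weak_curl_test_function(1)[OF \<Omega> \<phi>]])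
  then have "is_weak_curl \<Omega> ?d (weak_curl \<Omega> ?d)"
    unfolding weak_curl_def[of \<Omega> "\<lambda>x. w x - \<phi> x"] by (rule someI[of "is_weak_curl \<Omega> ?d"])
  then have "AE x in lebesgue_on \<Omega>. weak_curl \<Omega> ?d x = ?c x" using c by (rule is_weak_curl_unique[OF \<Omega>])
  then have "AE x in lebesgue_on \<Omega>. (norm (weak_curl \<Omega> ?d x))\<^sup>2 = (norm (?c x))\<^sup>2" by eventually_elim simp
  then have eq: "L2_norm \<Omega> (weak_curl \<Omega> ?d) = L2_norm \<Omega> ?c"
    using is_weak_curl_L2[OF c] is_weak_curl_L2[OF \<open>is_weak_curl \<Omega> ?d (weak_curl \<Omega> ?d)\<close>]
    by (auto simp: L2_norm_def L2_def intro!: integral_cong_AE)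
  have "L2_norm \<Omega> ?d \<le> H_curl_norm \<Omega> ?d" "L2_norm \<Omega> (weak_curl \<Omega> ?d) \<le> H_curl_norm \<Omega> ?d"
    unfolding H_curl_norm_def using L2_norm_nonneg by (auto intro!: real_le_rsqrt)
  then show ?thesis using that[OF \<phi>] lt eq by simp
qed

text \<open>By Lindelof's theorem countably many of the open sets on which \<open>f\<close> vanishes almost everywhere
  cover all of them.\<close>

lemma AE_zero_outside_ess_supp:
  assumes \<Omega>: "open \<Omega>"
  shows "AE x in lebesgue_on \<Omega>. x \<notin> ess_supp \<Omega> f \<longrightarrow> f x = 0"
proof -
  define F where "F = {U. open U \<and> (AE y in lebesgue_on (U \<inter> \<Omega>). f y = 0)}"
  obtain F' where F': "F' \<subseteq> F" "countable F'" "\<Union>F' = \<Union>F"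
  proof (rule Lindelof[of F])
    show "open S" if "S \<in> F" for S using that by (simp add: F_def)
  qed
  have "AE x in lebesgue. \<forall>U\<in>F'. x \<in> U \<inter> \<Omega> \<longrightarrow> f x = 0"
  proof (subst AE_ball_countable[OF F'(2)], intro ballI)
    fix U assume "U \<in> F'"
    then have U: "open U" "AE y in lebesgue_on (U \<inter> \<Omega>). f y = 0" using F' by (auto simp: F_def)
    then show "AE x in lebesgue. x \<in> U \<inter> \<Omega> \<longrightarrow> f x = 0"
      using \<Omega> by (subst (asm) AE_restrict_space_iff) (auto simp: open_Int)
  qed
  then have "AE x in lebesgue. x \<in> \<Omega> \<longrightarrow> x \<notin> ess_supp \<Omega> f \<longrightarrow> f x = 0"
  proof eventually_elim
    case (elim x)
    show ?case
    proof (intro impI)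
      assume "x \<in> \<Omega>" "x \<notin> ess_supp \<Omega> f"
      then have "x \<in> \<Union>F" by (auto simp: ess_supp_def F_def)
      then show "f x = 0" using elim F'(3) \<open>x \<in> \<Omega>\<close> by blast
    qed
  qed
  then show ?thesis using \<Omega> by (subst AE_restrict_space_iff) auto
qed

section \<open>Potentials along rays\<close>

definition rdot :: "real^3 \<Rightarrow> complex^3 \<Rightarrow> complex" where
  "rdot v a = (\<Sum>j\<in>UNIV. (v $ j) *\<^sub>R (a $ j))"

lemma rdot_expand: "rdot v a = (v $ 1) *\<^sub>R (a $ 1) + (v $ 2) *\<^sub>R (a $ 2) + (v $ 3) *\<^sub>R (a $ 3)"
  by (simp add: rdot_def sum_3)

lemma bounded_linear_rdot: "bounded_linear (rdot v)"
  unfolding rdot_def [abs_def]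
  by (intro bounded_linear_sum bounded_linear_scaleR_right[THEN bounded_linear_compose] bounded_linear_vec_nth)

lemma rdot_axis: "rdot (axis i 1) a = a $ i"
  unfolding rdot_def axis_def by (simp add: if_distrib[of "\<lambda>c. c *\<^sub>R _"] cong: if_cong)

lemma norm_rdot_le: "norm (rdot v a) \<le> norm v * norm a"
proof -
  have "norm (rdot v a) \<le> (\<Sum>i\<in>UNIV. \<bar>v $ i\<bar> * norm (a $ i))"
    unfolding rdot_def by (rule sum_norm_le) simp
  also have "\<dots> \<le> norm v * norm a"
    using L2_set_mult_ineq[of "\<lambda>i. v $ i" "\<lambda>i. norm (a $ i)" UNIV]
    by (simp add: norm_vec_def L2_set_def)
  finally show ?thesis .
qed

text \<open>The curl as an alternating bilinear form: for \<open>C\<^sup>1\<close> fields this equals \<open>curl f \<cdot> (v \<times> e)\<close>.\<close>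

definition curl_pairing :: "(real^3 \<Rightarrow> complex^3) \<Rightarrow> real^3 \<Rightarrow> real^3 \<Rightarrow> real^3 \<Rightarrow> complex" where
  "curl_pairing f v e y = rdot e (frechet_derivative f (at y) v) - rdot v (frechet_derivative f (at y) e)"

lemma norm_curl_pairing_le:
  assumes f: "C_k (Suc 0) f"
  shows "norm (curl_pairing f v e y) \<le> 6 * norm v * norm e * norm (curl f y)"
proof -
  let ?D = "frechet_derivative f (at y)"
  note lin = has_derivative_linear[OF C_k_SucD(1)[OF f, of y]]
  have exp: "v = (v $ 1) *\<^sub>R axis 1 1 + (v $ 2) *\<^sub>R axis 2 1 + (v $ 3) *\<^sub>R axis 3 1" for v :: "real^3"
    by (simp add: vec_eq_iff forall_3 axis_def)
  have D: "?D v = (v $ 1) *\<^sub>R ?D (axis 1 1) + (v $ 2) *\<^sub>R ?D (axis 2 1) + (v $ 3) *\<^sub>R ?D (axis 3 1)" for v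
    by (subst exp) (simp add: linear_add[OF lin] linear_scale[OF lin])
  have pd: "partial_deriv i (\<lambda>y. f y $ j) y = ?D (axis i 1) $ j" for i j
    unfolding partial_deriv_def
    using frechet_derivative_at[OF bounded_linear.has_derivative[OF bounded_linear_vec_nth C_k_SucD(1)[OF f, of y]]]
    by metis
  have eq: "curl_pairing f v e y = (v $ 1 * e $ 2 - v $ 2 * e $ 1) *\<^sub>R (curl f y $ 3)
      + (v $ 2 * e $ 3 - v $ 3 * e $ 2) *\<^sub>R (curl f y $ 1)
      + (v $ 3 * e $ 1 - v $ 1 * e $ 3) *\<^sub>R (curl f y $ 2)"
    unfolding curl_pairing_def D[of v] D[of e] rdot_expand curl_def pd
    by (simp add: algebra_simps)
  have co: "norm ((v $ i * e $ j - v $ j * e $ i) *\<^sub>R (curl f y $ k)) \<le> 2 * norm v * norm e * norm (curl f y)" for i j k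
  proof -
    have p: "\<bar>v $ i * e $ j\<bar> \<le> norm v * norm e" for i j
      unfolding abs_mult by (intro mult_mono component_le_norm_cart) auto
    have "\<bar>v $ i * e $ j - v $ j * e $ i\<bar> \<le> 2 * norm v * norm e"
      using p[of i j] p[of j i] by linarith
    then show ?thesis unfolding norm_scaleR
      by (intro mult_mono Finite_Cartesian_Product.norm_nth_le) auto
  qed
  show ?thesis
    unfolding eq using co[of 1 2 3] co[of 2 3 1] co[of 3 1 2]
    by (intro order_trans[OF norm_triangle_ineq] order_trans[OF add_right_mono[OF norm_triangle_ineq]]) linarith
qed

lemma integral_support_le:
  fixes g :: "real \<Rightarrow> real"
  assumes g: "continuous_on {0..} g" "\<And>t. t \<ge> 0 \<Longrightarrow> g t \<ge> 0" "\<And>t. t > c \<Longrightarrow> g t = 0" and "A \<ge> 0" "c \<ge> 0"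
  shows "integral {0..A} g \<le> integral {0..c} g"
proof (cases "A \<le> c")
  case True
  then show ?thesis
    using g by (intro integral_subset_le integrable_continuous_real continuous_on_subset[OF g(1)]) auto
next
  case False
  have int: "g integrable_on {0..A}" by (intro integrable_continuous_real continuous_on_subset[OF g(1)]) auto
  have "integral {0..c} g + integral {c..A} g = integral {0..A} g"
    using False assms(5) by (intro Henstock_Kurzweil_Integration.integral_combine int) auto
  moreover have "integral {c..A} g = 0"
  proof -
    have "negligible {c}" by simp
    then have "integral {c..A} g = integral {c..A} (\<lambda>_. 0)"
      by (rule integral_spike) (use g(3) in auto)
    then show ?thesis by simp
  qed
  ultimately show ?thesis by simp
qed

text \<open>The variance of \<open>g\<close> on \<open>{0..c}\<close> is nonnegative.\<close>

lemma integral_square_le: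
  fixes g :: "real \<Rightarrow> real"
  assumes g: "continuous_on {0..c} g" and "c \<ge> 0"
  shows "(integral {0..c} g)\<^sup>2 \<le> c * integral {0..c} (\<lambda>t. (g t)\<^sup>2)"
proof (cases "c = 0")
  case False
  define m where "m = integral {0..c} g / c"
  have mc: "m * c = integral {0..c} g" using False by (simp add: m_def)
  have i: "g integrable_on {0..c}" "(\<lambda>t. (g t)\<^sup>2) integrable_on {0..c}" "(\<lambda>t. 2 * m * g t) integrable_on {0..c}"
    by (intro integrable_continuous_real continuous_intros g)+
  have "0 \<le> integral {0..c} (\<lambda>t. (g t - m)\<^sup>2)"
    by (intro integral_nonneg integrable_continuous_real continuous_intros g) auto
  also have "(\<lambda>t. (g t - m)\<^sup>2) = (\<lambda>t. ((g t)\<^sup>2 - 2 * m * g t) + m\<^sup>2)"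
    by (auto simp: power2_diff algebra_simps)
  also have "integral {0..c} \<dots> = integral {0..c} (\<lambda>t. (g t)\<^sup>2) - 2 * m * integral {0..c} g + m\<^sup>2 * c"
    using i \<open>c \<ge> 0\<close>
    by (subst Henstock_Kurzweil_Integration.integral_add) (auto simp: Henstock_Kurzweil_Integration.integral_diff integrable_diff mult.commute)
  also have "\<dots> = integral {0..c} (\<lambda>t. (g t)\<^sup>2) - m\<^sup>2 * c"
    unfolding mc[symmetric] by (simp add: power2_eq_square algebra_simps)
  finally have "c * (m\<^sup>2 * c) \<le> c * integral {0..c} (\<lambda>t. (g t)\<^sup>2)"
    using \<open>c \<ge> 0\<close> by (intro mult_left_mono) auto
  then show ?thesis unfolding mc[symmetric] by (simp add: power2_eq_square algebra_simps)
qed auto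

text \<open>A field that vanishes above height \<open>M\<close>. For directions with third component 1, integrals over
  \<open>{0..M}\<close> therefore exhaust the whole ray from any point above height zero.\<close>

locale ray_field =
  fixes f :: "real^3 \<Rightarrow> complex^3" and M :: real
  assumes C1: "C_k (Suc 0) f" and M_pos: "M \<ge> 0" and top: "\<And>x. x $ 3 \<ge> M \<Longrightarrow> f x = 0"
begin

definition ray_potential :: "real^3 \<Rightarrow> real^3 \<Rightarrow> complex" where
  "ray_potential e x = - integral {0..M} (\<lambda>t. rdot e (f (x + t *\<^sub>R e)))"

lemma cont_f: "continuous_on UNIV f" using C1 by (rule C_k_continuous)

lemma cont_D: "continuous_on UNIV (\<lambda>x. frechet_derivative f (at x) v)"
  using C_k_SucD(2)[OF C1] by simp

lemma cont_rdot: "continuous_on A g \<Longrightarrow> continuous_on A (\<lambda>x. rdot v (g x))"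
  by (rule bounded_linear.continuous_on[OF bounded_linear_rdot])

lemma cont_curl_pairing: "continuous_on UNIV (curl_pairing f v e)"
  unfolding curl_pairing_def [abs_def] by (intro continuous_intros cont_rdot cont_D)

lemma ray_derivative:
  "((\<lambda>t. rdot v (f (x + t *\<^sub>R e))) has_vector_derivative rdot v (frechet_derivative f (at (x + t *\<^sub>R e)) e)) (at t)"
proof -
  have "((\<lambda>t. x + t *\<^sub>R e) has_derivative (\<lambda>h. h *\<^sub>R e)) (at t)"
    by (auto intro!: derivative_eq_intros)
  from has_derivative_compose[OF this C_k_SucD(1)[OF C1, of "x + t *\<^sub>R e"]]
  have "((\<lambda>t. f (x + t *\<^sub>R e)) has_derivative (\<lambda>h. h *\<^sub>R frechet_derivative f (at (x + t *\<^sub>R e)) e)) (at t)"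
    by (simp add: linear_scale[OF has_derivative_linear[OF C_k_SucD(1)[OF C1]]])
  from bounded_linear.has_derivative[OF bounded_linear_rdot this]
  show ?thesis by (simp add: has_vector_derivative_def linear_scale[OF bounded_linear.linear[OF bounded_linear_rdot]])
qed

lemma ray_potential_derivative_raw:
  "(ray_potential e has_derivative
     (\<lambda>v. - integral {0..M} (\<lambda>t. rdot e (frechet_derivative f (at (x + t *\<^sub>R e)) v)))) (at x)"
  "continuous_on UNIV (\<lambda>x. integral {0..M} (\<lambda>t. rdot e (frechet_derivative f (at (x + t *\<^sub>R e)) v)))"
proof -
  have d: "((\<lambda>x. rdot e (f (x + t *\<^sub>R e))) has_derivative (\<lambda>v. rdot e (frechet_derivative f (at (x + t *\<^sub>R e)) v))) (at x)" for x t
  proof -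
    have "((\<lambda>x. x + t *\<^sub>R e) has_derivative (\<lambda>v. v)) (at x)" by (auto intro!: derivative_eq_intros)
    from bounded_linear.has_derivative[OF bounded_linear_rdot has_derivative_compose[OF this C_k_SucD(1)[OF C1, of "x + t *\<^sub>R e"]]]
    show ?thesis .
  qed
  have c: "continuous_on {0..M} (\<lambda>t. rdot e (f (x + t *\<^sub>R e)))" for x
    by (intro cont_rdot continuous_on_compose2[OF cont_f] continuous_intros) auto
  have c': "continuous_on (UNIV \<times> {0..M}) (\<lambda>(x, t). rdot e (frechet_derivative f (at (x + t *\<^sub>R e)) v))" for v
    unfolding split_beta by (intro cont_rdot continuous_on_compose2[OF cont_D] continuous_intros) auto
  note I = has_derivative_integral_cbox[where a = 0 and b = M and F = "\<lambda>x t. rdot e (f (x + t *\<^sub>R e))"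
      and F' = "\<lambda>x t v. rdot e (frechet_derivative f (at (x + t *\<^sub>R e)) v)", unfolded box_real, OF d c c']
  show "(ray_potential e has_derivative
     (\<lambda>v. - integral {0..M} (\<lambda>t. rdot e (frechet_derivative f (at (x + t *\<^sub>R e)) v)))) (at x)"
    unfolding ray_potential_def [abs_def] by (rule has_derivative_minus[OF I(1)])
  show "continuous_on UNIV (\<lambda>x. integral {0..M} (\<lambda>t. rdot e (frechet_derivative f (at (x + t *\<^sub>R e)) v)))"
    by (rule I(2))
qed

lemma ray_potential_C1: "C_k (Suc 0) (ray_potential e)"
  by (rule C_k_SucI[OF ray_potential_derivative_raw(1)]) (auto intro!: continuous_intros ray_potential_derivative_raw(2))

text \<open>Exchanging the two arguments of the derivative of \<open>f\<close> costs one \<open>curl_pairing\<close>, and what is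
  left is the derivative of \<open>f\<close> along the ray, which integrates to the boundary term at \<open>x\<close>.\<close>

lemma ray_potential_derivative:
  assumes e: "e $ 3 = 1" and x: "x $ 3 \<ge> 0"
  shows "(ray_potential e has_derivative
     (\<lambda>v. rdot v (f x) - integral {0..M} (\<lambda>t. curl_pairing f v e (x + t *\<^sub>R e)))) (at x)"
proof -
  have "- integral {0..M} (\<lambda>t. rdot e (frechet_derivative f (at (x + t *\<^sub>R e)) v)) =
      rdot v (f x) - integral {0..M} (\<lambda>t. curl_pairing f v e (x + t *\<^sub>R e))" for v
  proof -
    have "((\<lambda>t. rdot v (frechet_derivative f (at (x + t *\<^sub>R e)) e)) has_integral
        rdot v (f (x + M *\<^sub>R e)) - rdot v (f (x + 0 *\<^sub>R e))) {0..M}"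
      by (rule fundamental_theorem_of_calculus[OF M_pos])
         (rule has_vector_derivative_at_within[OF ray_derivative])
    moreover have "f (x + M *\<^sub>R e) = 0" using e x by (intro top) simp
    ultimately have 1: "((\<lambda>t. rdot v (frechet_derivative f (at (x + t *\<^sub>R e)) e)) has_integral - rdot v (f x)) {0..M}"
      by (simp add: rdot_expand)
    have "(\<lambda>t. rdot e (frechet_derivative f (at (x + t *\<^sub>R e)) v)) integrable_on {0..M}"
      by (intro integrable_continuous_real cont_rdot continuous_on_compose2[OF cont_D] continuous_intros) auto
    with 1 show ?thesis
      unfolding curl_pairing_def
      by (simp add: Henstock_Kurzweil_Integration.integral_diff has_integral_integrable_integral)
  qed
  then show ?thesis using ray_potential_derivative_raw(1)[of e x] by simp
qed

lemma ray_potential_top: "e $ 3 = 1 \<Longrightarrow> x $ 3 \<ge> M \<Longrightarrow> ray_potential e x = 0"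
  unfolding ray_potential_def
  by (subst integral_cong[where g = "\<lambda>_. 0"]) (auto simp: top rdot_expand)

text \<open>Stokes' theorem on the planar quadrant spanned by the two rays: the derivative of the first
  potential along the second ray consists of the integrand of the second potential and a curl term.\<close>

lemma ray_potential_diff:
  assumes e: "e $ 3 = 1" and e': "e' $ 3 = 1" and x: "x $ 3 \<ge> 0"
  shows "ray_potential e x - ray_potential e' x =
    integral {0..M} (\<lambda>t. integral {0..M} (\<lambda>s. curl_pairing f e' e (x + t *\<^sub>R e' + s *\<^sub>R e)))"
proof -
  let ?I = "\<lambda>t. integral {0..M} (\<lambda>s. curl_pairing f e' e (x + t *\<^sub>R e' + s *\<^sub>R e))"
  have d: "((\<lambda>t. ray_potential e (x + t *\<^sub>R e')) has_vector_derivative (rdot e' (f (x + t *\<^sub>R e')) - ?I t)) (at t)" if "t \<ge> 0" for t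
  proof -
    have "((\<lambda>t. x + t *\<^sub>R e') has_derivative (\<lambda>h. h *\<^sub>R e')) (at t)"
      by (auto intro!: derivative_eq_intros)
    moreover have P: "(ray_potential e has_derivative
       (\<lambda>v. rdot v (f (x + t *\<^sub>R e')) - integral {0..M} (\<lambda>s. curl_pairing f v e (x + t *\<^sub>R e' + s *\<^sub>R e)))) (at (x + t *\<^sub>R e'))"
      using that x e' by (intro ray_potential_derivative e) simp
    ultimately have "((\<lambda>t. ray_potential e (x + t *\<^sub>R e')) has_derivative
       (\<lambda>h. (rdot (h *\<^sub>R e') (f (x + t *\<^sub>R e')) - integral {0..M} (\<lambda>s. curl_pairing f (h *\<^sub>R e') e (x + t *\<^sub>R e' + s *\<^sub>R e))))) (at t)"
      by (rule has_derivative_compose)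
    then show ?thesis unfolding has_vector_derivative_def
      using linear_scale[OF has_derivative_linear[OF P], of _ e'] by simp
  qed
  have "((\<lambda>t. rdot e' (f (x + t *\<^sub>R e')) - ?I t) has_integral
      ray_potential e (x + M *\<^sub>R e') - ray_potential e (x + 0 *\<^sub>R e')) {0..M}"
    by (rule fundamental_theorem_of_calculus[OF M_pos]) (rule has_vector_derivative_at_within[OF d], simp)
  moreover have "ray_potential e (x + M *\<^sub>R e') = 0"
    using x e e' by (intro ray_potential_top) auto
  ultimately have 1: "integral {0..M} (\<lambda>t. rdot e' (f (x + t *\<^sub>R e')) - ?I t) = - ray_potential e x"
    by (simp add: has_integral_iff)
  have "continuous_on (UNIV \<times> {0..M}) (\<lambda>(t, s). curl_pairing f e' e (x + t *\<^sub>R e' + s *\<^sub>R e))"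
    unfolding split_beta by (intro continuous_on_compose2[OF cont_curl_pairing] continuous_intros) auto
  then have "continuous_on UNIV ?I"
    using integral_continuous_on_param[of UNIV 0 M "\<lambda>t s. curl_pairing f e' e (x + t *\<^sub>R e' + s *\<^sub>R e)"] by simp
  then have i: "?I integrable_on {0..M}"
    by (intro integrable_continuous_real) (rule continuous_on_subset, auto)
  have "(\<lambda>t. rdot e' (f (x + t *\<^sub>R e'))) integrable_on {0..M}"
    by (intro integrable_continuous_real cont_rdot continuous_on_compose2[OF cont_f] continuous_intros) auto
  with i 1 show ?thesis
    by (simp add: Henstock_Kurzweil_Integration.integral_diff ray_potential_def algebra_simps)
qed

end

section \<open>Integrals over rays\<close>

definition axis_dist :: "real^3 \<Rightarrow> real" where
  "axis_dist x = sqrt ((x $ 1)\<^sup>2 + (x $ 2)\<^sup>2)"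

lemma abs_le_axis_dist: "\<bar>x $ 1\<bar> \<le> axis_dist x" "\<bar>x $ 2\<bar> \<le> axis_dist x"
  by (auto simp: axis_dist_def intro: real_le_rsqrt)

lemma axis_dist_nonneg: "axis_dist x \<ge> 0" by (simp add: axis_dist_def)

lemma continuous_on_axis_dist: "continuous_on A axis_dist"
  unfolding axis_dist_def [abs_def] by (intro continuous_intros)

text \<open>Used for \<open>k = 1, 2\<close> and \<open>s = \<plusminus>1\<close>: one unit outwards along the axis \<open>k\<close>, one unit upwards.\<close>

definition ray_dir :: "3 \<Rightarrow> real \<Rightarrow> real^3" where
  "ray_dir k s = axis k s + axis 3 1"

lemma ray_dir_simps [simp]:
  "ray_dir 1 s $ 1 = s" "ray_dir 1 s $ 2 = 0" "ray_dir 1 s $ 3 = 1"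
  "ray_dir 2 s $ 1 = 0" "ray_dir 2 s $ 2 = s" "ray_dir 2 s $ 3 = 1"
  by (auto simp: ray_dir_def axis_def)

lemma norm_ray_dir_le: "\<bar>s\<bar> = 1 \<Longrightarrow> norm (ray_dir 1 s) \<le> 2" "\<bar>s\<bar> = 1 \<Longrightarrow> norm (ray_dir 2 s) \<le> 2"
  using norm_le_l1_cart[of "ray_dir 1 s"] norm_le_l1_cart[of "ray_dir 2 s"] by (simp_all add: sum_3)

definition ray_integral :: "real^3 \<Rightarrow> real \<Rightarrow> (real^3 \<Rightarrow> real) \<Rightarrow> real^3 \<Rightarrow> real" where
  "ray_integral e c g x = integral {0..c} (\<lambda>t. g (x + t *\<^sub>R e))"

lemma continuous_on_ray:
  fixes g :: "real^3 \<Rightarrow> 'b::topological_space"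
  assumes "continuous_on UNIV g"
  shows "continuous_on A (\<lambda>t. g (x + t *\<^sub>R e))"
  by (intro continuous_on_compose2[OF assms] continuous_intros) auto

lemma continuous_on_ray_integral:
  assumes "continuous_on UNIV g" shows "continuous_on A (ray_integral e c g)"
proof -
  have "continuous_on (UNIV \<times> {0..c}) (\<lambda>(x, t). g (x + t *\<^sub>R e))"
    unfolding split_beta by (intro continuous_on_compose2[OF assms] continuous_intros) auto
  then have "continuous_on UNIV (ray_integral e c g)"
    unfolding ray_integral_def [abs_def]
    using integral_continuous_on_param[of UNIV 0 c "\<lambda>x t. g (x + t *\<^sub>R e)"] by simp
  then show ?thesis by (rule continuous_on_subset) auto
qed

lemma ray_integral_nonneg: "(\<And>x. g x \<ge> 0) \<Longrightarrow> continuous_on UNIV g \<Longrightarrow> ray_integral e c g x \<ge> 0"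
  unfolding ray_integral_def
  by (intro integral_nonneg integrable_continuous_real continuous_on_ray) auto

lemma ray_integral_mono:
  assumes "continuous_on UNIV g" "continuous_on UNIV g'" "\<And>x. g x \<le> g' x"
  shows "ray_integral e c g x \<le> ray_integral e c g' x"
  unfolding ray_integral_def
  by (intro integral_le integrable_continuous_real continuous_on_ray assms)

lemma ray_integral_mono_length:
  assumes "continuous_on UNIV g" "\<And>x. 0 \<le> g x" "c \<le> c'"
  shows "ray_integral e c g x \<le> ray_integral e c' g x"
  unfolding ray_integral_def using assms
  by (intro integral_subset_le integrable_continuous_real continuous_on_ray) auto

lemma ray_integral_square_le:
  assumes "continuous_on UNIV g" "c \<ge> 0"
  shows "(ray_integral e c g x)\<^sup>2 \<le> c * ray_integral e c (\<lambda>y. (g y)\<^sup>2) x"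
  unfolding ray_integral_def by (intro integral_square_le continuous_on_ray assms)

text \<open>The factor \<open>c\<^sup>2\<close> is the area of the square. The square on the right may be larger, so that its
  size no longer depends on \<open>x\<close>.\<close>

lemma ray_integral_twice_square_le:
  assumes g: "continuous_on UNIV g" "\<And>x. g x \<ge> 0" and c: "0 \<le> c" "c \<le> c'"
  shows "(ray_integral e' c (ray_integral e c g) x)\<^sup>2 \<le> c\<^sup>2 * ray_integral e' c' (ray_integral e c' (\<lambda>y. (g y)\<^sup>2)) x"
proof -
  let ?g2 = "\<lambda>y. (g y)\<^sup>2"
  have g2: "continuous_on UNIV ?g2" by (intro continuous_intros g)
  note cr = continuous_on_ray_integral
  have "(ray_integral e' c (ray_integral e c g) x)\<^sup>2 \<le> c * ray_integral e' c (\<lambda>y. (ray_integral e c g y)\<^sup>2) x"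
    by (rule ray_integral_square_le[OF cr[OF g(1)] c(1)])
  also have "\<dots> \<le> c * ray_integral e' c (\<lambda>y. c * ray_integral e c ?g2 y) x"
    using ray_integral_square_le[OF g(1) c(1)] c
    by (intro mult_left_mono ray_integral_mono continuous_intros cr g g2) auto
  also have "\<dots> = c\<^sup>2 * ray_integral e' c (ray_integral e c ?g2) x"
    by (simp add: ray_integral_def power2_eq_square)
  also have "\<dots> \<le> c\<^sup>2 * ray_integral e' c' (ray_integral e c' ?g2) x"
  proof (rule mult_left_mono)
    have "ray_integral e' c (ray_integral e c ?g2) x \<le> ray_integral e' c (ray_integral e c' ?g2) x"
      by (intro ray_integral_mono cr g2 ray_integral_mono_length c(2)) auto
    also have "\<dots> \<le> ray_integral e' c' (ray_integral e c' ?g2) x"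
      by (intro ray_integral_mono_length cr g2 ray_integral_nonneg c(2)) auto
    finally show "ray_integral e' c (ray_integral e c ?g2) x \<le> ray_integral e' c' (ray_integral e c' ?g2) x" .
  qed simp
  finally show ?thesis .
qed

section \<open>Rays leaving a horn\<close>

text \<open>The field vanishes outside the horn of radius \<open>\<rho>\<close>, and \<open>2 \<mu> z\<close> is the time at which a ray of
  slope one from the axis has left the horn for good. \<open>S\<close> is a step function from which the cutoff
  functions are built.\<close>

locale horn_field = ray_field f M for f M +
  fixes \<rho> \<mu> \<mu>' S S' :: "real \<Rightarrow> real" and C0 :: real
  assumes \<rho>_anti: "antimono_on {1<..} \<rho>" and \<rho>_cont: "continuous_on {1<..} \<rho>"
    and outside: "\<And>x. x $ 3 > 1 \<Longrightarrow> \<rho> (x $ 3) \<le> axis_dist x \<Longrightarrow> f x = 0"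
    and \<mu>_pos: "\<And>z. z > 1 \<Longrightarrow> \<mu> z > 0" and \<mu>_le: "\<And>z. z > 1 \<Longrightarrow> 2 * \<mu> z \<le> \<rho> z"
    and \<mu>_exit: "\<And>z. z > 1 \<Longrightarrow> \<rho> (z + 2 * \<mu> z) \<le> 2 * \<mu> z"
    and \<mu>_deriv: "\<And>z. z > 1 \<Longrightarrow> (\<mu> has_real_derivative \<mu>' z) (at z)"
    and \<mu>'_le: "\<And>z. z > 1 \<Longrightarrow> \<bar>\<mu>' z\<bar> \<le> 1" and \<mu>'_cont: "continuous_on {1<..} \<mu>'"
    and S_deriv: "\<And>t. (S has_real_derivative S' t) (at t)" and S'_cont: "continuous_on UNIV S'"
    and S'_le: "\<And>t. \<bar>S' t\<bar> \<le> C0"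
    and S_0: "\<And>t. t \<le> 0 \<Longrightarrow> S t = 0" and S_1: "\<And>t. t \<ge> 1 \<Longrightarrow> S t = 1" and S_range: "\<And>t. 0 \<le> S t \<and> S t \<le> 1"
    and S'_0: "\<And>t. t < 0 \<or> t > 1 \<Longrightarrow> S' t = 0"
begin

abbreviation J :: "real^3 \<Rightarrow> real" where "J x \<equiv> norm (curl f x)"

lemma cont_J: "continuous_on UNIV J" by (intro continuous_intros continuous_on_curl[OF C1])

lemma C0_nonneg: "C0 \<ge> 0" using S'_le[of 0] by linarith

lemma \<rho>_le: "1 < z \<Longrightarrow> z \<le> z' \<Longrightarrow> \<rho> z' \<le> \<rho> z"
  using \<rho>_anti by (auto simp: monotone_on_def)

lemma open_outside: "open {x. 1 < x $ 3 \<and> \<rho> (x $ 3) < axis_dist x}"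
proof -
  have "continuous_on {x::real^3. 1 < x $ 3} (\<lambda>x. axis_dist x - \<rho> (x $ 3))"
    by (intro continuous_intros continuous_on_axis_dist continuous_on_compose2[OF \<rho>_cont]) auto
  moreover have "open {x::real^3. 1 < x $ 3}" by (intro open_Collect_less continuous_intros)
  ultimately have "open ({x::real^3. 1 < x $ 3} \<inter> (\<lambda>x. axis_dist x - \<rho> (x $ 3)) -` {0<..})"
    by (intro continuous_open_preimage) auto
  moreover have "{x::real^3. 1 < x $ 3} \<inter> (\<lambda>x. axis_dist x - \<rho> (x $ 3)) -` {0<..} = {x. 1 < x $ 3 \<and> \<rho> (x $ 3) < axis_dist x}"
    by auto
  ultimately show ?thesis by simp
qed

lemma curl_outside:
  assumes "1 < x $ 3" "\<rho> (x $ 3) < axis_dist x"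
  shows "curl f x = 0"
proof -
  let ?S = "- {x. 1 < x $ 3 \<and> \<rho> (x $ 3) < axis_dist x}"
  have "partial_deriv i (\<lambda>y. f y $ j) x = 0" for i j
    unfolding partial_deriv_def
    by (rule frechet_derivative_outside_support[of ?S])
       (use outside assms open_outside in \<open>auto simp: closed_def\<close>)
  then show ?thesis by (simp add: curl_def vec_eq_iff forall_3)
qed

lemma far_zero:
  fixes x y :: "real^3"
  assumes "1 < x $ 3" "x $ 3 \<le> y $ 3" "\<rho> (x $ 3) < axis_dist y"
  shows "curl f y = 0" "f y = 0"
  using assms \<rho>_le[of "x $ 3" "y $ 3"] by (auto intro!: curl_outside outside)

text \<open>After the time \<open>2 \<rho>(x\<^sub>3)\<close> the ray has moved by more than the diameter of the horizontal
  section, while the sections only shrink on the way up.\<close>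

lemma far_along_ray:
  assumes x: "1 < x $ 3" "axis_dist x \<le> \<rho> (x $ 3)" and k: "k = 1 \<or> k = 2" and s: "\<bar>s\<bar> = 1" and t: "t > 2 * \<rho> (x $ 3)"
  shows "curl f (x + t *\<^sub>R ray_dir k s) = 0" "f (x + t *\<^sub>R ray_dir k s) = 0"
proof -
  let ?y = "x + t *\<^sub>R ray_dir k s"
  have "t \<ge> 0" using t x axis_dist_nonneg[of x] by linarith
  have "\<bar>t * s\<bar> = t" using s \<open>t \<ge> 0\<close> by (simp add: abs_mult)
  then have "\<rho> (x $ 3) < \<bar>?y $ k\<bar>"
    using k abs_le_axis_dist[of x] x t by auto
  then have "\<rho> (x $ 3) < axis_dist ?y" using k abs_le_axis_dist[of ?y] by auto
  moreover have "x $ 3 \<le> ?y $ 3" using k \<open>t \<ge> 0\<close> by auto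
  ultimately show "curl f ?y = 0" "f ?y = 0" using far_zero x by auto
qed

text \<open>If the start lies at most \<open>\<mu>\<close> on the wrong side of the axis, then a parameter above \<open>3 \<mu>\<close>
  moves the point to axis distance more than \<open>2 \<mu>\<close> and lifts it by more than \<open>2 \<mu>\<close>, where the radius
  is at most \<open>2 \<mu>\<close>.\<close>

lemma far_in_quadrant:
  assumes x: "1 < x $ 3" and s: "\<bar>s\<bar> = 1" "\<bar>s'\<bar> = 1"
    and reg: "- \<mu> (x $ 3) \<le> s * x $ 1" "- \<mu> (x $ 3) \<le> s' * x $ 2"
    and t: "t \<ge> 0" "r \<ge> 0" "t > 3 * \<mu> (x $ 3) \<or> r > 3 * \<mu> (x $ 3)"
  shows "curl f (x + t *\<^sub>R ray_dir 2 s' + r *\<^sub>R ray_dir 1 s) = 0"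
proof -
  let ?y = "x + t *\<^sub>R ray_dir 2 s' + r *\<^sub>R ray_dir 1 s"
  have m: "\<mu> (x $ 3) > 0" using \<mu>_pos x by auto
  have y: "?y $ 1 = x $ 1 + r * s" "?y $ 2 = x $ 2 + t * s'" "?y $ 3 = x $ 3 + t + r" by auto
  have "2 * \<mu> (x $ 3) < \<bar>?y $ 1\<bar> \<or> 2 * \<mu> (x $ 3) < \<bar>?y $ 2\<bar>"
    using s reg t unfolding y by (auto simp: abs_if split: if_splits)
  then have "2 * \<mu> (x $ 3) < axis_dist ?y" using abs_le_axis_dist[of ?y] by auto
  moreover have "\<rho> (?y $ 3) \<le> \<rho> (x $ 3 + 2 * \<mu> (x $ 3))"
    using x m t unfolding y by (intro \<rho>_le) auto
  moreover have "\<rho> (x $ 3 + 2 * \<mu> (x $ 3)) \<le> 2 * \<mu> (x $ 3)" using \<mu>_exit x by auto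
  moreover have "1 < ?y $ 3" using x t y by auto
  ultimately show ?thesis by (intro curl_outside) auto
qed

abbreviation P :: "3 \<Rightarrow> real \<Rightarrow> real^3 \<Rightarrow> complex" where "P k s \<equiv> ray_potential (ray_dir k s)"

text \<open>A ray that starts outside the horn and points away from the axis stays outside.\<close>

lemma ray_potential_outside:
  assumes x: "1 < x $ 3" "\<rho> (x $ 3) \<le> axis_dist x" and k: "k = 1 \<or> k = 2" and s: "0 \<le> s * x $ k"
  shows "P k s x = 0"
proof -
  have "f (x + t *\<^sub>R ray_dir k s) = 0" if "t \<ge> 0" for t
  proof -
    let ?y = "x + t *\<^sub>R ray_dir k s"
    have sq: "(x $ k)\<^sup>2 \<le> (x $ k + t * s)\<^sup>2"
    proof -
      have "(x $ k + t * s)\<^sup>2 = (x $ k)\<^sup>2 + 2 * t * (s * x $ k) + (t * s)\<^sup>2"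
        by (simp add: power2_sum algebra_simps)
      moreover have "2 * t * (s * x $ k) \<ge> 0" using that s by simp
      ultimately show ?thesis using zero_le_power2[of "t * s"] by linarith
    qed
    have "axis_dist x \<le> axis_dist ?y" using k sq unfolding axis_dist_def by auto
    moreover have "\<rho> (?y $ 3) \<le> \<rho> (x $ 3)" using x k that by (intro \<rho>_le) auto
    moreover have "1 < ?y $ 3" using x k that by auto
    ultimately show ?thesis using x by (intro outside) auto
  qed
  then show ?thesis unfolding ray_potential_def
    by (subst integral_cong[where g = "\<lambda>_. 0"]) (auto simp: rdot_expand)
qed

lemma ray_error_le:
  assumes x: "1 < x $ 3" "axis_dist x \<le> \<rho> (x $ 3)" "\<rho> (x $ 3) \<le> R" and k: "k = 1 \<or> k = 2" and s: "\<bar>s\<bar> = 1"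
  shows "norm (integral {0..M} (\<lambda>t. curl_pairing f v (ray_dir k s) (x + t *\<^sub>R ray_dir k s)))
     \<le> 12 * norm v * sqrt (2 * R * ray_integral (ray_dir k s) (2 * R) (\<lambda>y. (J y)\<^sup>2) x)"
proof -
  let ?e = "ray_dir k s"
  have R: "R \<ge> 0" using x axis_dist_nonneg[of x] by linarith
  have ne: "norm ?e \<le> 2" using k norm_ray_dir_le[OF s] by auto
  have "norm (curl_pairing f v ?e y) \<le> 12 * norm v * J y" for y
  proof -
    have "6 * norm v * norm ?e * J y \<le> 6 * norm v * 2 * J y"
      by (intro mult_mono ne) auto
    then show ?thesis using norm_curl_pairing_le[OF C1, of v ?e y] by simp
  qed
  then have "norm (integral {0..M} (\<lambda>t. curl_pairing f v ?e (x + t *\<^sub>R ?e))) \<le> integral {0..M} (\<lambda>t. 12 * norm v * J (x + t *\<^sub>R ?e))"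
    by (intro integral_norm_bound_integral integrable_continuous_real continuous_intros continuous_on_ray cont_J cont_curl_pairing) auto
  also have "\<dots> = 12 * norm v * integral {0..M} (\<lambda>t. J (x + t *\<^sub>R ?e))" by simp
  also have "integral {0..M} (\<lambda>t. J (x + t *\<^sub>R ?e)) \<le> ray_integral ?e (2 * R) J x"
    unfolding ray_integral_def
    using far_along_ray(1)[OF x(1,2) k s] x(3) M_pos R
    by (intro integral_support_le continuous_on_ray cont_J) auto
  also have "ray_integral ?e (2 * R) J x \<le> sqrt (2 * R * ray_integral ?e (2 * R) (\<lambda>y. (J y)\<^sup>2) x)"
    using ray_integral_square_le[OF cont_J, of "2 * R"] R by (intro real_le_rsqrt) auto
  finally show ?thesis by (simp add: mult_left_mono)
qed

lemma ray_potential_le: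
  assumes x: "1 < x $ 3" "axis_dist x \<le> \<rho> (x $ 3)" "\<rho> (x $ 3) \<le> R" and k: "k = 1 \<or> k = 2" and s: "\<bar>s\<bar> = 1"
  shows "norm (P k s x) \<le> 2 * sqrt (2 * R * ray_integral (ray_dir k s) (2 * R) (\<lambda>y. (norm (f y))\<^sup>2) x)"
proof -
  let ?e = "ray_dir k s"
  have cn: "continuous_on UNIV (\<lambda>x. norm (f x))" by (intro continuous_intros cont_f)
  have R: "R \<ge> 0" using x axis_dist_nonneg[of x] by linarith
  have ne: "norm ?e \<le> 2" using k norm_ray_dir_le[OF s] by auto
  have "norm (rdot ?e (f y)) \<le> 2 * norm (f y)" for y
    using norm_rdot_le[of ?e "f y"] mult_right_mono[OF ne, of "norm (f y)"] by simp
  then have "norm (P k s x) \<le> integral {0..M} (\<lambda>t. 2 * norm (f (x + t *\<^sub>R ?e)))"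
    unfolding ray_potential_def norm_minus_cancel
    by (intro integral_norm_bound_integral integrable_continuous_real continuous_intros continuous_on_ray cont_rdot cont_f) auto
  also have "\<dots> = 2 * integral {0..M} (\<lambda>t. norm (f (x + t *\<^sub>R ?e)))" by simp
  also have "integral {0..M} (\<lambda>t. norm (f (x + t *\<^sub>R ?e))) \<le> ray_integral ?e (2 * R) (\<lambda>y. norm (f y)) x"
    unfolding ray_integral_def
    using far_along_ray(2)[OF x(1,2) k s] x(3) M_pos R
    by (intro integral_support_le continuous_on_ray[OF cn]) auto
  also have "ray_integral ?e (2 * R) (\<lambda>y. norm (f y)) x \<le> sqrt (2 * R * ray_integral ?e (2 * R) (\<lambda>y. (norm (f y))\<^sup>2) x)"
    using ray_integral_square_le[OF cn, of "2 * R"] R by (intro real_le_rsqrt) auto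
  finally show ?thesis by simp
qed

text \<open>The constant 72 is the product of 24, which bounds the pairing of two directions with the
  curl, and 3, as the square in which the quadrant meets the horn has the side \<open>3 \<mu>\<close>.\<close>

lemma ray_potential_diff_le:
  assumes x: "1 < x $ 3" and R: "3 * \<mu> (x $ 3) \<le> 2 * R" and s: "\<bar>s\<bar> = 1" "\<bar>s'\<bar> = 1"
    and reg: "- \<mu> (x $ 3) \<le> s * x $ 1" "- \<mu> (x $ 3) \<le> s' * x $ 2"
  shows "norm (P 1 s x - P 2 s' x)
     \<le> 72 * \<mu> (x $ 3) * sqrt (ray_integral (ray_dir 2 s') (2 * R) (ray_integral (ray_dir 1 s) (2 * R) (\<lambda>y. (J y)\<^sup>2)) x)"
proof -
  let ?e = "ray_dir 1 s" and ?e' = "ray_dir 2 s'" and ?c = "3 * \<mu> (x $ 3)"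
  have c: "?c \<ge> 0" using \<mu>_pos x by (simp add: less_imp_le)
  have sk: "norm (curl_pairing f ?e' ?e y) \<le> 24 * J y" for y
  proof -
    have "norm (curl_pairing f ?e' ?e y) \<le> 6 * norm ?e' * norm ?e * J y" by (rule norm_curl_pairing_le[OF C1])
    also have "\<dots> \<le> 6 * 2 * 2 * J y" by (intro mult_mono norm_ray_dir_le s) auto
    finally show ?thesis by simp
  qed
  have inner_le: "norm (integral {0..M} (\<lambda>r. curl_pairing f ?e' ?e (y + r *\<^sub>R ?e))) \<le> 24 * ray_integral ?e M J y" for y
    unfolding ray_integral_def integral_mult_right[symmetric]
    by (intro integral_norm_bound_integral integrable_continuous_real continuous_intros continuous_on_ray continuous_on_curl[OF C1] cont_curl_pairing sk)
  have cs: "continuous_on UNIV (\<lambda>t. integral {0..M} (\<lambda>r. curl_pairing f ?e' ?e (x + t *\<^sub>R ?e' + r *\<^sub>R ?e)))"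
  proof -
    have "continuous_on (UNIV \<times> {0..M}) (\<lambda>(t, r). curl_pairing f ?e' ?e (x + t *\<^sub>R ?e' + r *\<^sub>R ?e))"
      unfolding split_beta by (intro continuous_on_compose2[OF cont_curl_pairing] continuous_intros) auto
    then show ?thesis
      using integral_continuous_on_param[of UNIV 0 M "\<lambda>t r. curl_pairing f ?e' ?e (x + t *\<^sub>R ?e' + r *\<^sub>R ?e)"] by simp
  qed
  have ray_cut: "ray_integral ?e M J (x + t *\<^sub>R ?e') \<le> ray_integral ?e ?c J (x + t *\<^sub>R ?e')" if "t \<ge> 0" for t
    unfolding ray_integral_def
    by (intro integral_support_le continuous_on_ray cont_J M_pos c) (use far_in_quadrant[OF x s reg that] c in auto)
  have ray_zero: "ray_integral ?e M J (x + t *\<^sub>R ?e') = 0" if "t > ?c" for t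
    unfolding ray_integral_def
    using far_in_quadrant[OF x s reg] that c
    by (subst integral_cong[where g = "\<lambda>_. 0"]) auto
  have "norm (P 1 s x - P 2 s' x) = norm (integral {0..M} (\<lambda>t. integral {0..M} (\<lambda>r. curl_pairing f ?e' ?e (x + t *\<^sub>R ?e' + r *\<^sub>R ?e))))"
    using x by (subst ray_potential_diff) auto
  also have "\<dots> \<le> integral {0..M} (\<lambda>t. 24 * ray_integral ?e M J (x + t *\<^sub>R ?e'))"
    by (intro integral_norm_bound_integral integrable_continuous_real continuous_intros continuous_on_ray
        continuous_on_ray_integral cont_J inner_le continuous_on_subset[OF cs]) auto
  also have "\<dots> = 24 * integral {0..M} (\<lambda>t. ray_integral ?e M J (x + t *\<^sub>R ?e'))" by simp
  also have "integral {0..M} (\<lambda>t. ray_integral ?e M J (x + t *\<^sub>R ?e')) \<le> integral {0..?c} (\<lambda>t. ray_integral ?e M J (x + t *\<^sub>R ?e'))"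
    using ray_zero by (intro integral_support_le continuous_on_ray continuous_on_ray_integral cont_J ray_integral_nonneg M_pos c) auto
  also have "\<dots> \<le> integral {0..?c} (\<lambda>t. ray_integral ?e ?c J (x + t *\<^sub>R ?e'))"
    using ray_cut by (intro integral_le integrable_continuous_real continuous_on_ray continuous_on_ray_integral cont_J) auto
  also have "\<dots> = ray_integral ?e' ?c (ray_integral ?e ?c J) x" by (simp add: ray_integral_def)
  also have "\<dots> \<le> sqrt (?c\<^sup>2 * ray_integral ?e' (2 * R) (ray_integral ?e (2 * R) (\<lambda>y. (J y)\<^sup>2)) x)"
    by (intro real_le_rsqrt ray_integral_twice_square_le cont_J c R) auto
  also have "\<dots> = ?c * sqrt (ray_integral ?e' (2 * R) (ray_integral ?e (2 * R) (\<lambda>y. (J y)\<^sup>2)) x)"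
    using c by (simp add: real_sqrt_mult)
  finally show ?thesis by simp
qed

end

section \<open>The potential of a field in a horn\<close>

lemma square_sum4_le: "(a + b + c + d)\<^sup>2 \<le> 4 * (a\<^sup>2 + b\<^sup>2 + c\<^sup>2 + d\<^sup>2)" for a b c d :: real
proof -
  have two: "(p + q)\<^sup>2 \<le> 2 * (p\<^sup>2 + q\<^sup>2)" for p q :: real
    using sum_squares_bound[of p q] by (simp add: power2_sum)
  have "(a + b + c + d)\<^sup>2 \<le> 2 * ((a + b)\<^sup>2 + (c + d)\<^sup>2)"
    using two[of "a + b" "c + d"] by (simp add: add.assoc)
  also have "\<dots> \<le> 2 * (2 * (a\<^sup>2 + b\<^sup>2) + 2 * (c\<^sup>2 + d\<^sup>2))"
    by (intro mult_left_mono add_mono two) simp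
  finally show ?thesis by simp
qed

text \<open>The length \<open>2 R\<close> is an upper bound for the parameters at which a ray or a quadrant that is
  needed lies in the horn, provided that \<open>R\<close> bounds the radius at the height of its start.\<close>

definition single_rays :: "real \<Rightarrow> (real^3 \<Rightarrow> real) \<Rightarrow> real^3 \<Rightarrow> real" where
  "single_rays R g x = ray_integral (ray_dir 1 1) (2 * R) g x + ray_integral (ray_dir 1 (-1)) (2 * R) g x
     + ray_integral (ray_dir 2 1) (2 * R) g x + ray_integral (ray_dir 2 (-1)) (2 * R) g x"

definition double_rays :: "real \<Rightarrow> (real^3 \<Rightarrow> real) \<Rightarrow> real^3 \<Rightarrow> real" where
  "double_rays R g x =
       ray_integral (ray_dir 2 1) (2 * R) (ray_integral (ray_dir 1 1) (2 * R) g) x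
     + ray_integral (ray_dir 2 (-1)) (2 * R) (ray_integral (ray_dir 1 1) (2 * R) g) x
     + ray_integral (ray_dir 2 1) (2 * R) (ray_integral (ray_dir 1 (-1)) (2 * R) g) x
     + ray_integral (ray_dir 2 (-1)) (2 * R) (ray_integral (ray_dir 1 (-1)) (2 * R) g) x"

context horn_field
begin

text \<open>Equal to 1 for \<open>s x\<^sub>1 \<ge> \<mu>\<close> and to 0 for \<open>s x\<^sub>1 \<le> 0\<close>. The functions with a prime are the
  derivatives in the direction \<open>v\<close>.\<close>

definition side :: "real \<Rightarrow> real^3 \<Rightarrow> real" where "side s x = S (s * x $ 1 / \<mu> (x $ 3))"

definition side' :: "real \<Rightarrow> real^3 \<Rightarrow> real^3 \<Rightarrow> real" where
  "side' s x v = (s * v $ 1 / \<mu> (x $ 3) - s * x $ 1 * (\<mu>' (x $ 3) * v $ 3) / (\<mu> (x $ 3))\<^sup>2) * S' (s * x $ 1 / \<mu> (x $ 3))"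

definition blend :: "real^3 \<Rightarrow> real" where "blend x = S ((x $ 2 / \<mu> (x $ 3) + 1) / 2)"

definition blend' :: "real^3 \<Rightarrow> real^3 \<Rightarrow> real" where
  "blend' x v = ((v $ 2 / \<mu> (x $ 3) - x $ 2 * (\<mu>' (x $ 3) * v $ 3) / (\<mu> (x $ 3))\<^sup>2) / 2) * S' ((x $ 2 / \<mu> (x $ 3) + 1) / 2)"

text \<open>For \<open>|x\<^sub>1| \<ge> \<mu>\<close> this is the potential along the ray pointing to the same side. In the strip
  \<open>|x\<^sub>1| < \<mu>\<close> it is mixed with the potentials along the rays in the directions \<open>\<plusminus>x\<^sub>2\<close>, which in turn
  are blended for \<open>|x\<^sub>2| < \<mu>\<close>. As the horn has radius at least \<open>2 \<mu>\<close>, a point outside of it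
  satisfies \<open>|x\<^sub>1| \<ge> \<mu>\<close> or \<open>|x\<^sub>2| \<ge> \<mu>\<close>, so that every potential with a nonzero weight vanishes
  there.\<close>

definition potential :: "real^3 \<Rightarrow> complex" where
  "potential x = side 1 x *\<^sub>R P 1 1 x + side (-1) x *\<^sub>R P 1 (-1) x
     + (1 - side 1 x - side (-1) x) *\<^sub>R (blend x *\<^sub>R P 2 1 x + (1 - blend x) *\<^sub>R P 2 (-1) x)"

definition dP :: "3 \<Rightarrow> real \<Rightarrow> real^3 \<Rightarrow> real^3 \<Rightarrow> complex" where
  "dP k s x v = frechet_derivative (P k s) (at x) v"

text \<open>The terms are grouped as the product rule for \<open>potential\<close> yields them.\<close>

definition potential' :: "real^3 \<Rightarrow> real^3 \<Rightarrow> complex" where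
  "potential' x v = (side 1 x *\<^sub>R dP 1 1 x v + side' 1 x v *\<^sub>R P 1 1 x)
     + (side (-1) x *\<^sub>R dP 1 (-1) x v + side' (-1) x v *\<^sub>R P 1 (-1) x)
     + ((1 - side 1 x - side (-1) x) *\<^sub>R
          ((blend x *\<^sub>R dP 2 1 x v + blend' x v *\<^sub>R P 2 1 x)
            + ((1 - blend x) *\<^sub>R dP 2 (-1) x v + (- blend' x v) *\<^sub>R P 2 (-1) x))
        + (- side' 1 x v - side' (-1) x v) *\<^sub>R (blend x *\<^sub>R P 2 1 x + (1 - blend x) *\<^sub>R P 2 (-1) x))"

lemma \<mu>_comp_deriv: "x $ 3 > 1 \<Longrightarrow> ((\<lambda>x. \<mu> (x $ 3)) has_derivative (\<lambda>v. \<mu>' (x $ 3) * v $ 3)) (at x)"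
  using DERIV_compose_FDERIV[OF \<mu>_deriv bounded_linear_imp_has_derivative[OF bounded_linear_vec_nth[of 3]]]
  by (simp add: mult.commute)

lemma quotient_deriv:
  assumes "x $ 3 > 1"
  shows "((\<lambda>x. x $ i / \<mu> (x $ 3)) has_derivative
     (\<lambda>v. v $ i / \<mu> (x $ 3) - x $ i * (\<mu>' (x $ 3) * v $ 3) / (\<mu> (x $ 3))\<^sup>2)) (at x)"
proof -
  have "\<mu> (x $ 3) \<noteq> 0" using \<mu>_pos[OF assms] by simp
  from has_derivative_divide'[OF bounded_linear_imp_has_derivative[OF bounded_linear_vec_nth[of i]] \<mu>_comp_deriv[OF assms] this]
  show ?thesis
    by (rule has_derivative_eq_rhs) (use \<open>\<mu> (x $ 3) \<noteq> 0\<close> in \<open>auto simp: divide_simps power2_eq_square\<close>)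
qed

lemma side_deriv:
  assumes "x $ 3 > 1" shows "(side s has_derivative side' s x) (at x)"
proof -
  have "((\<lambda>x. s * (x $ 1 / \<mu> (x $ 3))) has_derivative
     (\<lambda>v. s * (v $ 1 / \<mu> (x $ 3) - x $ 1 * (\<mu>' (x $ 3) * v $ 3) / (\<mu> (x $ 3))\<^sup>2))) (at x)"
    by (intro has_derivative_mult_right quotient_deriv assms)
  from DERIV_compose_FDERIV[OF S_deriv this]
  show ?thesis unfolding side_def [abs_def] side'_def [abs_def]
    by (simp add: right_diff_distrib mult.assoc)
qed

lemma blend_deriv:
  assumes "x $ 3 > 1" shows "(blend has_derivative blend' x) (at x)"
proof -
  have "((\<lambda>x. (x $ 2 / \<mu> (x $ 3) + 1) / 2) has_derivative
     (\<lambda>v. (v $ 2 / \<mu> (x $ 3) - x $ 2 * (\<mu>' (x $ 3) * v $ 3) / (\<mu> (x $ 3))\<^sup>2) / 2)) (at x)"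
    using has_derivative_divide[OF has_derivative_add[OF quotient_deriv[OF assms] has_derivative_const[of 1]] has_derivative_const[of 2]]
    by (rule has_derivative_eq_rhs) simp_all
  from DERIV_compose_FDERIV[OF S_deriv this]
  show ?thesis unfolding blend_def [abs_def] blend'_def [abs_def] by simp
qed

lemma dP_deriv: "(P k s has_derivative dP k s x) (at x)"
  unfolding dP_def [abs_def] by (rule C_k_SucD(1)[OF ray_potential_C1])

lemma potential_deriv:
  assumes x: "x $ 3 > 1" shows "(potential has_derivative potential' x) (at x)"
proof -
  have w: "((\<lambda>x. 1 - side 1 x - side (-1) x) has_derivative (\<lambda>v. - side' 1 x v - side' (-1) x v)) (at x)"
    using has_derivative_diff[OF has_derivative_diff[OF has_derivative_const[of 1] side_deriv[OF x, of 1]] side_deriv[OF x, of "-1"]] by simp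
  have w2: "((\<lambda>x. 1 - blend x) has_derivative (\<lambda>v. - blend' x v)) (at x)"
    using has_derivative_diff[OF has_derivative_const[of 1] blend_deriv[OF x]] by simp
  show ?thesis
    unfolding potential_def [abs_def] potential'_def [abs_def]
    by (intro has_derivative_add has_derivative_scaleR w w2 side_deriv blend_deriv dP_deriv x)
qed

lemma continuous_on_potential': "continuous_on {x. x $ 3 > 1} (\<lambda>x. potential' x v)"
proof -
  let ?U = "{x::real^3. x $ 3 > 1}"
  have c\<mu>: "continuous_on ?U (\<lambda>x. \<mu> (x $ 3))"
    using \<mu>_comp_deriv by (intro continuous_at_imp_continuous_on) (auto intro: has_derivative_continuous)
  have c\<mu>': "continuous_on ?U (\<lambda>x. \<mu>' (x $ 3))"
    by (intro continuous_on_compose2[OF \<mu>'_cont] continuous_intros) auto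
  have nz: "\<mu> (x $ 3) \<noteq> 0" if "x \<in> ?U" for x using \<mu>_pos[of "x $ 3"] that by simp
  have cS: "continuous_on ?U (side s)" "continuous_on ?U blend" for s
    using side_deriv blend_deriv by (intro continuous_at_imp_continuous_on; auto intro: has_derivative_continuous)+
  have cS': "continuous_on ?U (\<lambda>x. side' s x v)" for s
    unfolding side'_def by (intro continuous_intros c\<mu> c\<mu>' continuous_on_compose2[OF S'_cont]) (use nz in auto)
  have cB': "continuous_on ?U (\<lambda>x. blend' x v)"
    unfolding blend'_def by (intro continuous_intros c\<mu> c\<mu>' continuous_on_compose2[OF S'_cont]) (use nz in auto)
  have cP: "continuous_on ?U (P k s)" for k s
    by (rule continuous_on_subset[OF C_k_continuous[OF ray_potential_C1]]) simp
  have cdP: "continuous_on ?U (\<lambda>x. dP k s x v)" for k s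
    unfolding dP_def by (rule continuous_on_subset[of UNIV]) (use C_k_SucD(2)[OF ray_potential_C1] in auto)
  show ?thesis unfolding potential'_def
    by (intro continuous_intros cS cS' cB' cP cdP)
qed

lemma side_sum: "0 \<le> 1 - side 1 x - side (-1) x" "1 - side 1 x - side (-1) x \<le> 1"
  using S_range S_0 unfolding side_def
  by (smt (verit) divide_minus_left minus_mult_minus mult_minus_left mult_1)+

text \<open>Each of the four potentials has weight zero wherever it need not vanish.\<close>

lemma potential_outside:
  assumes x: "1 < x $ 3" "\<rho> (x $ 3) \<le> axis_dist x"
  shows "potential x = 0"
proof -
  have m: "\<mu> (x $ 3) > 0" using \<mu>_pos x by auto
  have a: "side s x *\<^sub>R P 1 s x = 0" if "\<bar>s\<bar> = 1" for s
  proof (cases "0 \<le> s * x $ 1")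
    case True
    then show ?thesis using ray_potential_outside[OF x, of 1 s] by simp
  next
    case False
    then have "s * x $ 1 / \<mu> (x $ 3) \<le> 0" using m by (simp add: divide_le_0_iff)
    then show ?thesis by (simp add: side_def S_0)
  qed
  have a1: "side 1 x *\<^sub>R P 1 1 x = 0" and a2: "side (-1) x *\<^sub>R P 1 (-1) x = 0"
    by (rule a, simp)+
  have W: "(1 - side 1 x - side (-1) x) *\<^sub>R (blend x *\<^sub>R P 2 1 x + (1 - blend x) *\<^sub>R P 2 (-1) x) = 0"
  proof (cases "\<mu> (x $ 3) \<le> \<bar>x $ 1\<bar>")
    case True
    then have "1 - side 1 x - side (-1) x = 0"
      using m S_1[of "x $ 1 / \<mu> (x $ 3)"] S_0[of "x $ 1 / \<mu> (x $ 3)"] S_1[of "- x $ 1 / \<mu> (x $ 3)"] S_0[of "- x $ 1 / \<mu> (x $ 3)"]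
      by (cases "x $ 1 \<ge> 0") (auto simp: side_def divide_simps abs_if)
    then show ?thesis by simp
  next
    case False
    have "(2 * \<mu> (x $ 3))\<^sup>2 \<le> (axis_dist x)\<^sup>2"
      using \<mu>_le[of "x $ 3"] x m by (intro power_mono) auto
    then have "4 * (\<mu> (x $ 3))\<^sup>2 \<le> (x $ 1)\<^sup>2 + (x $ 2)\<^sup>2" by (simp add: axis_dist_def power_mult_distrib)
    moreover have "(x $ 1)\<^sup>2 \<le> (\<mu> (x $ 3))\<^sup>2" using False by (intro abs_le_square_iff[THEN iffD1]) auto
    moreover have "(\<mu> (x $ 3))\<^sup>2 > 0" using m by simp
    ultimately have "(\<mu> (x $ 3))\<^sup>2 \<le> (x $ 2)\<^sup>2" by linarith
    then have "\<mu> (x $ 3) \<le> \<bar>x $ 2\<bar>" using m abs_le_square_iff[of "\<mu> (x $ 3)" "x $ 2"] by simp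
    then show ?thesis
      using m ray_potential_outside[OF x, of 2 1] ray_potential_outside[OF x, of 2 "-1"]
        S_1[of "(x $ 2 / \<mu> (x $ 3) + 1) / 2"] S_0[of "(x $ 2 / \<mu> (x $ 3) + 1) / 2"]
      by (cases "x $ 2 \<ge> 0") (auto simp: blend_def divide_simps)
  qed
  show ?thesis unfolding potential_def a1 a2 W by simp
qed

lemma potential_top: "x $ 3 \<ge> M \<Longrightarrow> potential x = 0"
  by (simp add: potential_def ray_potential_top)

text \<open>The derivative of \<open>\<mu>\<close> contributes at most as much as that of \<open>x\<^sub>1\<close>, because \<open>\<bar>x\<^sub>1\<bar> \<le> \<mu>\<close>
  wherever the cutoff function varies.\<close>

lemma side'_le:
  assumes x: "1 < x $ 3" and s: "\<bar>s\<bar> = 1" and v: "norm v \<le> 1"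
  shows "\<bar>side' s x v\<bar> \<le> 2 * C0 / \<mu> (x $ 3)" and "side' s x v \<noteq> 0 \<Longrightarrow> 0 \<le> s * x $ 1"
proof -
  let ?m = "\<mu> (x $ 3)"
  have m: "?m > 0" using \<mu>_pos x by auto
  have v': "\<bar>v $ i\<bar> \<le> 1" for i using component_le_norm_cart[of v i] v by linarith
  have reg: "0 \<le> s * x $ 1 \<and> s * x $ 1 \<le> ?m" if "side' s x v \<noteq> 0"
  proof -
    have "S' (s * x $ 1 / ?m) \<noteq> 0" using that by (auto simp: side'_def)
    then have "\<not> (s * x $ 1 / ?m < 0 \<or> s * x $ 1 / ?m > 1)" using S'_0 by blast
    then show ?thesis using m by (auto simp: divide_simps not_less)
  qed
  then show "side' s x v \<noteq> 0 \<Longrightarrow> 0 \<le> s * x $ 1" by blast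
  show "\<bar>side' s x v\<bar> \<le> 2 * C0 / ?m"
  proof (cases "side' s x v = 0")
    case True then show ?thesis using C0_nonneg m by simp
  next
    case False
    note r = reg[OF False]
    have "\<bar>s * v $ 1 / ?m\<bar> \<le> 1 / ?m" using s v'[of 1] m by (simp add: abs_mult divide_right_mono)
    moreover have "\<bar>s * x $ 1 * (\<mu>' (x $ 3) * v $ 3) / ?m\<^sup>2\<bar> \<le> 1 / ?m"
    proof -
      have "\<bar>s * x $ 1\<bar> * (\<bar>\<mu>' (x $ 3)\<bar> * \<bar>v $ 3\<bar>) \<le> ?m * (1 * 1)"
        using r v' \<mu>'_le x m by (intro mult_mono) auto
      then show ?thesis using m by (simp add: abs_mult divide_simps power2_eq_square)
    qed
    ultimately have "\<bar>s * v $ 1 / ?m - s * x $ 1 * (\<mu>' (x $ 3) * v $ 3) / ?m\<^sup>2\<bar> \<le> 1 / ?m + 1 / ?m"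
      by (intro order_trans[OF abs_triangle_ineq4 add_mono])
    then have "\<bar>s * v $ 1 / ?m - s * x $ 1 * (\<mu>' (x $ 3) * v $ 3) / ?m\<^sup>2\<bar> \<le> 2 / ?m" by simp
    then have "\<bar>side' s x v\<bar> \<le> 2 / ?m * C0"
      unfolding side'_def abs_mult[of _ "S' _"] using S'_le m by (intro mult_mono) auto
    then show ?thesis by simp
  qed
qed

lemma blend'_le:
  assumes x: "1 < x $ 3" and v: "norm v \<le> 1"
  shows "\<bar>blend' x v\<bar> \<le> 2 * C0 / \<mu> (x $ 3)" and "blend' x v \<noteq> 0 \<Longrightarrow> \<bar>x $ 2\<bar> \<le> \<mu> (x $ 3)"
proof -
  let ?m = "\<mu> (x $ 3)"
  have m: "?m > 0" using \<mu>_pos x by auto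
  have v': "\<bar>v $ i\<bar> \<le> 1" for i using component_le_norm_cart[of v i] v by linarith
  have reg: "\<bar>x $ 2\<bar> \<le> ?m" if "blend' x v \<noteq> 0"
  proof -
    have "S' ((x $ 2 / ?m + 1) / 2) \<noteq> 0" using that by (auto simp: blend'_def)
    then have "\<not> ((x $ 2 / ?m + 1) / 2 < 0 \<or> (x $ 2 / ?m + 1) / 2 > 1)" using S'_0 by blast
    then have "- 1 \<le> x $ 2 / ?m" "x $ 2 / ?m \<le> 1" by auto
    then show ?thesis using m by (auto simp: pos_le_divide_eq pos_divide_le_eq)
  qed
  then show "blend' x v \<noteq> 0 \<Longrightarrow> \<bar>x $ 2\<bar> \<le> ?m" by blast
  show "\<bar>blend' x v\<bar> \<le> 2 * C0 / ?m"
  proof (cases "blend' x v = 0")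
    case True then show ?thesis using C0_nonneg m by simp
  next
    case False
    note r = reg[OF False]
    have "\<bar>v $ 2 / ?m\<bar> \<le> 1 / ?m" using v'[of 2] m by (simp add: divide_right_mono)
    moreover have "\<bar>x $ 2 * (\<mu>' (x $ 3) * v $ 3) / ?m\<^sup>2\<bar> \<le> 1 / ?m"
    proof -
      have "\<bar>x $ 2\<bar> * (\<bar>\<mu>' (x $ 3)\<bar> * \<bar>v $ 3\<bar>) \<le> ?m * (1 * 1)"
        using r v' \<mu>'_le x m by (intro mult_mono) auto
      then show ?thesis using m by (simp add: abs_mult divide_simps power2_eq_square)
    qed
    ultimately have "\<bar>v $ 2 / ?m - x $ 2 * (\<mu>' (x $ 3) * v $ 3) / ?m\<^sup>2\<bar> \<le> 1 / ?m + 1 / ?m"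
      by (intro order_trans[OF abs_triangle_ineq4 add_mono])
    moreover have "\<bar>(v $ 2 / ?m - x $ 2 * (\<mu>' (x $ 3) * v $ 3) / ?m\<^sup>2) / 2\<bar>
        \<le> \<bar>v $ 2 / ?m - x $ 2 * (\<mu>' (x $ 3) * v $ 3) / ?m\<^sup>2\<bar>"
      unfolding abs_divide by simp
    ultimately have "\<bar>(v $ 2 / ?m - x $ 2 * (\<mu>' (x $ 3) * v $ 3) / ?m\<^sup>2) / 2\<bar> \<le> 1 / ?m + 1 / ?m" by (rule order_trans[rotated])
    then have "\<bar>(v $ 2 / ?m - x $ 2 * (\<mu>' (x $ 3) * v $ 3) / ?m\<^sup>2) / 2\<bar> \<le> 2 / ?m" by simp
    then have "\<bar>blend' x v\<bar> \<le> 2 / ?m * C0"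
      unfolding blend'_def abs_mult[of _ "S' _"] using S'_le m by (intro mult_mono) auto
    then show ?thesis by simp
  qed
qed

text \<open>The weights sum to 1, so their derivatives can be grouped to multiply only differences of two
  potentials. In each such term the factors that do not vanish place \<open>x\<close> where the quadrant between
  the two rays is short. The difference of the potentials in the directions \<open>x\<^sub>2\<close> and \<open>-x\<^sub>2\<close>, which
  span no such quadrant, is expressed through a third one.\<close>

lemma potential_error_le:
  assumes x: "1 < x $ 3" "axis_dist x \<le> \<rho> (x $ 3)" "\<rho> (x $ 3) \<le> R" and v: "norm v \<le> 1"
  defines "E1 \<equiv> \<lambda>k s. 12 * sqrt (2 * R * ray_integral (ray_dir k s) (2 * R) (\<lambda>y. (J y)\<^sup>2) x)"
    and "E2 \<equiv> \<lambda>s s'. 288 * C0 * sqrt (ray_integral (ray_dir 2 s') (2 * R) (ray_integral (ray_dir 1 s) (2 * R) (\<lambda>y. (J y)\<^sup>2)) x)"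
  shows "norm (rdot v (f x) - potential' x v) \<le>
     (E1 1 1 + E1 1 (-1) + E1 2 1 + E1 2 (-1)) + (E2 1 1 + E2 1 (-1) + E2 (-1) 1 + E2 (-1) (-1))"
proof -
  let ?m = "\<mu> (x $ 3)"
  have m: "?m > 0" using \<mu>_pos x by auto
  have R3: "3 * ?m \<le> 2 * R" using \<mu>_le[of "x $ 3"] x m by linarith
  define I where "I k s = integral {0..M} (\<lambda>t. curl_pairing f v (ray_dir k s) (x + t *\<^sub>R ray_dir k s))" for k s
  have dP: "dP k s x v = rdot v (f x) - I k s" if "k = 1 \<or> k = 2" for k s
  proof -
    have "dP k s x = (\<lambda>v. rdot v (f x) - integral {0..M} (\<lambda>t. curl_pairing f v (ray_dir k s) (x + t *\<^sub>R ray_dir k s)))"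
      using that x by (intro has_derivative_unique[OF dP_deriv ray_potential_derivative]) auto
    then show ?thesis by (simp add: I_def)
  qed
  have eq: "rdot v (f x) - potential' x v =
      side 1 x *\<^sub>R I 1 1 + side (-1) x *\<^sub>R I 1 (-1)
    + (1 - side 1 x - side (-1) x) *\<^sub>R (blend x *\<^sub>R I 2 1) + (1 - side 1 x - side (-1) x) *\<^sub>R ((1 - blend x) *\<^sub>R I 2 (-1))
    - (side' 1 x v *\<^sub>R blend x *\<^sub>R (P 1 1 x - P 2 1 x) + side' 1 x v *\<^sub>R (1 - blend x) *\<^sub>R (P 1 1 x - P 2 (-1) x)
     + side' (-1) x v *\<^sub>R blend x *\<^sub>R (P 1 (-1) x - P 2 1 x) + side' (-1) x v *\<^sub>R (1 - blend x) *\<^sub>R (P 1 (-1) x - P 2 (-1) x)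
     + (blend' x v *\<^sub>R (1 - side 1 x - side (-1) x) *\<^sub>R (P 1 1 x - P 2 (-1) x) - blend' x v *\<^sub>R (1 - side 1 x - side (-1) x) *\<^sub>R (P 1 1 x - P 2 1 x)))"
    unfolding potential'_def by (simp add: dP scaleR_conv_of_real algebra_simps)
  have I_le: "norm (I k s) \<le> E1 k s" if "k = 1 \<or> k = 2" "\<bar>s\<bar> = 1" for k s
  proof -
    have "norm (I k s) \<le> norm v * E1 k s"
      using ray_error_le[OF x that, of v] by (simp add: I_def E1_def)
    also have "\<dots> \<le> 1 * E1 k s"
      using x axis_dist_nonneg[of x] v by (intro mult_right_mono) (auto simp: E1_def intro!: mult_nonneg_nonneg ray_integral_nonneg continuous_intros cont_J)
    finally show ?thesis by simp
  qed
  have b: "0 \<le> blend x" "blend x \<le> 1" "0 \<le> side s x" "side s x \<le> 1" for s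
    using S_range by (auto simp: blend_def side_def)
  have wI: "norm (c *\<^sub>R z) \<le> norm z" if "0 \<le> c" "c \<le> 1" for c and z :: complex
    using that by (simp add: mult_left_le_one_le)
  have D_le: "norm (c *\<^sub>R d *\<^sub>R (P 1 s x - P 2 s' x)) \<le> E2 s s' / 2"
    if c: "\<bar>c\<bar> \<le> 2 * C0 / ?m" and d: "0 \<le> d" "d \<le> 1" and s: "\<bar>s\<bar> = 1" "\<bar>s'\<bar> = 1"
      and reg: "c \<noteq> 0 \<Longrightarrow> d \<noteq> 0 \<Longrightarrow> - ?m \<le> s * x $ 1 \<and> - ?m \<le> s' * x $ 2" for c d s s'
  proof (cases "c = 0 \<or> d = 0")
    case True
    have "0 \<le> E2 s s'" unfolding E2_def
      by (intro mult_nonneg_nonneg real_sqrt_ge_zero ray_integral_nonneg continuous_on_ray_integral continuous_intros cont_J) (use C0_nonneg in auto)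
    then show ?thesis using True by auto
  next
    case False
    then have reg': "- ?m \<le> s * x $ 1" "- ?m \<le> s' * x $ 2" using reg by auto
    have "norm (c *\<^sub>R d *\<^sub>R (P 1 s x - P 2 s' x)) \<le> \<bar>c\<bar> * norm (P 1 s x - P 2 s' x)"
      unfolding norm_scaleR[of c] by (intro mult_left_mono wI d) auto
    also have "\<dots> \<le> (2 * C0 / ?m) * (72 * ?m * sqrt (ray_integral (ray_dir 2 s') (2 * R) (ray_integral (ray_dir 1 s) (2 * R) (\<lambda>y. (J y)\<^sup>2)) x))"
      using c C0_nonneg m by (intro mult_mono ray_potential_diff_le[OF x(1) R3 s reg']) auto
    also have "\<dots> = E2 s s' / 2" using m by (simp add: E2_def)
    finally show ?thesis .
  qed
  have regb: "blend x \<noteq> 0 \<Longrightarrow> - ?m \<le> x $ 2" "1 - blend x \<noteq> 0 \<Longrightarrow> x $ 2 \<le> ?m"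
  proof -
    show "- ?m \<le> x $ 2" if "blend x \<noteq> 0"
    proof (rule ccontr)
      assume "\<not> ?thesis"
      then have "x $ 2 / ?m \<le> -1" using m by (simp add: divide_simps)
      then show False using that S_0[of "(x $ 2 / ?m + 1) / 2"] by (simp add: blend_def)
    qed
    show "x $ 2 \<le> ?m" if "1 - blend x \<noteq> 0"
    proof (rule ccontr)
      assume "\<not> ?thesis"
      then have "x $ 2 / ?m \<ge> 1" using m by (simp add: divide_simps)
      then show False using that S_1[of "(x $ 2 / ?m + 1) / 2"] by (simp add: blend_def)
    qed
  qed
  have regs: "- ?m \<le> x $ 1" if "1 - side 1 x - side (-1) x \<noteq> 0"
  proof (rule ccontr)
    assume "\<not> ?thesis"
    then have "- x $ 1 / ?m \<ge> 1" "x $ 1 / ?m \<le> 0" using m by (simp_all add: divide_simps)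
    then show False using that S_1[of "- x $ 1 / ?m"] S_0[of "x $ 1 / ?m"] by (simp add: side_def)
  qed
  note sd = side'_le[OF x(1) _ v] and bl = blend'_le[OF x(1) v]
  have T1: "norm (side 1 x *\<^sub>R I 1 1) \<le> E1 1 1" "norm (side (-1) x *\<^sub>R I 1 (-1)) \<le> E1 1 (-1)"
    "norm ((1 - side 1 x - side (-1) x) *\<^sub>R (blend x *\<^sub>R I 2 1)) \<le> E1 2 1"
    "norm ((1 - side 1 x - side (-1) x) *\<^sub>R ((1 - blend x) *\<^sub>R I 2 (-1))) \<le> E1 2 (-1)"
    by (rule order_trans[OF wI[OF b(3,4)] I_le], simp, simp)+
       (rule order_trans[OF wI[OF side_sum] order_trans[OF wI I_le]]; use b in simp)+
  have T2: "norm (side' 1 x v *\<^sub>R blend x *\<^sub>R (P 1 1 x - P 2 1 x)) \<le> E2 1 1 / 2"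
    "norm (side' 1 x v *\<^sub>R (1 - blend x) *\<^sub>R (P 1 1 x - P 2 (-1) x)) \<le> E2 1 (-1) / 2"
    "norm (side' (-1) x v *\<^sub>R blend x *\<^sub>R (P 1 (-1) x - P 2 1 x)) \<le> E2 (-1) 1 / 2"
    "norm (side' (-1) x v *\<^sub>R (1 - blend x) *\<^sub>R (P 1 (-1) x - P 2 (-1) x)) \<le> E2 (-1) (-1) / 2"
    "norm (blend' x v *\<^sub>R (1 - side 1 x - side (-1) x) *\<^sub>R (P 1 1 x - P 2 (-1) x)) \<le> E2 1 (-1) / 2"
    "norm (blend' x v *\<^sub>R (1 - side 1 x - side (-1) x) *\<^sub>R (P 1 1 x - P 2 1 x)) \<le> E2 1 1 / 2"
    using sd(1)[of 1] sd(1)[of "-1"] sd(2)[of 1] sd(2)[of "-1"] bl regb regs b side_sum[of x] m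
    by (intro D_le; force)+
  have tri: "norm (a1 + a2 + a3 + a4 - (b1 + b2 + b3 + b4 + (b5 - b6))) \<le>
      norm a1 + norm a2 + norm a3 + norm a4 + (norm b1 + norm b2 + norm b3 + norm b4 + (norm b5 + norm b6))"
    for a1 a2 a3 a4 b1 b2 b3 b4 b5 b6 :: complex
    by (intro order_trans[OF norm_triangle_ineq4] add_mono order_trans[OF norm_triangle_ineq] order_refl)
  have nn: "0 \<le> E2 s s'" for s s' unfolding E2_def
    by (intro mult_nonneg_nonneg real_sqrt_ge_zero ray_integral_nonneg continuous_on_ray_integral continuous_intros cont_J) (use C0_nonneg in auto)
  show ?thesis
    unfolding eq by (rule order_trans[OF tri]) (use T1 T2 nn[of "-1" 1] nn[of "-1" "-1"] in linarith)
qed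

text \<open>The factor 24 is \<open>3 \<cdot> 2 \<cdot> 4\<close>: three components, each bounded by two groups of four terms.\<close>

lemma potential_gradient_error:
  assumes x: "1 < x $ 3" and R: "\<rho> (x $ 3) \<le> R"
  shows "(norm (f x - grad potential x))\<^sup>2 \<le>
    24 * (288 * R * single_rays R (\<lambda>y. (J y)\<^sup>2) x + (288 * C0)\<^sup>2 * double_rays R (\<lambda>y. (J y)\<^sup>2) x)"
proof -
  let ?g = "\<lambda>y. (J y)\<^sup>2"
  have cg: "continuous_on UNIV ?g" by (intro continuous_intros cont_J)
  have n1: "0 \<le> ray_integral e c ?g x" for e c by (intro ray_integral_nonneg cg) auto
  have n2: "0 \<le> ray_integral e' c (ray_integral e c ?g) x" for e e' c
    by (intro ray_integral_nonneg continuous_on_ray_integral cg) auto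
  have "R > 0" using \<mu>_pos[OF x] \<mu>_le[OF x] R by linarith
  have rhs: "0 \<le> 24 * (288 * R * single_rays R ?g x + (288 * C0)\<^sup>2 * double_rays R ?g x)"
    using \<open>R > 0\<close> n1 n2 unfolding single_rays_def double_rays_def
    by (intro mult_nonneg_nonneg add_nonneg_nonneg) auto
  show ?thesis
  proof (cases "axis_dist x \<le> \<rho> (x $ 3)")
    case True
    define E1 where "E1 k s = 12 * sqrt (2 * R * ray_integral (ray_dir k s) (2 * R) ?g x)" for k s
    define E2 where "E2 s s' = 288 * C0 * sqrt (ray_integral (ray_dir 2 s') (2 * R) (ray_integral (ray_dir 1 s) (2 * R) ?g) x)" for s s'
    define B1 where "B1 = E1 1 1 + E1 1 (-1) + E1 2 1 + E1 2 (-1)"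
    define B2 where "B2 = E2 1 1 + E2 1 (-1) + E2 (-1) 1 + E2 (-1) (-1)"
    have comp: "(norm ((f x - grad potential x) $ i))\<^sup>2 \<le> (B1 + B2)\<^sup>2" for i
    proof -
      have "partial_deriv i potential x = potential' x (axis i 1)"
        unfolding partial_deriv_def using frechet_derivative_at[OF potential_deriv[OF x]] by simp
      then have "(f x - grad potential x) $ i = rdot (axis i 1) (f x) - potential' x (axis i 1)"
        by (simp add: grad_def rdot_axis)
      moreover have "norm (axis i 1 :: real^3) \<le> 1" by simp
      ultimately have "norm ((f x - grad potential x) $ i) \<le> B1 + B2"
        using potential_error_le[OF x True R] unfolding B1_def B2_def E1_def E2_def by simp
      then show ?thesis by (intro power_mono) auto
    qed
    have "(norm (f x - grad potential x))\<^sup>2 = (\<Sum>i\<in>UNIV. (norm ((f x - grad potential x) $ i))\<^sup>2)"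
      by (simp add: norm_vec_def L2_set_def sum_nonneg)
    also have "\<dots> \<le> (\<Sum>i\<in>(UNIV::3 set). (B1 + B2)\<^sup>2)" by (intro sum_mono comp)
    also have "\<dots> = 3 * (B1 + B2)\<^sup>2" by simp
    also have "\<dots> \<le> 3 * (2 * B1\<^sup>2 + 2 * B2\<^sup>2)"
      using sum_squares_bound[of B1 B2] by (simp add: power2_sum)
    also have "\<dots> \<le> 24 * ((E1 1 1)\<^sup>2 + (E1 1 (-1))\<^sup>2 + (E1 2 1)\<^sup>2 + (E1 2 (-1))\<^sup>2
        + ((E2 1 1)\<^sup>2 + (E2 1 (-1))\<^sup>2 + (E2 (-1) 1)\<^sup>2 + (E2 (-1) (-1))\<^sup>2))"
    proof -
      have "B1\<^sup>2 \<le> 4 * ((E1 1 1)\<^sup>2 + (E1 1 (-1))\<^sup>2 + (E1 2 1)\<^sup>2 + (E1 2 (-1))\<^sup>2)"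
        unfolding B1_def by (rule square_sum4_le)
      moreover have "B2\<^sup>2 \<le> 4 * ((E2 1 1)\<^sup>2 + (E2 1 (-1))\<^sup>2 + (E2 (-1) 1)\<^sup>2 + (E2 (-1) (-1))\<^sup>2)"
        unfolding B2_def by (rule square_sum4_le)
      moreover have "3 * (2 * b1 + 2 * b2) \<le> 24 * (q1 + q2)" if "b1 \<le> 4 * q1" "b2 \<le> 4 * q2" for b1 b2 q1 q2 :: real
        using that unfolding distrib_left by linarith
      ultimately show ?thesis by blast
    qed
    also have "\<dots> = 24 * (288 * R * single_rays R ?g x + (288 * C0)\<^sup>2 * double_rays R ?g x)"
      using n1 n2 \<open>R > 0\<close> unfolding E1_def E2_def single_rays_def double_rays_def
      by (simp add: power_mult_distrib algebra_simps)
    finally show ?thesis .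
  next
    case False
    let ?U = "{x. 1 < x $ 3 \<and> \<rho> (x $ 3) < axis_dist x}"
    have "partial_deriv i potential x = 0" for i
      unfolding partial_deriv_def
      by (rule frechet_derivative_outside_support[of "- ?U"])
         (use potential_outside False x open_outside in \<open>auto simp: closed_def\<close>)
    then have "grad potential x = 0" by (simp add: grad_def vec_eq_iff)
    moreover have "f x = 0" using False x by (intro outside) auto
    ultimately show ?thesis using rhs by simp
  qed
qed

lemma potential_square_le:
  assumes x: "1 < x $ 3" and R: "\<rho> (x $ 3) \<le> R"
  shows "(norm (potential x))\<^sup>2 \<le> 32 * R * single_rays R (\<lambda>y. (norm (f y))\<^sup>2) x"
proof -
  let ?g = "\<lambda>y. (norm (f y))\<^sup>2"
  have cg: "continuous_on UNIV ?g" by (intro continuous_intros cont_f)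
  have n1: "0 \<le> ray_integral e c ?g x" for e c by (intro ray_integral_nonneg cg) auto
  have "R > 0" using \<mu>_pos[OF x] \<mu>_le[OF x] R by linarith
  show ?thesis
  proof (cases "axis_dist x \<le> \<rho> (x $ 3)")
    case True
    define E where "E k s = 2 * sqrt (2 * R * ray_integral (ray_dir k s) (2 * R) ?g x)" for k s
    have PE: "norm (P k s x) \<le> E k s" if "k = 1 \<or> k = 2" "\<bar>s\<bar> = 1" for k s
      unfolding E_def by (rule ray_potential_le[OF x True R that])
    have b: "0 \<le> blend x" "blend x \<le> 1" "0 \<le> side s x" "side s x \<le> 1" for s
      using S_range by (auto simp: blend_def side_def)
    have wI: "norm (c *\<^sub>R z) \<le> norm z" if "0 \<le> c" "c \<le> 1" for c and z :: complex
      using that by (simp add: mult_left_le_one_le)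
    have "norm (potential x) \<le> norm (P 1 1 x) + norm (P 1 (-1) x) + (norm (P 2 1 x) + norm (P 2 (-1) x))"
      unfolding potential_def
      using b side_sum[of x]
      by (intro order_trans[OF norm_triangle_ineq] add_mono wI order_trans[OF wI]) auto
    also have "\<dots> \<le> E 1 1 + E 1 (-1) + E 2 1 + E 2 (-1)"
      using PE[of 1 1] PE[of 1 "-1"] PE[of 2 1] PE[of 2 "-1"] by simp
    finally have "(norm (potential x))\<^sup>2 \<le> (E 1 1 + E 1 (-1) + E 2 1 + E 2 (-1))\<^sup>2"
      by (intro power_mono) auto
    also have "\<dots> \<le> 4 * ((E 1 1)\<^sup>2 + (E 1 (-1))\<^sup>2 + (E 2 1)\<^sup>2 + (E 2 (-1))\<^sup>2)" by (rule square_sum4_le)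
    also have "\<dots> = 32 * R * single_rays R ?g x"
      using n1 \<open>R > 0\<close> unfolding E_def single_rays_def by (simp add: power_mult_distrib algebra_simps)
    finally show ?thesis .
  next
    case False
    then have "potential x = 0" using x by (intro potential_outside) auto
    then show ?thesis using n1 \<open>R > 0\<close> by (auto simp: single_rays_def intro!: mult_nonneg_nonneg add_nonneg_nonneg)
  qed
qed

end

section \<open>Integration over the part above a given height\<close>

lemma nn_integral_lborel_translate:
  fixes g :: "'a::euclidean_space \<Rightarrow> ennreal"
  assumes "g \<in> borel_measurable borel"
  shows "(\<integral>\<^sup>+x. g (x + c) \<partial>lborel) = (\<integral>\<^sup>+x. g x \<partial>lborel)"
proof -
  have "(\<integral>\<^sup>+x. g x \<partial>lborel) = (\<integral>\<^sup>+x. g x \<partial>distr lborel borel ((+) c))"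
    by (simp add: lborel_distr_plus)
  also have "\<dots> = (\<integral>\<^sup>+x. g (c + x) \<partial>lborel)"
    using assms by (intro nn_integral_distr) auto
  finally show ?thesis by (simp add: add.commute)
qed

text \<open>By Fubini's theorem and translation invariance each parameter of the ray contributes at most
  the integral of \<open>g\<close>; the rays go up, so they stay above the height \<open>z\<close>.\<close>

lemma nn_integral_ray_integral_le:
  fixes g :: "real^3 \<Rightarrow> real"
  assumes g: "continuous_on UNIV g" "\<And>x. g x \<ge> 0" and e: "e $ 3 \<ge> 0" and c: "c \<ge> 0"
  shows "(\<integral>\<^sup>+x. indicator {x. z < x $ 3} x * ennreal (ray_integral e c g x) \<partial>lborel)
    \<le> ennreal c * (\<integral>\<^sup>+x. indicator {x. z < x $ 3} x * ennreal (g x) \<partial>lborel)"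
proof -
  let ?A = "{x::real^3. z < x $ 3}"
  have gm [measurable]: "g \<in> borel_measurable borel" by (rule borel_measurable_continuous_onI[OF g(1)])
  have A [measurable]: "?A \<in> sets borel"
    by (intro borel_open open_Collect_less continuous_intros)
  have ray: "ennreal (ray_integral e c g x) = (\<integral>\<^sup>+t. indicator {0..c} t * ennreal (g (x + t *\<^sub>R e)) \<partial>lborel)" for x
  proof -
    have "((\<lambda>t. g (x + t *\<^sub>R e)) has_integral ray_integral e c g x) {0..c}"
      unfolding ray_integral_def
      by (intro integrable_integral integrable_continuous_real continuous_on_ray g)
    then have "((\<lambda>t. if t \<in> {0..c} then g (x + t *\<^sub>R e) else 0) has_integral ray_integral e c g x) UNIV"
      by (simp only: has_integral_restrict_UNIV)
    moreover have "(\<lambda>t. if t \<in> {0..c} then g (x + t *\<^sub>R e) else 0) \<in> borel_measurable borel" by measurable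
    ultimately have "(\<integral>\<^sup>+t. ennreal (if t \<in> {0..c} then g (x + t *\<^sub>R e) else 0) \<partial>lborel) = ennreal (ray_integral e c g x)"
      using g(2) by (intro nn_integral_has_integral_lborel) auto
    moreover have "ennreal (if t \<in> {0..c} then g (x + t *\<^sub>R e) else 0) = indicator {0..c} t * ennreal (g (x + t *\<^sub>R e))" for t
      by (auto simp: indicator_def)
    ultimately show ?thesis by simp
  qed
  have "(\<integral>\<^sup>+x. indicator ?A x * ennreal (ray_integral e c g x) \<partial>lborel)
      = (\<integral>\<^sup>+x. \<integral>\<^sup>+t. indicator ?A x * (indicator {0..c} t * ennreal (g (x + t *\<^sub>R e))) \<partial>lborel \<partial>lborel)"
    unfolding ray by (intro nn_integral_cong nn_integral_cmult[symmetric]) measurable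
  also have "\<dots> = (\<integral>\<^sup>+t. \<integral>\<^sup>+x. indicator ?A x * (indicator {0..c} t * ennreal (g (x + t *\<^sub>R e))) \<partial>lborel \<partial>lborel)"
    by (rule lborel_pair.Fubini'[symmetric]) measurable
  also have "\<dots> \<le> (\<integral>\<^sup>+t. (\<integral>\<^sup>+x. indicator ?A x * ennreal (g x) \<partial>lborel) * indicator {0..c} t \<partial>lborel)"
  proof (rule nn_integral_mono)
    fix t :: real
    show "(\<integral>\<^sup>+x. indicator ?A x * (indicator {0..c} t * ennreal (g (x + t *\<^sub>R e))) \<partial>lborel)
        \<le> (\<integral>\<^sup>+x. indicator ?A x * ennreal (g x) \<partial>lborel) * indicator {0..c} t"
    proof (cases "t \<in> {0..c}")
      case True
      have "(\<integral>\<^sup>+x. indicator ?A x * ennreal (g (x + t *\<^sub>R e)) \<partial>lborel)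
          \<le> (\<integral>\<^sup>+x. indicator ?A (x + t *\<^sub>R e) * ennreal (g (x + t *\<^sub>R e)) \<partial>lborel)"
      proof (intro nn_integral_mono mult_right_mono)
        fix x
        have "0 \<le> t * e $ 3" using True e by simp
        then show "(indicator ?A x :: ennreal) \<le> indicator ?A (x + t *\<^sub>R e)" by (auto simp: indicator_def)
      qed simp
      also have "\<dots> = (\<integral>\<^sup>+x. indicator ?A x * ennreal (g x) \<partial>lborel)"
        by (rule nn_integral_lborel_translate[where g = "\<lambda>x. indicator ?A x * ennreal (g x)"]) measurable
      finally show ?thesis using True by simp
    qed simp
  qed
  also have "\<dots> = ennreal c * (\<integral>\<^sup>+x. indicator ?A x * ennreal (g x) \<partial>lborel)"
    using c by (subst nn_integral_cmult_indicator) (auto simp: mult.commute)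
  finally show ?thesis .
qed

lemma nn_integral_add4:
  fixes a b c d :: "'a \<Rightarrow> real"
  assumes "a \<in> borel_measurable M" "b \<in> borel_measurable M" "c \<in> borel_measurable M" "d \<in> borel_measurable M"
    and "\<And>x. 0 \<le> a x" "\<And>x. 0 \<le> b x" "\<And>x. 0 \<le> c x" "\<And>x. 0 \<le> d x" and [measurable]: "A \<in> sets M"
  shows "(\<integral>\<^sup>+x. indicator A x * ennreal (a x + b x + c x + d x) \<partial>M)
    = (\<integral>\<^sup>+x. indicator A x * ennreal (a x) \<partial>M) + (\<integral>\<^sup>+x. indicator A x * ennreal (b x) \<partial>M)
    + (\<integral>\<^sup>+x. indicator A x * ennreal (c x) \<partial>M) + (\<integral>\<^sup>+x. indicator A x * ennreal (d x) \<partial>M)"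
proof -
  note [measurable] = assms(1-4)
  have "(\<integral>\<^sup>+x. indicator A x * ennreal (a x + b x + c x + d x) \<partial>M)
    = (\<integral>\<^sup>+x. indicator A x * ennreal (a x) + indicator A x * ennreal (b x) + indicator A x * ennreal (c x) + indicator A x * ennreal (d x) \<partial>M)"
    using assms(5-8) by (intro nn_integral_cong) (simp add: ennreal_plus distrib_left)
  also have "\<dots> = (\<integral>\<^sup>+x. indicator A x * ennreal (a x) \<partial>M) + (\<integral>\<^sup>+x. indicator A x * ennreal (b x) \<partial>M)
    + (\<integral>\<^sup>+x. indicator A x * ennreal (c x) \<partial>M) + (\<integral>\<^sup>+x. indicator A x * ennreal (d x) \<partial>M)"
    by (simp add: nn_integral_add)
  finally show ?thesis .
qed

lemma nn_integral_rays_le: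
  fixes g :: "real^3 \<Rightarrow> real" and R z :: real
  assumes g: "continuous_on UNIV g" "\<And>x. g x \<ge> 0" and R: "R \<ge> 0"
  defines "I \<equiv> \<integral>\<^sup>+x. indicator {x. z < x $ 3} x * ennreal (g x) \<partial>lborel"
  shows "(\<integral>\<^sup>+x. indicator {x. z < x $ 3} x * ennreal (single_rays R g x) \<partial>lborel) \<le> ennreal (8 * R) * I"
    and "(\<integral>\<^sup>+x. indicator {x. z < x $ 3} x * ennreal (double_rays R g x) \<partial>lborel) \<le> ennreal (16 * R\<^sup>2) * I"
proof -
  let ?A = "{x::real^3. z < x $ 3}"
  have A: "?A \<in> sets lborel"
    unfolding sets_lborel by (intro borel_open open_Collect_less continuous_intros)
  have cr: "continuous_on UNIV (ray_integral e c g)" for e c by (rule continuous_on_ray_integral[OF g(1)])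
  have crr: "continuous_on UNIV (ray_integral e' c (ray_integral e c g))" for e e' c by (rule continuous_on_ray_integral[OF cr])
  have nr: "0 \<le> ray_integral e c g x" for e c x by (rule ray_integral_nonneg[OF g(2,1)])
  have nrr: "0 \<le> ray_integral e' c (ray_integral e c g) x" for e e' c x by (rule ray_integral_nonneg[OF nr cr])
  have one: "(\<integral>\<^sup>+x. indicator ?A x * ennreal (ray_integral e (2 * R) g x) \<partial>lborel) \<le> ennreal (2 * R) * I"
    if "e $ 3 = 1" for e
    unfolding I_def using nn_integral_ray_integral_le[OF g, of e "2 * R" z] that R by simp
  have two: "(\<integral>\<^sup>+x. indicator ?A x * ennreal (ray_integral e' (2 * R) (ray_integral e (2 * R) g) x) \<partial>lborel) \<le> ennreal (4 * R\<^sup>2) * I"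
    if "e $ 3 = 1" "e' $ 3 = 1" for e e'
  proof -
    have "(\<integral>\<^sup>+x. indicator ?A x * ennreal (ray_integral e' (2 * R) (ray_integral e (2 * R) g) x) \<partial>lborel)
        \<le> ennreal (2 * R) * (\<integral>\<^sup>+x. indicator ?A x * ennreal (ray_integral e (2 * R) g x) \<partial>lborel)"
      using nn_integral_ray_integral_le[OF cr nr, of e' "2 * R" z] that R by simp
    also have "\<dots> \<le> ennreal (2 * R) * (ennreal (2 * R) * I)"
      by (intro mult_left_mono one that) simp
    also have "\<dots> = ennreal (4 * R\<^sup>2) * I"
      using R by (simp add: mult.assoc[symmetric] ennreal_mult[symmetric] power2_eq_square)
    finally show ?thesis .
  qed
  have q: "ennreal a * I + ennreal a * I + ennreal a * I + ennreal a * I = ennreal (4 * a) * I" if "a \<ge> 0" for a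
    using that by (simp add: distrib_right[symmetric] ennreal_plus[symmetric] del: ennreal_plus)
  show "(\<integral>\<^sup>+x. indicator ?A x * ennreal (single_rays R g x) \<partial>lborel) \<le> ennreal (8 * R) * I"
  proof -
    have "(\<integral>\<^sup>+x. indicator ?A x * ennreal (single_rays R g x) \<partial>lborel)
      \<le> ennreal (2 * R) * I + ennreal (2 * R) * I + ennreal (2 * R) * I + ennreal (2 * R) * I"
      unfolding single_rays_def
      by (subst nn_integral_add4)
         (auto intro!: add_mono one nr A borel_measurable_continuous_onI cr simp: measurable_lborel1)
    then show ?thesis using q[of "2 * R"] R by simp
  qed
  show "(\<integral>\<^sup>+x. indicator ?A x * ennreal (double_rays R g x) \<partial>lborel) \<le> ennreal (16 * R\<^sup>2) * I"
  proof -
    have "(\<integral>\<^sup>+x. indicator ?A x * ennreal (double_rays R g x) \<partial>lborel)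
      \<le> ennreal (4 * R\<^sup>2) * I + ennreal (4 * R\<^sup>2) * I + ennreal (4 * R\<^sup>2) * I + ennreal (4 * R\<^sup>2) * I"
      unfolding double_rays_def
      by (subst nn_integral_add4)
         (auto intro!: add_mono two nrr A borel_measurable_continuous_onI crr simp: measurable_lborel1)
    then show ?thesis using q[of "4 * R\<^sup>2"] by simp
  qed
qed

context horn_field
begin

lemma integral_gradient_error:
  assumes z: "1 < z"
  shows "(\<integral>\<^sup>+x. indicator {x. z < x $ 3} x * ennreal ((norm (f x - grad potential x))\<^sup>2) \<partial>lborel)
    \<le> ennreal (24 * (2304 + 16 * (288 * C0)\<^sup>2) * (\<rho> z)\<^sup>2)
      * (\<integral>\<^sup>+x. indicator {x. z < x $ 3} x * ennreal ((J x)\<^sup>2) \<partial>lborel)"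
proof -
  let ?A = "{x::real^3. z < x $ 3}" and ?g = "\<lambda>y. (J y)\<^sup>2" and ?R = "\<rho> z"
  let ?I = "\<integral>\<^sup>+x. indicator ?A x * ennreal (?g x) \<partial>lborel"
  have cg: "continuous_on UNIV ?g" by (intro continuous_intros cont_J)
  have R: "0 \<le> ?R" using \<mu>_pos[OF z] \<mu>_le[OF z] by linarith
  have A [measurable]: "?A \<in> sets borel" by (intro borel_open open_Collect_less continuous_intros)
  have [measurable]: "single_rays ?R ?g \<in> borel_measurable borel" "double_rays ?R ?g \<in> borel_measurable borel"
    unfolding single_rays_def [abs_def] double_rays_def [abs_def]
    by (intro borel_measurable_continuous_onI continuous_intros continuous_on_ray_integral cg)+
  have n: "0 \<le> single_rays ?R ?g x" "0 \<le> double_rays ?R ?g x" for x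
    unfolding single_rays_def double_rays_def
    by (intro add_nonneg_nonneg ray_integral_nonneg continuous_on_ray_integral cg; simp)+
  have "(\<integral>\<^sup>+x. indicator ?A x * ennreal ((norm (f x - grad potential x))\<^sup>2) \<partial>lborel)
      \<le> (\<integral>\<^sup>+x. ennreal (24 * 288 * ?R) * (indicator ?A x * ennreal (single_rays ?R ?g x))
            + ennreal (24 * (288 * C0)\<^sup>2) * (indicator ?A x * ennreal (double_rays ?R ?g x)) \<partial>lborel)"
  proof (rule nn_integral_mono)
    fix x :: "real^3"
    show "indicator ?A x * ennreal ((norm (f x - grad potential x))\<^sup>2)
      \<le> ennreal (24 * 288 * ?R) * (indicator ?A x * ennreal (single_rays ?R ?g x))
            + ennreal (24 * (288 * C0)\<^sup>2) * (indicator ?A x * ennreal (double_rays ?R ?g x))"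
    proof (cases "x \<in> ?A")
      case True
      then have x: "1 < x $ 3" "\<rho> (x $ 3) \<le> ?R" using z \<rho>_le[of z "x $ 3"] by auto
      have "ennreal ((norm (f x - grad potential x))\<^sup>2)
        \<le> ennreal (24 * 288 * ?R * single_rays ?R ?g x + 24 * (288 * C0)\<^sup>2 * double_rays ?R ?g x)"
        using potential_gradient_error[OF x] by (intro ennreal_leI) (simp add: algebra_simps)
      then show ?thesis using True n R by (simp add: ennreal_plus ennreal_mult)
    qed simp
  qed
  also have "\<dots> = ennreal (24 * 288 * ?R) * (\<integral>\<^sup>+x. indicator ?A x * ennreal (single_rays ?R ?g x) \<partial>lborel)
     + ennreal (24 * (288 * C0)\<^sup>2) * (\<integral>\<^sup>+x. indicator ?A x * ennreal (double_rays ?R ?g x) \<partial>lborel)"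
    by (subst nn_integral_add, measurable, subst nn_integral_cmult, measurable, subst nn_integral_cmult, measurable)
  also have "\<dots> \<le> ennreal (24 * 288 * ?R) * (ennreal (8 * ?R) * ?I) + ennreal (24 * (288 * C0)\<^sup>2) * (ennreal (16 * ?R\<^sup>2) * ?I)"
    by (intro add_mono mult_left_mono nn_integral_rays_le cg R) auto
  also have "\<dots> = ennreal (24 * (2304 + 16 * (288 * C0)\<^sup>2) * ?R\<^sup>2) * ?I"
  proof -
    have C: "ennreal p * (ennreal q * I) + ennreal r * (ennreal s * I) = ennreal (p * q + r * s) * I"
      if "0 \<le> p" "0 \<le> q" "0 \<le> r" "0 \<le> s" for p q r s I
      using that by (simp add: ennreal_plus ennreal_mult distrib_right mult.assoc)
    have E: "24 * 288 * ?R * (8 * ?R) + 24 * (288 * C0)\<^sup>2 * (16 * ?R\<^sup>2) = 24 * (2304 + 16 * (288 * C0)\<^sup>2) * ?R\<^sup>2"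
      by (simp add: power2_eq_square algebra_simps)
    show ?thesis unfolding E[symmetric] by (rule C) (use R in auto)
  qed
  finally show ?thesis .
qed

lemma integral_potential_square:
  assumes z: "1 < z"
  shows "(\<integral>\<^sup>+x. indicator {x. z < x $ 3} x * ennreal ((norm (potential x))\<^sup>2) \<partial>lborel)
    \<le> ennreal ((16 * \<rho> z)\<^sup>2) * (\<integral>\<^sup>+x. indicator {x. z < x $ 3} x * ennreal ((norm (f x))\<^sup>2) \<partial>lborel)"
proof -
  let ?A = "{x::real^3. z < x $ 3}" and ?g = "\<lambda>y. (norm (f y))\<^sup>2" and ?R = "\<rho> z"
  let ?I = "\<integral>\<^sup>+x. indicator ?A x * ennreal (?g x) \<partial>lborel"
  have cg: "continuous_on UNIV ?g" by (intro continuous_intros cont_f)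
  have R: "0 \<le> ?R" using \<mu>_pos[OF z] \<mu>_le[OF z] by linarith
  have A [measurable]: "?A \<in> sets borel" by (intro borel_open open_Collect_less continuous_intros)
  have [measurable]: "single_rays ?R ?g \<in> borel_measurable borel"
    unfolding single_rays_def [abs_def]
    by (intro borel_measurable_continuous_onI continuous_intros continuous_on_ray_integral cg)
  have n: "0 \<le> single_rays ?R ?g x" for x
    unfolding single_rays_def by (intro add_nonneg_nonneg ray_integral_nonneg cg; simp)
  have "(\<integral>\<^sup>+x. indicator ?A x * ennreal ((norm (potential x))\<^sup>2) \<partial>lborel)
      \<le> (\<integral>\<^sup>+x. ennreal (32 * ?R) * (indicator ?A x * ennreal (single_rays ?R ?g x)) \<partial>lborel)"
  proof (rule nn_integral_mono)
    fix x :: "real^3"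
    show "indicator ?A x * ennreal ((norm (potential x))\<^sup>2)
      \<le> ennreal (32 * ?R) * (indicator ?A x * ennreal (single_rays ?R ?g x))"
    proof (cases "x \<in> ?A")
      case True
      then have x: "1 < x $ 3" "\<rho> (x $ 3) \<le> ?R" using z \<rho>_le[of z "x $ 3"] by auto
      have "ennreal ((norm (potential x))\<^sup>2) \<le> ennreal (32 * ?R * single_rays ?R ?g x)"
        using potential_square_le[OF x] by (intro ennreal_leI) simp
      then show ?thesis using True n R by (simp add: ennreal_mult)
    qed simp
  qed
  also have "\<dots> = ennreal (32 * ?R) * (\<integral>\<^sup>+x. indicator ?A x * ennreal (single_rays ?R ?g x) \<partial>lborel)"
    by (rule nn_integral_cmult) measurable
  also have "\<dots> \<le> ennreal (32 * ?R) * (ennreal (8 * ?R) * ?I)"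
    by (intro mult_left_mono nn_integral_rays_le cg R) auto
  also have "\<dots> = ennreal ((16 * ?R)\<^sup>2) * ?I"
  proof -
    have E: "(16 * ?R)\<^sup>2 = 32 * ?R * (8 * ?R)" by (simp add: power2_eq_square)
    have m: "ennreal (32 * ?R * (8 * ?R)) = ennreal (32 * ?R) * ennreal (8 * ?R)"
      by (rule ennreal_mult) (use R in auto)
    show ?thesis unfolding E m by (simp only: mult.assoc)
  qed
  finally show ?thesis .
qed

end

section \<open>The exit scale and the step function\<close>

text \<open>The exit height \<open>g z\<close> is the root of \<open>h \<zeta> = z\<close> for \<open>h \<zeta> = \<zeta> - \<rho> \<zeta>\<close>, and \<open>\<mu> z\<close> is half of \<open>g z
  - z\<close>. As \<open>\<rho>\<close> decreases, \<open>h' \<ge> 1\<close>, so the slope of the inverse function \<open>g\<close> lies between 0 and 1,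
  no matter how steep \<open>\<rho>\<close> is.\<close>

lemma exit_scale_exists:
  fixes \<rho> \<rho>' :: "real \<Rightarrow> real"
  assumes deriv: "\<And>z. z > 1 \<Longrightarrow> (\<rho> has_real_derivative \<rho>' z) (at z)" and cont': "continuous_on {1<..} \<rho>'"
    and anti: "antimono_on {1<..} \<rho>" and pos: "\<And>z. z > 1 \<Longrightarrow> \<rho> z > 0"
  obtains \<mu> \<mu>' where "\<And>z. z > 1 \<Longrightarrow> \<mu> z > 0" "\<And>z. z > 1 \<Longrightarrow> 2 * \<mu> z \<le> \<rho> z"
    "\<And>z. z > 1 \<Longrightarrow> \<rho> (z + 2 * \<mu> z) \<le> 2 * \<mu> z"
    "\<And>z. z > 1 \<Longrightarrow> (\<mu> has_real_derivative \<mu>' z) (at z)"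
    "\<And>z. z > 1 \<Longrightarrow> \<bar>\<mu>' z\<bar> \<le> 1" "continuous_on {1<..} \<mu>'"
proof -
  have le: "\<rho> b \<le> \<rho> a" if "1 < a" "a \<le> b" for a b
    using anti that by (auto simp: monotone_on_def)
  have \<rho>'_le: "\<rho>' z \<le> 0" if "z > 1" for z
  proof -
    have "mono_on {1<..} (\<lambda>z. - \<rho> z)" using le by (auto simp: mono_on_def)
    moreover have "((\<lambda>z. - \<rho> z) has_real_derivative - \<rho>' z) (at z)" by (intro DERIV_minus deriv that)
    moreover have "z \<in> interior {1<..}" using that by (simp add: interior_open)
    ultimately have "- \<rho>' z \<ge> 0" by (rule mono_on_imp_deriv_nonneg)
    then show ?thesis by simp
  qed
  define h where "h \<zeta> = \<zeta> - \<rho> \<zeta>" for \<zeta>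
  have h_deriv: "(h has_real_derivative 1 - \<rho>' z) (at z)" if "z > 1" for z
    unfolding h_def [abs_def] by (intro DERIV_diff DERIV_ident deriv that)
  have ex: "\<exists>\<zeta>. z < \<zeta> \<and> h \<zeta> = z" if z: "z > 1" for z
  proof -
    have "continuous_on {z..z + \<rho> z} h"
      using z by (intro continuous_at_imp_continuous_on) (auto intro!: DERIV_isCont[OF h_deriv])
    moreover have "h z \<le> z" "z \<le> h (z + \<rho> z)"
      using pos[OF z] le[of z "z + \<rho> z"] z by (auto simp: h_def)
    ultimately obtain \<zeta> where "z \<le> \<zeta>" "\<zeta> \<le> z + \<rho> z" "h \<zeta> = z"
      using IVT'[of h z z "z + \<rho> z"] pos[OF z] by auto
    moreover have "\<zeta> \<noteq> z" using \<open>h \<zeta> = z\<close> pos[OF z] by (auto simp: h_def)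
    ultimately have "z < \<zeta> \<and> h \<zeta> = z" by simp
    then show ?thesis ..
  qed
  then obtain g where g: "\<And>z. z > 1 \<Longrightarrow> z < g z" "\<And>z. z > 1 \<Longrightarrow> h (g z) = z" by metis
  have g1: "g z > 1" if "z > 1" for z using g(1)[OF that] that by simp
  have expand: "\<zeta>' - \<zeta> \<le> h \<zeta>' - h \<zeta>" if "1 < \<zeta>" "\<zeta> \<le> \<zeta>'" for \<zeta> \<zeta>'
    using le[OF that] by (simp add: h_def)
  have lip: "\<bar>g z' - g z\<bar> \<le> \<bar>z' - z\<bar>" if "z > 1" "z' > 1" for z z'
    using expand[of "g z" "g z'"] expand[of "g z'" "g z"] g(2) g1 that by (cases "g z \<le> g z'") auto
  have contg: "isCont g z" if z: "z > 1" for z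
  proof -
    have "((\<lambda>z'. g z' - g z) \<longlongrightarrow> 0) (at z)"
    proof (rule Lim_null_comparison)
      show "eventually (\<lambda>z'. norm (g z' - g z) \<le> \<bar>z' - z\<bar>) (at z)"
      proof -
        have "eventually (\<lambda>z'. z' \<in> {1<..}) (at z)"
          by (rule eventually_at_in_open') (use z in auto)
        then show ?thesis by eventually_elim (use lip[OF z] in auto)
      qed
      have "((\<lambda>z'. \<bar>z' - z\<bar>) \<longlongrightarrow> \<bar>z - z\<bar>) (at z)" by (intro tendsto_intros)
      then show "((\<lambda>z'. \<bar>z' - z\<bar>) \<longlongrightarrow> 0) (at z)" by simp
    qed
    then show ?thesis by (simp add: isCont_def LIM_zero_iff)
  qed
  have g_deriv: "(g has_real_derivative inverse (1 - \<rho>' (g z))) (at z)" if z: "z > 1" for z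
  proof (rule DERIV_inverse_function[where f = h and a = 1 and b = "z + 1"])
    show "(h has_real_derivative 1 - \<rho>' (g z)) (at (g z))" by (rule h_deriv[OF g1[OF z]])
    show "1 - \<rho>' (g z) \<noteq> 0" using \<rho>'_le[OF g1[OF z]] by simp
  qed (use z g(2) contg in auto)
  define \<mu> where "\<mu> z = (g z - z) / 2" for z
  define \<mu>' where "\<mu>' z = (inverse (1 - \<rho>' (g z)) - 1) / 2" for z
  have two\<mu>: "2 * \<mu> z = \<rho> (g z)" if "z > 1" for z
    using g(2)[OF that] by (simp add: \<mu>_def h_def)
  show ?thesis
  proof (rule that)
    fix z :: real assume z: "z > 1"
    show "\<mu> z > 0" using g(1)[OF z] by (simp add: \<mu>_def)
    show "2 * \<mu> z \<le> \<rho> z" unfolding two\<mu>[OF z] using le[OF z] g(1)[OF z] by simp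
    have "z + 2 * \<mu> z = g z" by (simp add: \<mu>_def field_simps)
    then show "\<rho> (z + 2 * \<mu> z) \<le> 2 * \<mu> z" using two\<mu>[OF z] by simp
    show "(\<mu> has_real_derivative \<mu>' z) (at z)"
      unfolding \<mu>_def [abs_def] \<mu>'_def by (intro DERIV_cdivide DERIV_diff DERIV_ident g_deriv z)
    have "1 \<le> 1 - \<rho>' (g z)" using \<rho>'_le[OF g1[OF z]] by simp
    then have "0 \<le> inverse (1 - \<rho>' (g z))" "inverse (1 - \<rho>' (g z)) \<le> 1" by (auto simp: inverse_le_1_iff)
    moreover have "\<bar>(i - 1) / 2\<bar> \<le> 1" if "0 \<le> i" "i \<le> 1" for i :: real
      using that by simp
    ultimately show "\<bar>\<mu>' z\<bar> \<le> 1" unfolding \<mu>'_def by blast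
  next
    have "continuous_on {1<..} g" using contg by (intro continuous_at_imp_continuous_on) auto
    then have "continuous_on {1<..} (\<lambda>z. \<rho>' (g z))"
      by (intro continuous_on_compose2[OF cont']) (use g1 in auto)
    moreover have "1 - \<rho>' (g z) \<noteq> 0" if "z > 1" for z using \<rho>'_le[OF g1[OF that]] by simp
    ultimately show "continuous_on {1<..} \<mu>'"
      unfolding \<mu>'_def [abs_def] by (intro continuous_intros) auto
  qed
qed

lemma smooth_step_exists:
  obtains S S' :: "real \<Rightarrow> real" and C0 :: real
  where "\<And>t. (S has_real_derivative S' t) (at t)" "continuous_on UNIV S'" "\<And>t. \<bar>S' t\<bar> \<le> C0"
    "\<And>t. t \<le> 0 \<Longrightarrow> S t = 0" "\<And>t. t \<ge> 1 \<Longrightarrow> S t = 1" "\<And>t. 0 \<le> S t \<and> S t \<le> 1"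
    "\<And>t. t < 0 \<or> t > 1 \<Longrightarrow> S' t = 0"
proof -
  let ?d = "flat ([:0,0,1:] * (1 - pderiv 1))"
  define S where "S t = smooth_ramp t / (smooth_ramp t + smooth_ramp (1 - t))" for t
  define S' where "S' t = (?d t * (smooth_ramp t + smooth_ramp (1 - t)) - smooth_ramp t * (?d t - ?d (1 - t))) / (smooth_ramp t + smooth_ramp (1 - t))\<^sup>2" for t
  have pos: "smooth_ramp t + smooth_ramp (1 - t) > 0" for t
    using smooth_ramp_facts(1,3)[of t] smooth_ramp_facts(1,3)[of "1 - t"] by (cases "t > 0") (auto intro: add_pos_nonneg add_nonneg_pos)
  have d1: "(smooth_ramp has_real_derivative ?d t) (at t)" for t by (rule flat_has_derivative)
  have d2: "((\<lambda>t. smooth_ramp (1 - t)) has_real_derivative - ?d (1 - t)) (at t)" for t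
  proof -
    have "((\<lambda>t. 1 - t) has_real_derivative - 1) (at t)" by (auto intro!: derivative_eq_intros)
    from DERIV_chain'[OF this d1[of "1 - t"]] show ?thesis by simp
  qed
  have S_deriv: "(S has_real_derivative S' t) (at t)" for t
    unfolding S_def [abs_def] S'_def power2_eq_square
    using DERIV_divide[OF d1 DERIV_add[OF d1 d2], of t] pos[of t] by simp
  have cflat: "continuous_on UNIV (flat q)" for q
    using flat_has_derivative by (blast intro: DERIV_continuous_on has_field_derivative_at_within)
  have cont: "continuous_on UNIV S'"
    unfolding S'_def [abs_def]
    by (intro continuous_intros cflat continuous_on_compose2[OF cflat]) (use pos in \<open>auto simp: less_imp_neq[symmetric]\<close>)
  have S0: "S t = 0" if "t \<le> 0" for t using that by (simp add: S_def smooth_ramp_facts)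
  have S1: "S t = 1" if "t \<ge> 1" for t
  proof -
    have "smooth_ramp (1 - t) = 0" "smooth_ramp t \<noteq> 0"
      using that smooth_ramp_facts(3)[of t] smooth_ramp_facts(4)[of "1 - t"] by auto
    then show ?thesis by (simp add: S_def)
  qed
  have zero: "S' t = 0" if "t < 0 \<or> t > 1" for t
  proof -
    have "(S has_real_derivative 0) (at t)"
    proof (cases "t < 0")
      case True
      have "((\<lambda>_. 0) has_real_derivative 0) (at t)" by simp
      then show ?thesis
        by (rule has_field_derivative_transform_within_open[where S = "{..<0}"]) (use True S0 in auto)
    next
      case False
      have "((\<lambda>_. 1) has_real_derivative 0) (at t)" by simp
      then show ?thesis
        by (rule has_field_derivative_transform_within_open[where S = "{1<..}"]) (use False that S1 in auto)
    qed
    then show ?thesis using DERIV_unique S_deriv by blast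
  qed
  have "\<And>t. t \<notin> cbox 0 1 \<Longrightarrow> S' t = 0" using zero by auto
  then obtain C0 where "\<And>t. norm (S' t) \<le> C0" using bounded_compact_support[OF cont] by metis
  moreover have "0 \<le> S t \<and> S t \<le> 1" for t
    using smooth_ramp_facts(1)[of t] smooth_ramp_facts(1)[of "1 - t"] pos[of t] by (simp add: S_def)
  ultimately show ?thesis using that[OF S_deriv cont _ S0 S1 _ zero] by auto
qed

section \<open>The estimate on the horn\<close>

lemma horn_eq: "horn \<rho> = {x. 1 < x $ 3 \<and> axis_dist x < \<rho> (x $ 3)}"
  by (simp add: horn_def axis_dist_def)

lemma open_horn:
  assumes "continuous_on {1<..} \<rho>" shows "open (horn \<rho>)"
proof -
  have "continuous_on {x::real^3. 1 < x $ 3} (\<lambda>x. \<rho> (x $ 3) - axis_dist x)"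
    by (intro continuous_intros continuous_on_axis_dist continuous_on_compose2[OF assms]) auto
  moreover have "open {x::real^3. 1 < x $ 3}" by (intro open_Collect_less continuous_intros)
  ultimately have "open ({x::real^3. 1 < x $ 3} \<inter> (\<lambda>x. \<rho> (x $ 3) - axis_dist x) -` {0<..})"
    by (intro continuous_open_preimage) auto
  moreover have "{x::real^3. 1 < x $ 3} \<inter> (\<lambda>x. \<rho> (x $ 3) - axis_dist x) -` {0<..} = horn \<rho>"
    by (auto simp: horn_eq)
  ultimately show ?thesis by simp
qed

definition conj_vec :: "complex^3 \<Rightarrow> complex^3" where "conj_vec a = (\<chi> i. cnj (a $ i))"

lemma bounded_linear_conj_vec: "bounded_linear conj_vec"
  unfolding linear_conv_bounded_linear[symmetric]
  by (rule linearI) (simp_all add: conj_vec_def vec_eq_iff scaleR_conv_of_real[where 'a = complex])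

lemma norm_conj_vec [simp]: "norm (conj_vec a) = norm a"
  by (simp add: conj_vec_def norm_vec_def)

lemma cdot_conj_vec: "cdot a (conj_vec a) = of_real ((norm a)\<^sup>2)"
proof -
  have "cdot a (conj_vec a) = (\<Sum>i\<in>UNIV. of_real ((norm (a $ i))\<^sup>2))"
    unfolding cdot_def conj_vec_def vec_lambda_beta complex_norm_square ..
  also have "\<dots> = of_real ((norm a)\<^sup>2)"
    unfolding norm_vec_def L2_set_def by (simp only: real_sqrt_pow2[OF sum_nonneg[OF zero_le_power2]] of_real_sum)
  finally show ?thesis .
qed

lemma curl_conj_vec:
  assumes f: "C_k (Suc 0) f"
  shows "curl (\<lambda>x. conj_vec (f x)) x = conj_vec (curl f x)"
proof -
  have "partial_deriv i (\<lambda>y. conj_vec (f y) $ j) x = cnj (partial_deriv i (\<lambda>y. f y $ j) x)" for i j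
  proof -
    have "((\<lambda>y. conj_vec (f y) $ j) has_derivative (\<lambda>v. cnj (frechet_derivative (\<lambda>y. f y $ j) (at x) v))) (at x)"
      using bounded_linear.has_derivative[OF bounded_linear_cnj C_k_SucD(1)[OF C_k_component[OF f]], of j x]
      by (simp add: conj_vec_def)
    from frechet_derivative_at[OF this] show ?thesis unfolding partial_deriv_def by metis
  qed
  then show ?thesis by (simp add: curl_def conj_vec_def vec_eq_iff forall_3)
qed

lemma L2_conj_vec:
  assumes "u \<in> L2 \<Omega>"
  shows "(\<lambda>x. conj_vec (u x)) \<in> L2 \<Omega>" "L2_norm \<Omega> (\<lambda>x. conj_vec (u x)) = L2_norm \<Omega> u"
proof -
  have "conj_vec \<in> borel_measurable borel"
    by (intro borel_measurable_continuous_onI linear_continuous_on bounded_linear_conj_vec)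
  then show "(\<lambda>x. conj_vec (u x)) \<in> L2 \<Omega>"
    using assms measurable_compose[of u "lebesgue_on \<Omega>" borel conj_vec borel] by (simp add: L2_def)
qed (simp add: L2_norm_def)

lemma L2_norm_le_nn_integral:
  fixes u :: "'a::euclidean_space \<Rightarrow> 'b::real_normed_vector"
  assumes \<Omega>: "open \<Omega>" and u: "u \<in> borel_measurable (lebesgue_on \<Omega>)"
    and F: "F \<in> borel_measurable borel" "\<And>x. ennreal ((norm (u x))\<^sup>2) \<le> F x"
    and B: "(\<integral>\<^sup>+x. F x \<partial>lborel) \<le> ennreal B" "B \<ge> 0"
  shows "u \<in> L2 \<Omega>" "(L2_norm \<Omega> u)\<^sup>2 \<le> B"
proof -
  have \<Omega>': "\<Omega> \<inter> space lebesgue \<in> sets lebesgue" using \<Omega> by simp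
  have "(\<integral>\<^sup>+x. ennreal ((norm (u x))\<^sup>2) \<partial>lebesgue_on \<Omega>) \<le> (\<integral>\<^sup>+x. F x \<partial>lebesgue_on \<Omega>)"
    by (intro nn_integral_mono F)
  also have "\<dots> = (\<integral>\<^sup>+x. F x * indicator \<Omega> x \<partial>lebesgue)"
    by (rule nn_integral_restrict_space[OF \<Omega>'])
  also have "\<dots> \<le> (\<integral>\<^sup>+x. F x \<partial>lebesgue)"
    by (intro nn_integral_mono) (auto simp: indicator_def)
  also have "\<dots> = (\<integral>\<^sup>+x. F x \<partial>lborel)"
    using F(1) by (intro nn_integral_completion) 
  finally have le: "(\<integral>\<^sup>+x. ennreal ((norm (u x))\<^sup>2) \<partial>lebesgue_on \<Omega>) \<le> ennreal B" using B by simp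
  have m: "(\<lambda>x. (norm (u x))\<^sup>2) \<in> borel_measurable (lebesgue_on \<Omega>)" using u by measurable
  have int: "integrable (lebesgue_on \<Omega>) (\<lambda>x. (norm (u x))\<^sup>2)"
    using m le by (intro integrableI_nonneg) (auto intro: order_le_less_trans)
  then show "u \<in> L2 \<Omega>" using u by (simp add: L2_def)
  have "ennreal ((L2_norm \<Omega> u)\<^sup>2) \<le> ennreal B"
    using le nn_integral_eq_integral[OF int] by (simp add: L2_norm_power2)
  then show "(L2_norm \<Omega> u)\<^sup>2 \<le> B" using B by (simp add: ennreal_le_iff)
qed

lemma nn_integral_compact_support:
  fixes u :: "'a::euclidean_space \<Rightarrow> 'b::euclidean_space"
  assumes u: "continuous_on UNIV u" "\<And>x. x \<notin> cbox a b \<Longrightarrow> u x = 0" "\<And>x. x \<notin> \<Omega> \<Longrightarrow> u x = 0" and \<Omega>: "open \<Omega>"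
  shows "(\<integral>\<^sup>+x. ennreal ((norm (u x))\<^sup>2) \<partial>lborel) = ennreal ((L2_norm \<Omega> u)\<^sup>2)"
proof -
  have c: "continuous_on UNIV (\<lambda>x. (norm (u x))\<^sup>2)" by (intro continuous_intros u)
  have z: "\<And>x. x \<notin> cbox a b \<Longrightarrow> (norm (u x))\<^sup>2 = 0" "\<And>x. x \<notin> \<Omega> \<Longrightarrow> (norm (u x))\<^sup>2 = 0" using u by auto
  have "(\<integral>\<^sup>+x. ennreal ((norm (u x))\<^sup>2) \<partial>lborel) = ennreal (\<integral>x. (norm (u x))\<^sup>2 \<partial>lborel)"
    by (intro nn_integral_eq_integral integrable_compact_support[OF c z(1)]) auto
  then show ?thesis
    using compactly_supported_lebesgue_on(3)[OF c z(1) \<Omega> z(2)] by (simp add: L2_norm_power2)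
qed

text \<open>This leaves room between the support of an approximating field and the lateral boundary: the
  potential is constructed in the thinner horn of radius \<open>\<kappa> \<rho>\<close>, which makes its support a compact
  subset of the original one.\<close>

lemma compact_in_horn_margin:
  assumes \<rho>: "continuous_on {1<..} \<rho>" "\<And>z. z > 1 \<Longrightarrow> \<rho> z > 0" and K: "compact K" "K \<subseteq> horn \<rho>"
  obtains \<kappa> where "0 < \<kappa>" "\<kappa> < 1" "\<And>x. x \<in> K \<Longrightarrow> axis_dist x < \<kappa> * \<rho> (x $ 3)"
proof (cases "K = {}")
  case True
  then show ?thesis using that[of "1/2"] by simp
next
  case False
  have K': "1 < x $ 3" "axis_dist x < \<rho> (x $ 3)" if "x \<in> K" for x using K(2) that by (auto simp: horn_eq)
  have pos: "\<rho> (x $ 3) > 0" if "x \<in> K" for x using \<rho>(2) K' that by blast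
  have "continuous_on K (\<lambda>x. axis_dist x / \<rho> (x $ 3))"
    using K' pos by (intro continuous_intros continuous_on_axis_dist continuous_on_compose2[OF \<rho>(1)])
      (auto simp: less_imp_neq[symmetric])
  then obtain x0 where x0: "x0 \<in> K" "\<And>x. x \<in> K \<Longrightarrow> axis_dist x / \<rho> (x $ 3) \<le> axis_dist x0 / \<rho> (x0 $ 3)"
    using continuous_attains_sup[OF K(1) False] by blast
  define m where "m = axis_dist x0 / \<rho> (x0 $ 3)"
  have m: "0 \<le> m" "m < 1" using K'[OF x0(1)] pos[OF x0(1)] axis_dist_nonneg[of x0] by (auto simp: m_def)
  show ?thesis
  proof (rule that[of "(m + 1) / 2"])
    fix x assume x: "x \<in> K"
    have "axis_dist x \<le> m * \<rho> (x $ 3)" using x0(2)[OF x] pos[OF x] unfolding m_def[symmetric] by (simp add: pos_divide_le_eq)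
    also have "\<dots> < (m + 1) / 2 * \<rho> (x $ 3)" using m pos[OF x] by (intro mult_strict_right_mono) auto
    finally show "axis_dist x < (m + 1) / 2 * \<rho> (x $ 3)" .
  qed (use m in auto)
qed

context horn_field
begin

text \<open>The rays go up, so below the field the potential need not vanish; it is cut off between two
  heights. The cutoff is harmless if the field tested against it vanishes below the upper height.\<close>

lemma cutoff_potential:
  assumes Z: "1 < Z'" "Z' < Z"
  obtains \<psi> where "C_k (Suc 0) \<psi>"
    "compact {x. Z' \<le> x $ 3 \<and> x $ 3 \<le> M \<and> axis_dist x \<le> \<rho> (x $ 3)}"
    "\<And>x. x \<notin> {x. Z' \<le> x $ 3 \<and> x $ 3 \<le> M \<and> axis_dist x \<le> \<rho> (x $ 3)} \<Longrightarrow> \<psi> x = 0"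
    "\<And>x. norm (\<psi> x) \<le> indicator {x. Z' < x $ 3} x * norm (potential x)"
    "\<And>x. Z < x $ 3 \<Longrightarrow> grad \<psi> x = grad potential x"
proof -
  define cut where "cut t = S ((t - Z') / (Z - Z'))" for t
  define cut' where "cut' t = S' ((t - Z') / (Z - Z')) / (Z - Z')" for t
  have cut_deriv: "(cut has_real_derivative cut' t) (at t)" for t
  proof -
    have "((\<lambda>t. (t - Z') / (Z - Z')) has_real_derivative 1 / (Z - Z')) (at t)"
      using Z by (auto intro!: derivative_eq_intros)
    from DERIV_chain'[OF this S_deriv] show ?thesis by (simp add: cut_def [abs_def] cut'_def)
  qed
  have cut0: "cut t = 0" if "t \<le> Z'" for t unfolding cut_def using that Z by (intro S_0) (simp add: divide_le_0_iff)
  have cut'0: "cut' t = 0" if "t < Z' \<or> t > Z" for t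
  proof -
    have "(t - Z') / (Z - Z') < 0 \<or> (t - Z') / (Z - Z') > 1" using that Z by (auto simp: divide_simps)
    then show ?thesis unfolding cut'_def using S'_0 by simp
  qed
  have cut1: "cut t = 1" if "t > Z" for t unfolding cut_def using that Z by (intro S_1) (simp add: divide_simps)
  have cutr: "0 \<le> cut t" "cut t \<le> 1" for t using S_range by (auto simp: cut_def)
  have ccut': "continuous_on UNIV cut'"
    unfolding cut'_def [abs_def] by (intro continuous_intros continuous_on_compose2[OF S'_cont]) (use Z in auto)
  define \<psi> where "\<psi> x = (if 1 < x $ 3 then cut (x $ 3) *\<^sub>R potential x else 0)" for x
  define \<psi>' where "\<psi>' x v = (if 1 < x $ 3 then cut (x $ 3) *\<^sub>R potential' x v + (cut' (x $ 3) * v $ 3) *\<^sub>R potential x else 0)" for x v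
  let ?U = "{x::real^3. 1 < x $ 3}" and ?V = "{x::real^3. x $ 3 < Z'}"
  have oU: "open ?U" "open ?V" by (intro open_Collect_less continuous_intros)+
  have \<psi>_deriv: "(\<psi> has_derivative \<psi>' x) (at x)" for x
  proof (cases "1 < x $ 3")
    case True
    have "((\<lambda>x. cut (x $ 3)) has_derivative (\<lambda>v. cut' (x $ 3) * v $ 3)) (at x)"
      using DERIV_compose_FDERIV[OF cut_deriv bounded_linear_imp_has_derivative[OF bounded_linear_vec_nth[of 3]]]
      by (simp add: mult.commute)
    from has_derivative_scaleR[OF this potential_deriv[OF True]]
    have "((\<lambda>x. cut (x $ 3) *\<^sub>R potential x) has_derivative \<psi>' x) (at x)"
      using True by (simp add: \<psi>'_def [abs_def])
    then show ?thesis
      by (rule has_derivative_transform_within_open[OF _ oU(1)]) (use True in \<open>auto simp: \<psi>_def\<close>)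
  next
    case False
    have "((\<lambda>_. 0::complex) has_derivative (\<lambda>_. 0)) (at x)" by simp
    then have "(\<psi> has_derivative (\<lambda>_. 0)) (at x)"
      by (rule has_derivative_transform_within_open[OF _ oU(2)]) (use False Z cut0 in \<open>auto simp: \<psi>_def\<close>)
    then show ?thesis using False by (simp add: \<psi>'_def [abs_def])
  qed
  have cont: "continuous_on UNIV (\<lambda>x. \<psi>' x v)" for v
  proof -
    have "continuous_on ?U potential"
      using potential_deriv by (intro continuous_at_imp_continuous_on) (auto intro: has_derivative_continuous)
    moreover have "continuous_on ?U (\<lambda>x. cut (x $ 3))"
    proof -
      have "continuous_on UNIV cut"
        using cut_deriv by (blast intro: DERIV_continuous_on has_field_derivative_at_within)
      then show ?thesis by (rule continuous_on_compose2) (auto intro!: continuous_intros)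
    qed
    ultimately have "continuous_on ?U (\<lambda>x. cut (x $ 3) *\<^sub>R potential' x v + (cut' (x $ 3) * v $ 3) *\<^sub>R potential x)"
      by (intro continuous_intros continuous_on_potential' continuous_on_compose2[OF ccut']) auto
    then have "continuous_on ?U (\<lambda>x. \<psi>' x v)" by (rule continuous_on_eq) (auto simp: \<psi>'_def)
    moreover have "continuous_on ?V (\<lambda>x. \<psi>' x v)"
      by (rule continuous_on_eq[OF continuous_on_const[of _ 0]]) (auto simp: \<psi>'_def cut0 cut'0)
    ultimately have "continuous_on (?U \<union> ?V) (\<lambda>x. \<psi>' x v)" by (intro continuous_on_open_Un oU)
    moreover have "?U \<union> ?V = UNIV" using Z by auto
    ultimately show ?thesis by simp
  qed
  let ?K = "{x. Z' \<le> x $ 3 \<and> x $ 3 \<le> M \<and> axis_dist x \<le> \<rho> (x $ 3)}"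
  show ?thesis
  proof (rule that[of \<psi>])
    show "C_k (Suc 0) \<psi>" by (rule C_k_SucI[OF \<psi>_deriv]) (use cont in simp)
    show "\<psi> x = 0" if "x \<notin> ?K" for x
      using that cut0[of "x $ 3"] potential_top[of x] potential_outside[of x] by (auto simp: \<psi>_def not_le)
    show "norm (\<psi> x) \<le> indicator {x. Z' < x $ 3} x * norm (potential x)" for x
      using cut0[of "x $ 3"] cutr[of "x $ 3"] by (auto simp: \<psi>_def indicator_def not_less mult_left_le_one_le)
    show "grad \<psi> x = grad potential x" if "Z < x $ 3" for x
    proof -
      have "1 < x $ 3" using that Z by simp
      then have "\<psi>' x = potential' x" using that by (auto simp: \<psi>'_def cut1 cut'0)
      then show ?thesis
        unfolding grad_def partial_deriv_def
        using frechet_derivative_at[OF \<psi>_deriv[of x]] frechet_derivative_at[OF potential_deriv[OF \<open>1 < x $ 3\<close>]] by simp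
    qed
    show "compact ?K"
    proof (rule compact_eq_bounded_closed[THEN iffD2], intro conjI)
      have "continuous_on {x::real^3. Z' \<le> x $ 3 \<and> x $ 3 \<le> M} (\<lambda>x. axis_dist x - \<rho> (x $ 3))"
        by (intro continuous_intros continuous_on_axis_dist continuous_on_compose2[OF \<rho>_cont]) (use Z in auto)
      moreover have "closed {x::real^3. Z' \<le> x $ 3 \<and> x $ 3 \<le> M}"
        by (intro closed_Collect_conj closed_Collect_le continuous_intros)
      ultimately have "closed ({x::real^3. Z' \<le> x $ 3 \<and> x $ 3 \<le> M} \<inter> (\<lambda>x. axis_dist x - \<rho> (x $ 3)) -` {..0})"
        by (intro continuous_closed_preimage) auto
      also have "{x::real^3. Z' \<le> x $ 3 \<and> x $ 3 \<le> M} \<inter> (\<lambda>x. axis_dist x - \<rho> (x $ 3)) -` {..0} = ?K" by auto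
      finally show "closed ?K" .
      show "bounded ?K"
      proof (rule boundedI)
        fix x assume x: "x \<in> ?K"
        have "norm x \<le> \<bar>x $ 1\<bar> + \<bar>x $ 2\<bar> + \<bar>x $ 3\<bar>" using norm_le_l1_cart[of x] by (simp add: sum_3)
        moreover have "\<rho> (x $ 3) \<le> \<rho> Z'" using x Z by (intro \<rho>_le) auto
        ultimately show "norm x \<le> 2 * \<rho> Z' + M" using x abs_le_axis_dist[of x] Z by auto
      qed
    qed
  qed
qed

end

text \<open>The decomposition of \<open>\<integral> w \<cdot> f\<close> for one approximant \<open>f\<close> with error at most \<open>\<epsilon>\<close>. The cutoff of
  the potential takes place between the heights \<open>Z'\<close> and \<open>Z\<close>, where \<open>w\<close> vanishes; the radius at the
  lower height enters the estimate.\<close>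

lemma horn_estimate_approximate:
  fixes \<rho> \<rho>' S S' :: "real \<Rightarrow> real" and C0 :: real
  assumes deriv: "\<And>z. z > 1 \<Longrightarrow> (\<rho> has_real_derivative \<rho>' z) (at z)" and cont': "continuous_on {1<..} \<rho>'"
    and anti: "antimono_on {1<..} \<rho>" and pos: "\<And>z. z > 1 \<Longrightarrow> \<rho> z > 0"
    and S: "\<And>t. (S has_real_derivative S' t) (at t)" "continuous_on UNIV S'" "\<And>t. \<bar>S' t\<bar> \<le> C0"
      "\<And>t. t \<le> 0 \<Longrightarrow> S t = 0" "\<And>t. t \<ge> 1 \<Longrightarrow> S t = 1" "\<And>t. 0 \<le> S t \<and> S t \<le> 1"
      "\<And>t. t < 0 \<or> t > 1 \<Longrightarrow> S' t = 0"
    and Z: "1 < Z'" "Z' < Z" and w: "w \<in> X_N (horn \<rho>)"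
    and supp: "ess_supp (horn \<rho>) w \<subseteq> {x. Z < x $ 3}" and \<epsilon>: "\<epsilon> > 0"
  defines "N \<equiv> L2_norm (horn \<rho>) w" and "c \<equiv> L2_norm (horn \<rho>) (weak_curl (horn \<rho>) w)"
    and "d \<equiv> L2_norm (horn \<rho>) (weak_div (horn \<rho>) w)" and "B \<equiv> 24 * (2304 + 16 * (288 * C0)\<^sup>2)"
  shows "N\<^sup>2 \<le> N * \<epsilon> + d * (16 * \<rho> Z' * sqrt (2 * N\<^sup>2 + 2 * \<epsilon>\<^sup>2)) + N * (sqrt B * \<rho> Z' * sqrt (2 * c\<^sup>2 + 2 * \<epsilon>\<^sup>2))"
proof -
  let ?\<Omega> = "horn \<rho>" and ?M = "lebesgue_on (horn \<rho>)"
  have \<rho>_cont: "continuous_on {1<..} \<rho>"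
    by (intro continuous_at_imp_continuous_on) (auto intro!: DERIV_isCont[OF deriv])
  have \<Omega>: "open ?\<Omega>" by (rule open_horn[OF \<rho>_cont])
  have w0: "w \<in> H0_curl ?\<Omega>" and wdiv: "w \<in> H_div ?\<Omega>" using w by (auto simp: X_N_def)
  have wL: "w \<in> L2 ?\<Omega>" using wdiv by (simp add: H_div_def)
  have wcurl: "weak_curl ?\<Omega> w \<in> L2 ?\<Omega>"
    using w0 is_weak_curl_L2[OF is_weak_curl_weak_curl[of w ?\<Omega>]] by (simp add: H0_curl_def)
  have isdiv: "is_weak_div ?\<Omega> w (weak_div ?\<Omega> w)" by (rule is_weak_div_weak_div[OF wdiv])
  then have dL: "weak_div ?\<Omega> w \<in> L2 ?\<Omega>" by (simp add: is_weak_div_def)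
  obtain \<phi> where \<phi>: "\<phi> \<in> test_functions ?\<Omega>" "L2_norm ?\<Omega> (\<lambda>x. w x - \<phi> x) < \<epsilon>"
    "L2_norm ?\<Omega> (\<lambda>x. weak_curl ?\<Omega> w x - curl \<phi> x) < \<epsilon>"
    by (rule H0_curl_approximation[OF \<Omega> w0 \<epsilon>])
  obtain K where K: "\<And>k. C_k k \<phi>" "compact K" "K \<subseteq> ?\<Omega>" "\<And>x. x \<notin> K \<Longrightarrow> \<phi> x = 0"
    using test_functionsE[OF \<phi>(1)] by metis
  note \<phi>W = is_weak_curl_test_function[OF \<Omega> \<phi>(1)]
  have cpL: "curl \<phi> \<in> L2 ?\<Omega>" by (rule is_weak_curl_L2[OF \<phi>W(1)])
  obtain \<kappa> where \<kappa>: "0 < \<kappa>" "\<kappa> < 1" "\<And>x. x \<in> K \<Longrightarrow> axis_dist x < \<kappa> * \<rho> (x $ 3)"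
    using compact_in_horn_margin[OF \<rho>_cont pos K(2,3)] by blast
  obtain H where H: "H > 0" "\<And>x. x \<in> K \<Longrightarrow> norm x \<le> H"
    using compact_imp_bounded[OF K(2)] by (auto simp: bounded_pos)
  define f where "f x = conj_vec (\<phi> x)" for x
  have f0: "f x = 0" if "x \<notin> K" for x using K(4)[OF that] by (simp add: f_def conj_vec_def vec_eq_iff)
  have Cf: "C_k k f" for k unfolding f_def [abs_def] by (rule C_k_bounded_linear[OF bounded_linear_conj_vec K(1)])
  have curl_f: "curl f x = conj_vec (curl \<phi> x)" for x unfolding f_def [abs_def] by (rule curl_conj_vec[OF K(1)])
  have \<kappa>\<rho>_deriv: "((\<lambda>z. \<kappa> * \<rho> z) has_real_derivative \<kappa> * \<rho>' z) (at z)" if "z > 1" for z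
    by (rule DERIV_cmult[OF deriv[OF that]])
  have \<kappa>\<rho>_anti: "antimono_on {1<..} (\<lambda>z. \<kappa> * \<rho> z)"
    using anti \<kappa> by (auto simp: monotone_on_def intro!: mult_left_mono)
  obtain \<mu> \<mu>' where \<mu>: "\<And>z. z > 1 \<Longrightarrow> \<mu> z > 0" "\<And>z. z > 1 \<Longrightarrow> 2 * \<mu> z \<le> \<kappa> * \<rho> z"
    "\<And>z. z > 1 \<Longrightarrow> \<kappa> * \<rho> (z + 2 * \<mu> z) \<le> 2 * \<mu> z"
    "\<And>z. z > 1 \<Longrightarrow> (\<mu> has_real_derivative \<mu>' z) (at z)"
    "\<And>z. z > 1 \<Longrightarrow> \<bar>\<mu>' z\<bar> \<le> 1" "continuous_on {1<..} \<mu>'"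
    using exit_scale_exists[of "\<lambda>z. \<kappa> * \<rho> z" "\<lambda>z. \<kappa> * \<rho>' z", OF \<kappa>\<rho>_deriv _ \<kappa>\<rho>_anti] \<kappa>(1) pos cont'
    by (metis continuous_on_mult_left mult_pos_pos)
  interpret horn_field f "H + 1" "\<lambda>z. \<kappa> * \<rho> z" \<mu> \<mu>' S S' C0
  proof
    show "f x = 0" if "x $ 3 \<ge> H + 1" for x
    proof (rule f0)
      show "x \<notin> K" using H(2)[of x] component_le_norm_cart[of x 3] that by auto
    qed
    show "f x = 0" if "x $ 3 > 1" "\<kappa> * \<rho> (x $ 3) \<le> axis_dist x" for x
      using \<kappa>(3)[of x] that by (intro f0) auto
  qed (use Cf H \<mu> S \<kappa>\<rho>_anti \<rho>_cont in \<open>auto intro!: continuous_intros\<close>)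
  obtain \<psi> where \<psi>: "C_k (Suc 0) \<psi>"
    "compact {x. Z' \<le> x $ 3 \<and> x $ 3 \<le> H + 1 \<and> axis_dist x \<le> \<kappa> * \<rho> (x $ 3)}"
    "\<And>x. x \<notin> {x. Z' \<le> x $ 3 \<and> x $ 3 \<le> H + 1 \<and> axis_dist x \<le> \<kappa> * \<rho> (x $ 3)} \<Longrightarrow> \<psi> x = 0"
    "\<And>x. norm (\<psi> x) \<le> indicator {x. Z' < x $ 3} x * norm (potential x)"
    "\<And>x. Z < x $ 3 \<Longrightarrow> grad \<psi> x = grad potential x"
    by (rule cutoff_potential[OF Z]; rule that; (assumption | blast))
  let ?K = "{x. Z' \<le> x $ 3 \<and> x $ 3 \<le> H + 1 \<and> axis_dist x \<le> \<kappa> * \<rho> (x $ 3)}"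
  have K\<Omega>: "?K \<subseteq> ?\<Omega>"
  proof
    fix x assume x: "x \<in> ?K"
    then have "1 < x $ 3" using Z by auto
    moreover have "\<kappa> * \<rho> (x $ 3) < 1 * \<rho> (x $ 3)" using \<kappa> pos[OF \<open>1 < x $ 3\<close>] by (intro mult_strict_right_mono)
    ultimately show "x \<in> ?\<Omega>" using x by (auto simp: horn_eq)
  qed
  obtain a where a: "K \<union> ?K \<subseteq> cbox (-a) a"
    by (rule bounded_subset_cbox_symmetric[OF compact_imp_bounded[OF compact_Un[OF K(2) \<psi>(2)]]])
  have s\<psi>: "\<psi> x = 0" if "x \<notin> cbox (-a) a" for x by (rule \<psi>(3)) (use a that in blast)
  have c\<psi>: "continuous_on UNIV \<psi>" by (rule C_k_continuous[OF \<psi>(1)])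
  have cg: "continuous_on UNIV (grad \<psi>)"
    unfolding grad_def partial_deriv_def using C_k_SucD(2)[OF \<psi>(1)] by (intro continuous_on_vec_lambda) simp
  have g0: "grad \<psi> x = 0" if "x \<notin> cbox (-a) a" for x
  proof -
    have "partial_deriv i \<psi> x = 0" for i
      unfolding partial_deriv_def
      by (rule frechet_derivative_outside_support[of ?K]) (use \<psi>(3) compact_imp_closed[OF \<psi>(2)] a that in auto)
    then show ?thesis by (simp add: grad_def vec_eq_iff)
  qed
  have \<psi>L: "\<psi> \<in> L2 ?\<Omega>" by (rule compactly_supported_lebesgue_on(1)[OF c\<psi> s\<psi> \<Omega>])
  have gL: "grad \<psi> \<in> L2 ?\<Omega>" by (rule compactly_supported_lebesgue_on(1)[OF cg g0 \<Omega>])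
  have fL: "f \<in> L2 ?\<Omega>" unfolding f_def [abs_def] by (rule L2_conj_vec(1)[OF \<phi>W(2)])
  \<comment> \<open>Since \<open>w\<close> vanishes below \<open>Z\<close>, only this part of \<open>f - grad \<psi>\<close> is paired with \<open>w\<close>.\<close>
  define g where "g x = indicator {x. Z < x $ 3} x *\<^sub>R (f x - grad \<psi> x)" for x
  let ?A = "{x::real^3. Z' < x $ 3}"
  have R: "0 \<le> \<kappa> * \<rho> Z'" "\<kappa> * \<rho> Z' \<le> \<rho> Z'" "0 \<le> \<rho> Z'"
    using \<kappa> pos[OF Z(1)] by (auto simp: mult_left_le_one_le)
  have B0: "B \<ge> 0" by (simp add: B_def)
  have curl_bound: "(\<integral>\<^sup>+x. indicator ?A x * ennreal ((norm (curl f x))\<^sup>2) \<partial>lborel) \<le> ennreal ((L2_norm ?\<Omega> (curl \<phi>))\<^sup>2)"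
  proof -
    have c: "continuous_on UNIV (curl \<phi>)" by (rule continuous_on_curl[OF K(1)])
    have z: "curl \<phi> x = 0" if "x \<notin> K" for x
    proof -
      have "partial_deriv i (\<lambda>y. \<phi> y $ j) x = 0" for i j
        unfolding partial_deriv_def
        by (rule frechet_derivative_outside_support[of K]) (use K(4) compact_imp_closed[OF K(2)] that in auto)
      then show ?thesis by (simp add: curl_def vec_eq_iff forall_3)
    qed
    have "(\<integral>\<^sup>+x. indicator ?A x * ennreal ((norm (curl f x))\<^sup>2) \<partial>lborel) \<le> (\<integral>\<^sup>+x. ennreal ((norm (curl \<phi> x))\<^sup>2) \<partial>lborel)"
      by (intro nn_integral_mono) (auto simp: indicator_def curl_f)
    also have "\<dots> = ennreal ((L2_norm ?\<Omega> (curl \<phi>))\<^sup>2)"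
      by (rule nn_integral_compact_support[OF c _ _ \<Omega>, of "-a" a]) (use z a K(3) in blast)+
    finally show ?thesis .
  qed
  have f_bound: "(\<integral>\<^sup>+x. indicator ?A x * ennreal ((norm (f x))\<^sup>2) \<partial>lborel) \<le> ennreal ((L2_norm ?\<Omega> \<phi>)\<^sup>2)"
  proof -
    have "(\<integral>\<^sup>+x. indicator ?A x * ennreal ((norm (f x))\<^sup>2) \<partial>lborel) \<le> (\<integral>\<^sup>+x. ennreal ((norm (\<phi> x))\<^sup>2) \<partial>lborel)"
      by (intro nn_integral_mono) (auto simp: indicator_def f_def)
    also have "\<dots> = ennreal ((L2_norm ?\<Omega> \<phi>)\<^sup>2)"
      by (rule nn_integral_compact_support[OF C_k_continuous[OF K(1)] _ _ \<Omega>, of "-a" a]) (use K(4) a K(3) in blast)+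
    finally show ?thesis .
  qed
  have AZ: "{x::real^3. Z < x $ 3} \<in> sets borel" by (intro borel_open open_Collect_less continuous_intros)
  have fg_meas: "(\<lambda>x. f x - grad \<psi> x) \<in> borel_measurable borel"
    by (intro borel_measurable_continuous_onI continuous_intros cg C_k_continuous[OF Cf])
  have gm: "g \<in> borel_measurable borel"
    unfolding g_def [abs_def] using AZ fg_meas by (intro borel_measurable_scaleR borel_measurable_indicator) auto
  have to_M: "h \<in> borel_measurable ?M" if "h \<in> borel_measurable borel" for h :: "real^3 \<Rightarrow> 'z::topological_space"
    using that by (simp add: measurable_completion measurable_restrict_space1)
  have g_le: "g \<in> L2 ?\<Omega>" "(L2_norm ?\<Omega> g)\<^sup>2 \<le> B * (\<kappa> * \<rho> Z')\<^sup>2 * (L2_norm ?\<Omega> (curl \<phi>))\<^sup>2"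
  proof -
    have "(\<integral>\<^sup>+x. ennreal ((norm (g x))\<^sup>2) \<partial>lborel) \<le> (\<integral>\<^sup>+x. indicator ?A x * ennreal ((norm (f x - grad potential x))\<^sup>2) \<partial>lborel)"
      by (intro nn_integral_mono) (use \<psi>(5) Z in \<open>auto simp: g_def indicator_def\<close>)
    also have "\<dots> \<le> ennreal (B * (\<kappa> * \<rho> Z')\<^sup>2) * (\<integral>\<^sup>+x. indicator ?A x * ennreal ((norm (curl f x))\<^sup>2) \<partial>lborel)"
      unfolding B_def by (rule integral_gradient_error[OF Z(1)])
    also have "\<dots> \<le> ennreal (B * (\<kappa> * \<rho> Z')\<^sup>2) * ennreal ((L2_norm ?\<Omega> (curl \<phi>))\<^sup>2)"
      by (intro mult_left_mono curl_bound) simp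
    also have "\<dots> = ennreal (B * (\<kappa> * \<rho> Z')\<^sup>2 * (L2_norm ?\<Omega> (curl \<phi>))\<^sup>2)"
      using B0 by (simp add: ennreal_mult)
    finally have le: "(\<integral>\<^sup>+x. ennreal ((norm (g x))\<^sup>2) \<partial>lborel) \<le> ennreal (B * (\<kappa> * \<rho> Z')\<^sup>2 * (L2_norm ?\<Omega> (curl \<phi>))\<^sup>2)" .
    have Fm: "(\<lambda>x. ennreal ((norm (g x))\<^sup>2)) \<in> borel_measurable borel" using gm by measurable
    have nn: "0 \<le> B * (\<kappa> * \<rho> Z')\<^sup>2 * (L2_norm ?\<Omega> (curl \<phi>))\<^sup>2" using B0 by simp
    show "g \<in> L2 ?\<Omega>" "(L2_norm ?\<Omega> g)\<^sup>2 \<le> B * (\<kappa> * \<rho> Z')\<^sup>2 * (L2_norm ?\<Omega> (curl \<phi>))\<^sup>2"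
      using L2_norm_le_nn_integral[OF \<Omega> to_M[OF gm] Fm order_refl le nn] by auto
  qed
  have \<psi>_le: "(L2_norm ?\<Omega> \<psi>)\<^sup>2 \<le> (16 * (\<kappa> * \<rho> Z'))\<^sup>2 * (L2_norm ?\<Omega> \<phi>)\<^sup>2"
  proof -
    have pw: "ennreal ((norm (\<psi> x))\<^sup>2) \<le> indicator ?A x * ennreal ((norm (potential x))\<^sup>2)" for x
      using \<psi>(4)[of x] power_mono[OF \<psi>(4)[of x] norm_ge_zero, of 2] by (auto simp: indicator_def intro: ennreal_leI)
    have "(\<integral>\<^sup>+x. ennreal ((norm (\<psi> x))\<^sup>2) \<partial>lborel) \<le> (\<integral>\<^sup>+x. indicator ?A x * ennreal ((norm (potential x))\<^sup>2) \<partial>lborel)"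
      by (intro nn_integral_mono pw)
    also have "\<dots> \<le> ennreal ((16 * (\<kappa> * \<rho> Z'))\<^sup>2) * (\<integral>\<^sup>+x. indicator ?A x * ennreal ((norm (f x))\<^sup>2) \<partial>lborel)"
      by (rule integral_potential_square[OF Z(1)])
    also have "\<dots> \<le> ennreal ((16 * (\<kappa> * \<rho> Z'))\<^sup>2) * ennreal ((L2_norm ?\<Omega> \<phi>)\<^sup>2)"
      by (intro mult_left_mono f_bound) simp
    also have "\<dots> = ennreal ((16 * (\<kappa> * \<rho> Z'))\<^sup>2 * (L2_norm ?\<Omega> \<phi>)\<^sup>2)" by (simp add: ennreal_mult)
    finally have le: "(\<integral>\<^sup>+x. ennreal ((norm (\<psi> x))\<^sup>2) \<partial>lborel) \<le> ennreal ((16 * (\<kappa> * \<rho> Z'))\<^sup>2 * (L2_norm ?\<Omega> \<phi>)\<^sup>2)" .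
    have pm: "\<psi> \<in> borel_measurable borel" by (rule borel_measurable_continuous_onI[OF c\<psi>])
    then have Fm: "(\<lambda>x. ennreal ((norm (\<psi> x))\<^sup>2)) \<in> borel_measurable borel" by measurable
    show ?thesis
      by (rule L2_norm_le_nn_integral(2)[OF \<Omega> to_M[OF pm] Fm order_refl le]) simp
  qed
  have norm_g: "L2_norm ?\<Omega> g \<le> sqrt B * \<rho> Z' * sqrt (2 * c\<^sup>2 + 2 * \<epsilon>\<^sup>2)"
  proof -
    have "(L2_norm ?\<Omega> (curl \<phi>))\<^sup>2 \<le> 2 * c\<^sup>2 + 2 * (L2_norm ?\<Omega> (\<lambda>x. weak_curl ?\<Omega> w x - curl \<phi> x))\<^sup>2"
      unfolding c_def by (rule L2_diff(2)[OF wcurl cpL])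
    also have "\<dots> \<le> 2 * c\<^sup>2 + 2 * \<epsilon>\<^sup>2"
      using \<phi>(3) L2_norm_nonneg by (intro add_left_mono mult_left_mono power_mono) auto
    finally have 1: "(L2_norm ?\<Omega> (curl \<phi>))\<^sup>2 \<le> 2 * c\<^sup>2 + 2 * \<epsilon>\<^sup>2" .
    have "(L2_norm ?\<Omega> g)\<^sup>2 \<le> B * (\<kappa> * \<rho> Z')\<^sup>2 * (2 * c\<^sup>2 + 2 * \<epsilon>\<^sup>2)"
      using B0 by (intro order_trans[OF g_le(2)] mult_left_mono 1) auto
    also have "\<dots> \<le> B * (\<rho> Z')\<^sup>2 * (2 * c\<^sup>2 + 2 * \<epsilon>\<^sup>2)"
      using B0 R by (intro mult_right_mono mult_left_mono power_mono) auto
    finally have "L2_norm ?\<Omega> g \<le> sqrt (B * (\<rho> Z')\<^sup>2 * (2 * c\<^sup>2 + 2 * \<epsilon>\<^sup>2))" by (rule real_le_rsqrt)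
    then show ?thesis using R by (simp add: real_sqrt_mult)
  qed
  have norm_\<psi>: "L2_norm ?\<Omega> \<psi> \<le> 16 * \<rho> Z' * sqrt (2 * N\<^sup>2 + 2 * \<epsilon>\<^sup>2)"
  proof -
    have "(L2_norm ?\<Omega> \<phi>)\<^sup>2 \<le> 2 * N\<^sup>2 + 2 * (L2_norm ?\<Omega> (\<lambda>x. w x - \<phi> x))\<^sup>2"
      unfolding N_def by (rule L2_diff(2)[OF wL \<phi>W(2)])
    also have "\<dots> \<le> 2 * N\<^sup>2 + 2 * \<epsilon>\<^sup>2"
      using \<phi>(2) L2_norm_nonneg by (intro add_left_mono mult_left_mono power_mono) auto
    finally have 1: "(L2_norm ?\<Omega> \<phi>)\<^sup>2 \<le> 2 * N\<^sup>2 + 2 * \<epsilon>\<^sup>2" .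
    have "(L2_norm ?\<Omega> \<psi>)\<^sup>2 \<le> (16 * (\<kappa> * \<rho> Z'))\<^sup>2 * (2 * N\<^sup>2 + 2 * \<epsilon>\<^sup>2)"
      by (intro order_trans[OF \<psi>_le] mult_left_mono 1) auto
    also have "\<dots> \<le> (16 * \<rho> Z')\<^sup>2 * (2 * N\<^sup>2 + 2 * \<epsilon>\<^sup>2)"
      using R by (intro mult_right_mono power_mono) auto
    finally have "L2_norm ?\<Omega> \<psi> \<le> sqrt ((16 * \<rho> Z')\<^sup>2 * (2 * N\<^sup>2 + 2 * \<epsilon>\<^sup>2))" by (rule real_le_rsqrt)
    then show ?thesis using R by (simp add: real_sqrt_mult)
  qed
  let ?cw = "\<lambda>x. conj_vec (w x)"
  have cwL: "?cw \<in> L2 ?\<Omega>" by (rule L2_conj_vec(1)[OF wL])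
  have dif: "(\<lambda>x. ?cw x - f x) \<in> L2 ?\<Omega>" "(\<lambda>x. f x - grad \<psi> x) \<in> L2 ?\<Omega>"
    by (rule L2_diff(1)[OF cwL fL], rule L2_diff(1)[OF fL gL])
  have "?cw x - f x = conj_vec (w x - \<phi> x)" for x
    by (simp add: f_def conj_vec_def vec_eq_iff)
  then have dif_lt: "L2_norm ?\<Omega> (\<lambda>x. ?cw x - f x) < \<epsilon>"
    using L2_conj_vec(2)[OF L2_diff(1)[OF wL \<phi>W(2)]] \<phi>(2) by simp
  have lin: "cdot p (q + r) = cdot p q + cdot p r" for p q r
    by (simp add: cdot_def algebra_simps sum.distrib)
  have "complex_of_real (N\<^sup>2) = (\<integral>x. cdot (w x) (?cw x) \<partial>?M)"
    unfolding N_def L2_norm_power2 cdot_conj_vec by (rule integral_complex_of_real[symmetric])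
  also have "\<dots> = (\<integral>x. (cdot (w x) (?cw x - f x) + cdot (w x) (grad \<psi> x)) + cdot (w x) (f x - grad \<psi> x) \<partial>?M)"
    by (intro Bochner_Integration.integral_cong refl) (simp add: lin[symmetric])
  also have "\<dots> = (\<integral>x. cdot (w x) (?cw x - f x) \<partial>?M) + (\<integral>x. cdot (w x) (grad \<psi> x) \<partial>?M) + (\<integral>x. cdot (w x) (f x - grad \<psi> x) \<partial>?M)"
    using L2_cdot(1)[OF wL dif(1)] L2_cdot(1)[OF wL gL] L2_cdot(1)[OF wL dif(2)] by simp
  also have "(\<integral>x. cdot (w x) (f x - grad \<psi> x) \<partial>?M) = (\<integral>x. cdot (w x) (g x) \<partial>?M)"
  proof (rule integral_cong_AE)
    show "(\<lambda>x. cdot (w x) (f x - grad \<psi> x)) \<in> borel_measurable ?M" "(\<lambda>x. cdot (w x) (g x)) \<in> borel_measurable ?M"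
      by (intro borel_measurable_cdot L2_borel_measurable wL dif g_le)+
    show "AE x in ?M. cdot (w x) (f x - grad \<psi> x) = cdot (w x) (g x)"
      using AE_zero_outside_ess_supp[OF \<Omega>, of w]
    proof eventually_elim
      case (elim x)
      show ?case
      proof (cases "Z < x $ 3")
        case False
        then have "w x = 0" using elim supp by auto
        then show ?thesis by (simp add: cdot_def)
      qed (simp add: g_def)
    qed
  qed
  also have "(\<integral>x. cdot (w x) (grad \<psi> x) \<partial>?M) = - (\<integral>x. weak_div ?\<Omega> w x * \<psi> x \<partial>?M)"
    by (rule is_weak_div_C1[OF \<Omega> wL isdiv \<psi>(1,2) K\<Omega> \<psi>(3)])
  finally have eq: "complex_of_real (N\<^sup>2) = (\<integral>x. cdot (w x) (?cw x - f x) \<partial>?M) + - (\<integral>x. weak_div ?\<Omega> w x * \<psi> x \<partial>?M) + (\<integral>x. cdot (w x) (g x) \<partial>?M)" .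
  have N0: "N \<ge> 0" "d \<ge> 0" by (auto simp: N_def d_def L2_norm_nonneg)
  have 1: "norm (\<integral>x. cdot (w x) (?cw x - f x) \<partial>?M) \<le> N * \<epsilon>"
    using L2_cdot(2)[OF wL dif(1)] dif_lt N0 mult_left_mono[of "L2_norm ?\<Omega> (\<lambda>x. ?cw x - f x)" \<epsilon> N]
    by (simp add: N_def)
  have 2: "norm (\<integral>x. weak_div ?\<Omega> w x * \<psi> x \<partial>?M) \<le> d * (16 * \<rho> Z' * sqrt (2 * N\<^sup>2 + 2 * \<epsilon>\<^sup>2))"
  proof -
    have m: "(\<lambda>x. weak_div ?\<Omega> w x * \<psi> x) \<in> borel_measurable ?M"
      by (intro borel_measurable_times L2_borel_measurable dL \<psi>L)
    have "norm (\<integral>x. weak_div ?\<Omega> w x * \<psi> x \<partial>?M) \<le> d * L2_norm ?\<Omega> \<psi>"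
      unfolding d_def by (rule L2_product_bound(2)[OF dL \<psi>L m]) (simp add: norm_mult)
    also have "\<dots> \<le> d * (16 * \<rho> Z' * sqrt (2 * N\<^sup>2 + 2 * \<epsilon>\<^sup>2))" by (rule mult_left_mono[OF norm_\<psi> N0(2)])
    finally show ?thesis .
  qed
  have 3: "norm (\<integral>x. cdot (w x) (g x) \<partial>?M) \<le> N * (sqrt B * \<rho> Z' * sqrt (2 * c\<^sup>2 + 2 * \<epsilon>\<^sup>2))"
    using L2_cdot(2)[OF wL g_le(1)] mult_left_mono[OF norm_g N0(1)] by (simp add: N_def)
  have "N\<^sup>2 = norm (complex_of_real (N\<^sup>2))" by (simp add: norm_power)
  also have "\<dots> \<le> norm (\<integral>x. cdot (w x) (?cw x - f x) \<partial>?M) + norm (- (\<integral>x. weak_div ?\<Omega> w x * \<psi> x \<partial>?M)) + norm (\<integral>x. cdot (w x) (g x) \<partial>?M)"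
    unfolding eq by (intro order_trans[OF norm_triangle_ineq] add_right_mono norm_triangle_ineq)
  finally show ?thesis using 1 2 3 by simp
qed

theorem theorem5p4:
  fixes \<rho> :: "real \<Rightarrow> real"
  assumes "C11_on {1<..} \<rho>"
    and "\<forall>z>1. 0 < \<rho> z"
    and "antimono_on {1<..} \<rho>"
    and "(\<rho> \<longlongrightarrow> 0) at_top"
    and "ess_liminf_at_top (\<lambda>z. ereal ((deriv \<rho> z)\<^sup>2 - \<rho> z * deriv (deriv \<rho>) z)) > -1"
  shows "\<exists>Z0>1. \<exists>C>0. \<forall>Z\<ge>Z0. \<forall>w \<in> X_N (horn \<rho>).
           ess_supp (horn \<rho>) w \<subseteq> horn \<rho> \<inter> {x. Z < x $ 3} \<longrightarrow>
           (L2_norm (horn \<rho>) w)\<^sup>2 \<le> C * (\<rho> Z)\<^sup>2 *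
             ((L2_norm (horn \<rho>) (weak_curl (horn \<rho>) w))\<^sup>2
              + (L2_norm (horn \<rho>) (weak_div (horn \<rho>) w))\<^sup>2)"
proof -
  have deriv: "(\<rho> has_real_derivative deriv \<rho> z) (at z)" if "z > 1" for z
    using assms(1) that DERIV_deriv_iff_real_differentiable by (auto simp: C11_on_def)
  have cont': "continuous_on {1<..} (deriv \<rho>)"
  proof (intro continuous_at_imp_continuous_on ballI)
    fix z :: real assume z: "z \<in> {1<..}"
    let ?K = "{(1 + z) / 2..z + 1}"
    obtain L where "L-lipschitz_on ?K (deriv \<rho>)"
      using assms(1) z unfolding C11_on_def by (metis atLeastAtMost_iff compact_Icc greaterThan_iff less_le_trans
          less_divide_eq_numeral1(1) mult_2 mult.commute add_less_cancel_right one_add_one subsetI mult_1 add_strict_left_mono)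
    then have "continuous_on ?K (deriv \<rho>)" by (rule lipschitz_on_continuous_on)
    moreover have "z \<in> interior ?K" using z by (auto simp: interior_atLeastAtMost_real)
    ultimately show "isCont (deriv \<rho>) z" by (rule continuous_on_interior)
  qed
  obtain S S' :: "real \<Rightarrow> real" and C0 where
    S: "\<And>t. (S has_real_derivative S' t) (at t)" "continuous_on UNIV S'" "\<And>t. \<bar>S' t\<bar> \<le> C0"
    "\<And>t. t \<le> 0 \<Longrightarrow> S t = 0" "\<And>t. t \<ge> 1 \<Longrightarrow> S t = 1" "\<And>t. 0 \<le> S t \<and> S t \<le> 1"
    "\<And>t. t < 0 \<or> t > 1 \<Longrightarrow> S' t = 0"
    using smooth_step_exists by blast
  define B where "B = 24 * (2304 + 16 * (288 * C0)\<^sup>2)"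
  have B0: "B > 0" by (simp add: B_def add_pos_nonneg)
  \<comment> \<open>The constant results from \<open>N \<le> \<rho> Z (16 sqrt 2 d + sqrt (2 B) c)\<close> and \<open>(a + b)\<^sup>2 \<le> 2 a\<^sup>2 + 2 b\<^sup>2\<close>.\<close>
  have main: "(L2_norm (horn \<rho>) w)\<^sup>2 \<le> (1024 + 4 * B) * (\<rho> Z)\<^sup>2 *
             ((L2_norm (horn \<rho>) (weak_curl (horn \<rho>) w))\<^sup>2 + (L2_norm (horn \<rho>) (weak_div (horn \<rho>) w))\<^sup>2)"
    if Z: "Z \<ge> 2" and w: "w \<in> X_N (horn \<rho>)" and supp: "ess_supp (horn \<rho>) w \<subseteq> horn \<rho> \<inter> {x. Z < x $ 3}" for Z w
  proof -
    define N where "N = L2_norm (horn \<rho>) w"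
    define c where "c = L2_norm (horn \<rho>) (weak_curl (horn \<rho>) w)"
    define d where "d = L2_norm (horn \<rho>) (weak_div (horn \<rho>) w)"
    have nn: "N \<ge> 0" "c \<ge> 0" "d \<ge> 0" "\<rho> Z > 0" using assms(2) Z by (auto simp: N_def c_def d_def L2_norm_nonneg)
    have supp': "ess_supp (horn \<rho>) w \<subseteq> {x. Z < x $ 3}" using supp by blast
    have pos: "\<And>z. z > 1 \<Longrightarrow> \<rho> z > 0" using assms(2) by blast
    have approx: "N\<^sup>2 \<le> N * \<epsilon> + d * (16 * \<rho> Z' * sqrt (2 * N\<^sup>2 + 2 * \<epsilon>\<^sup>2)) + N * (sqrt B * \<rho> Z' * sqrt (2 * c\<^sup>2 + 2 * \<epsilon>\<^sup>2))"
      if "1 < Z'" "Z' < Z" "\<epsilon> > 0" for Z' \<epsilon>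
      unfolding N_def c_def d_def B_def
      by (rule horn_estimate_approximate[OF deriv cont' assms(3) pos S that(1,2) w supp' that(3)])
    define E where "E r \<longleftrightarrow> N\<^sup>2 \<le> d * (16 * r * (sqrt 2 * N)) + N * (sqrt B * r * (sqrt 2 * c))" for r
    \<comment> \<open>First \<open>\<epsilon> \<rightarrow> 0\<close>, then \<open>Z' \<rightarrow> Z\<close> from below.\<close>
    have step1: "E (\<rho> Z')" if Z': "1 < Z'" "Z' < Z" for Z'
    proof -
      have "((\<lambda>\<epsilon>. N * \<epsilon> + d * (16 * \<rho> Z' * sqrt (2 * N\<^sup>2 + 2 * \<epsilon>\<^sup>2)) + N * (sqrt B * \<rho> Z' * sqrt (2 * c\<^sup>2 + 2 * \<epsilon>\<^sup>2)))
          \<longlongrightarrow> N * 0 + d * (16 * \<rho> Z' * sqrt (2 * N\<^sup>2 + 2 * 0\<^sup>2)) + N * (sqrt B * \<rho> Z' * sqrt (2 * c\<^sup>2 + 2 * 0\<^sup>2))) (at_right 0)"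
        by (intro tendsto_intros)
      moreover have "eventually (\<lambda>\<epsilon>. N\<^sup>2 \<le> N * \<epsilon> + d * (16 * \<rho> Z' * sqrt (2 * N\<^sup>2 + 2 * \<epsilon>\<^sup>2))
          + N * (sqrt B * \<rho> Z' * sqrt (2 * c\<^sup>2 + 2 * \<epsilon>\<^sup>2))) (at_right (0::real))"
        using approx[OF Z'] by (auto simp: eventually_at_filter)
      ultimately have "N\<^sup>2 \<le> N * 0 + d * (16 * \<rho> Z' * sqrt (2 * N\<^sup>2 + 2 * 0\<^sup>2)) + N * (sqrt B * \<rho> Z' * sqrt (2 * c\<^sup>2 + 2 * 0\<^sup>2))"
        by (rule tendsto_lowerbound) simp
      then show ?thesis using nn by (simp add: E_def real_sqrt_mult)
    qed
    have "E (\<rho> Z)"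
    proof -
      have "isCont \<rho> Z" using deriv[of Z] Z by (auto intro: DERIV_isCont)
      then have "(\<rho> \<longlongrightarrow> \<rho> Z) (at_left Z)" by (simp add: isCont_def filterlim_at_split)
      then have "((\<lambda>Z'. d * (16 * \<rho> Z' * (sqrt 2 * N)) + N * (sqrt B * \<rho> Z' * (sqrt 2 * c)))
          \<longlongrightarrow> d * (16 * \<rho> Z * (sqrt 2 * N)) + N * (sqrt B * \<rho> Z * (sqrt 2 * c))) (at_left Z)"
        by (intro tendsto_intros)
      moreover have "eventually (\<lambda>Z'. N\<^sup>2 \<le> d * (16 * \<rho> Z' * (sqrt 2 * N)) + N * (sqrt B * \<rho> Z' * (sqrt 2 * c))) (at_left Z)"
        using step1 Z unfolding E_def eventually_at_left_real by (auto simp: eventually_at_left[of 1 Z] intro!: exI[of _ 1])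
      ultimately show ?thesis unfolding E_def by (rule tendsto_lowerbound) simp
    qed
    then have *: "N * N \<le> N * (\<rho> Z * (16 * sqrt 2 * d + sqrt B * sqrt 2 * c))"
      by (simp add: E_def power2_eq_square algebra_simps)
    have "N \<le> \<rho> Z * (16 * sqrt 2 * d + sqrt B * sqrt 2 * c)"
    proof (cases "N = 0")
      case True
      then show ?thesis using nn B0 by simp
    next
      case False
      then show ?thesis using * nn(1) by simp
    qed
    then have "N\<^sup>2 \<le> (\<rho> Z * (16 * sqrt 2 * d + sqrt B * sqrt 2 * c))\<^sup>2"
      using nn by (intro power_mono)
    also have "\<dots> = (\<rho> Z)\<^sup>2 * (16 * sqrt 2 * d + sqrt B * sqrt 2 * c)\<^sup>2" by (simp add: power_mult_distrib)
    also have "\<dots> \<le> (\<rho> Z)\<^sup>2 * ((1024 + 4 * B) * (c\<^sup>2 + d\<^sup>2))"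
    proof (rule mult_left_mono)
      have "(16 * sqrt 2 * d + sqrt B * sqrt 2 * c)\<^sup>2 \<le> 2 * (16 * sqrt 2 * d)\<^sup>2 + 2 * (sqrt B * sqrt 2 * c)\<^sup>2"
        using sum_squares_bound[of "16 * sqrt 2 * d" "sqrt B * sqrt 2 * c"] by (simp add: power2_sum)
      also have "\<dots> = 1024 * d\<^sup>2 + 4 * B * c\<^sup>2"
        using B0 by (simp add: power_mult_distrib)
      also have "\<dots> \<le> (1024 + 4 * B) * (c\<^sup>2 + d\<^sup>2)"
        using B0 by (simp add: algebra_simps)
      finally show "(16 * sqrt 2 * d + sqrt B * sqrt 2 * c)\<^sup>2 \<le> (1024 + 4 * B) * (c\<^sup>2 + d\<^sup>2)" .
    qed simp
    finally show ?thesis unfolding N_def c_def d_def by (simp add: mult_ac)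
  qed
  have "0 < 1024 + 4 * B" using B0 by simp
  with main have "\<exists>C>0. \<forall>Z\<ge>2. \<forall>w \<in> X_N (horn \<rho>).
           ess_supp (horn \<rho>) w \<subseteq> horn \<rho> \<inter> {x. Z < x $ 3} \<longrightarrow>
           (L2_norm (horn \<rho>) w)\<^sup>2 \<le> C * (\<rho> Z)\<^sup>2 *
             ((L2_norm (horn \<rho>) (weak_curl (horn \<rho>) w))\<^sup>2
              + (L2_norm (horn \<rho>) (weak_div (horn \<rho>) w))\<^sup>2)"
    by blast
  moreover have "(1::real) < 2" by simp
  ultimately show ?thesis by blast
qed

end
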